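(* Let $\ell\ge1$, $k\ge2$ and $d\ge1$ be integers, and consider the operator $\mathcal{P}$ acting on the space $\mathcal{F}$ (both defined in the context). (1) If $g(\boldsymbol x)=\sum_{\boldsymbol m\in\mathbb{Z}_+^d}\alpha(\boldsymbol m)H_{\boldsymbol m}(\boldsymbol x)\in L^2(\mathbb{R}^d,\mathrm{d}\gamma_d)$ and if $\varphi:\mathcal{M}\to\mathbb{C}$ is defined by $\varphi(M)=\prod_{i=1}^{\ell}\prod_{j=1}^{k}\alpha(\boldsymbol m^{i,j})$ for any $M=[\boldsymbol m^{i,j}]\in\mathcal{M}$, then $$\int_{-1/2}^{1/2}\bigg(\int_{\mathbb{R}^d}|\mathcal{H}^t g(\boldsymbol x)|^{2k}\,\mathrm{d}\gamma_d(\boldsymbol x)\bigg)^{\ell}\mathrm{d}t=\langle\varphi,\mathcal{P}\varphi\rangle_{\mathcal{F}}\quad\text{and}\quad\bigg(\int_{\mathbb{R}^d}|g(\boldsymbol x)|^2\,\mathrm{d}\gamma_d(\boldsymbol x)\bigg)^{k\ell}=\|\varphi\|_{\mathcal{F}}^2 .$$ (2) Let $S\ge0$ be an integer and let $\mathcal{P}_S$ be the restriction of $\mathcal{P}$ to $\mathcal{F}_S$ (recall that $\mathcal{P}(\mathcal{F}_S)\subset\mathcal{F}_S$). Then $\mathcal{P}_S^2=\mathcal{P}_S$ (hence $\mathcal{P}_S$ is a projection) if and only if $(k-1)\ell d/2=1$. In this case, $\mathcal{P}$ is well-defined on the whole of $\mathcal{F}$ and it is also a projection. (3) In general, if $\mu:=(k-1)\ell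 d/2>1$, then $$\|\mathcal{P}_S\|_{\mathcal{F}_S\to\mathcal{F}_S}=\frac{\mu(\mu+1)\cdots(\mu+\lfloor S/2\rfloor-1)}{\lfloor S/2\rfloor!}\sim\frac{S^{\mu-1}}{2^{\mu-1}\Gamma(\mu)},\qquad S\to\infty,$$ where the equality holds for every integer $S\ge0$. In particular, $\mathcal{P}$ is not bounded on $\mathcal{F}$ for $\mu>1$.
   Context: Notation: $\mathbb{Z}_+=\{0,1,2,\dots\}$; for $\boldsymbol m=(m_1,\dots,m_d)\in\mathbb{Z}_+^d$, $|\boldsymbol m|=m_1+\dots+m_d$ and $\boldsymbol m!=m_1!\cdots m_d!$. $\mathrm{d}\gamma_d(\boldsymbol x)=(2\pi)^{-d/2}e^{-\|\boldsymbol x\|^2/2}\,\mathrm{d}\boldsymbol x$. $H_m(x)$ are the monic orthogonal (Hermite) polynomials for $(2\pi)^{-1/2}e^{-x^2/2}\,\mathrm{d}x$ on $\mathbb{R}$, and $H_{\boldsymbol m}(\boldsymbol x)=H_{m_1}(x_1)\cdots H_{m_d}(x_d)$; these form an orthogonal basis of $L^2(\mathbb{R}^d,\mathrm{d}\gamma_d)$ with $\int|H_{\boldsymbol m}|^2\,\mathrm{d}\gamma_d=\boldsymbol m!$. Set $\lambda=\sqrt{1/k}$. For $t\in\mathbb{R}$, $\mathcal{H}^t$ is the linear operator on $L^2(\mathbb{R}^d,\mathrm{d}\gamma_d)$ determined by $\mathcal{H}^t:H_{\boldsymbol m}(\boldsymbol x)\mapsto e^{2\pi|\boldsymbol m|it}H_{\boldsymbol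 m}(\lambda\boldsymbol x)$. $\mathcal{M}$ is the set of $\ell\times k$ matrices $M=[\boldsymbol m^{i,j}]$ ($1\le i\le\ell$, $1\le j\le k$) with entries $\boldsymbol m^{i,j}\in\mathbb{Z}_+^d$; put $|M|=\sum_{i,j}|\boldsymbol m^{i,j}|$ and $M!=\prod_{i,j}\boldsymbol m^{i,j}!$. $\mathcal{F}$ is the Hilbert space of functions $\varphi:\mathcal{M}\to\mathbb{C}$ with $\sum_{M\in\mathcal{M}}|\varphi(M)|^2M!<\infty$, with inner product $\langle\varphi,\psi\rangle_{\mathcal{F}}=\sum_{M\in\mathcal{M}}\varphi(M)\overline{\psi(M)}M!$ and norm $\|\cdot\|_{\mathcal F}$. The operator $\mathcal{P}$ maps a function $\varphi:\mathcal{M}\to\mathbb{C}$ to the function $\mathcal{P}\varphi:\mathcal{M}\to\mathbb{C}$, $$\mathcal{P}\varphi(M)=\sum_{N\in\mathcal{M},\,|N|=|M|}\varphi(N)\frac{P(M,N)}{M!},$$ where, for $M=[\boldsymbol m^{i,j}]$ and $N=[\boldsymbol n^{i,j}]$, $$P(M,N)=\int_{(\mathbb{R}^d)^\ell}\prod_{i=1}^{\ell}\prod_{j=1}^{k}H_{\boldsymbol m^{i,j}}(\lambda\boldsymbol x^i)H_{\boldsymbol n^{i,j}}(\lambda\boldsymbol x^i)\,\mathrm{d}\gamma_d(\boldsymbol x^1)\cdots\mathrm{d}\gamma_d(\boldsymbol x^\ell).$$ Depending on $\ell,k,d$, the operator $\mathcal{P}$ may be unbounded, hence not defined on the whole of $\mathcal{F}$.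 For each integer $S\ge0$, $\mathcal{F}_S$ is the (finite-dimensional) subspace of functions $\varphi:\mathcal{M}\to\mathbb{C}$ with $\varphi(M)=0$ whenever $|M|\ne S$. One has $\mathcal{P}(\mathcal{F}_S)\subset\mathcal{F}_S$, the spaces $\mathcal{F}_S$ are mutually orthogonal, and $\mathcal{F}$ is the closure of their direct sum. The empty product (case $\lfloor S/2\rfloor=0$) equals $1$.
   Formalization: In (2), P_S²=P_S iff (k-1)ℓd/2=1 is shown for each S≥2 and for all S jointly; "only if" fails for S=0,1, where P_S is always a projection. In (1), ⟨φ,Pφ⟩ is summed over the levels F_S, possibly infinite, if Pφ is not in F. *)

theory Defs
  imports
    "HOL-Analysis.Analysis"
    "HOL-Computational_Algebra.Polynomial"
    "HOL-Library.Landau_Symbols"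
begin

text \<open>
  The dimensions are types: \<open>'d\<close> indexes the coordinates of Euclidean space, \<open>'l\<close> the rows and
  \<open>'k\<close> the columns of the matrices, so that \<open>d = CARD('d)\<close>, \<open>l = CARD('l)\<close>, \<open>k = CARD('k)\<close>, all
  of them at least 1.
\<close>

definition gauss :: "'a::euclidean_space measure" where
  "gauss = density lborel
     (\<lambda>x. ennreal ((2 * pi) powr (- real DIM('a) / 2) * exp (- (norm x)\<^sup>2 / 2)))"

definition hermite :: "nat \<Rightarrow> real poly" where
  "hermite = (THE h. (\<forall>m. degree (h m) = m \<and> lead_coeff (h m) = 1) \<and>
     (\<forall>m n. m \<noteq> n \<longrightarrow> (\<integral>x. poly (h m) x * poly (h n) x \<partial>gauss) = 0))"

definition mi_abs :: "nat ^ 'd \<Rightarrow> nat" where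
  "mi_abs m = (\<Sum>i\<in>UNIV. m $ i)"

definition mi_fact :: "nat ^ 'd \<Rightarrow> real" where
  "mi_fact m = (\<Prod>i\<in>UNIV. fact (m $ i))"

definition Herm :: "nat ^ 'd \<Rightarrow> real ^ 'd \<Rightarrow> real" where
  "Herm m x = (\<Prod>i\<in>UNIV. poly (hermite (m $ i)) (x $ i))"

definition lam :: "nat \<Rightarrow> real" where
  "lam k = sqrt (1 / real k)"

definition L2 :: "'a measure \<Rightarrow> ('a \<Rightarrow> complex) set" where
  "L2 M = {f. f \<in> borel_measurable M \<and> integrable M (\<lambda>x. (cmod (f x))\<^sup>2)}"

text \<open>
  Bounded operators on the Hilbert space of square integrable functions, acting on
  representatives. Linearity and boundedness together make them respect almost everywhere equality.
\<close>

definition bounded_L2_operator ::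
    "'a measure \<Rightarrow> (('a \<Rightarrow> complex) \<Rightarrow> ('a \<Rightarrow> complex)) \<Rightarrow> bool" where
  "bounded_L2_operator M T \<longleftrightarrow>
     (\<forall>f\<in>L2 M. T f \<in> L2 M) \<and>
     (\<forall>f\<in>L2 M. \<forall>g\<in>L2 M. \<forall>a b. AE x in M. T (\<lambda>x. a * f x + b * g x) x = a * T f x + b * T g x) \<and>
     (\<exists>C. \<forall>f\<in>L2 M. (\<integral>x. (cmod (T f x))\<^sup>2 \<partial>M) \<le> C * (\<integral>x. (cmod (f x))\<^sup>2 \<partial>M))"

definition has_hermite_expansion :: "(real ^ 'd \<Rightarrow> complex) \<Rightarrow> (nat ^ 'd \<Rightarrow> complex) \<Rightarrow> bool" where
  "has_hermite_expansion g \<alpha> \<longleftrightarrow>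
     ((\<lambda>A. \<integral>x. (cmod (g x - (\<Sum>m\<in>A. \<alpha> m * of_real (Herm m x))))\<^sup>2 \<partial>gauss) \<longlongrightarrow> 0)
       (finite_subsets_at_top UNIV)"

text \<open>
  The bounded operator determined by its values on the Hermite basis. It is unique only up to
  almost everywhere equality of the functions \<open>Hop k t g\<close>, hence the choice of a representative.
\<close>

definition Hop :: "nat \<Rightarrow> real \<Rightarrow> (real ^ 'd \<Rightarrow> complex) \<Rightarrow> real ^ 'd \<Rightarrow> complex" where
  "Hop k t = (SOME T. bounded_L2_operator gauss T \<and>
     (\<forall>m. AE x in gauss. T (\<lambda>y. of_real (Herm m y)) x =
            exp (2 * of_real pi * of_nat (mi_abs m) * \<i> * of_real t)
              * of_real (Herm m (lam k *\<^sub>R x))))"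

definition mat_abs :: "nat ^ 'd ^ 'k ^ 'l \<Rightarrow> nat" where
  "mat_abs M = (\<Sum>i\<in>UNIV. \<Sum>j\<in>UNIV. mi_abs (M $ i $ j))"

definition mat_fact :: "nat ^ 'd ^ 'k ^ 'l \<Rightarrow> real" where
  "mat_fact M = (\<Prod>i\<in>UNIV. \<Prod>j\<in>UNIV. mi_fact (M $ i $ j))"

definition Fock :: "(nat ^ 'd ^ 'k ^ 'l \<Rightarrow> complex) set" where
  "Fock = {\<phi>. (\<lambda>M. (cmod (\<phi> M))\<^sup>2 * mat_fact M) summable_on UNIV}"

definition Fock_inner ::
    "(nat ^ 'd ^ 'k ^ 'l \<Rightarrow> complex) \<Rightarrow> (nat ^ 'd ^ 'k ^ 'l \<Rightarrow> complex) \<Rightarrow> complex" where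
  "Fock_inner \<phi> \<psi> = (\<Sum>\<^sub>\<infinity>M. \<phi> M * cnj (\<psi> M) * of_real (mat_fact M))"

definition Fock_norm :: "(nat ^ 'd ^ 'k ^ 'l \<Rightarrow> complex) \<Rightarrow> real" where
  "Fock_norm \<phi> = sqrt (Re (Fock_inner \<phi> \<phi>))"

definition Fock_level :: "nat \<Rightarrow> (nat ^ 'd ^ 'k ^ 'l \<Rightarrow> complex) set" where
  "Fock_level S = {\<phi>. \<forall>M. mat_abs M \<noteq> S \<longrightarrow> \<phi> M = 0}"

definition level_part ::
    "nat \<Rightarrow> (nat ^ 'd ^ 'k ^ 'l \<Rightarrow> complex) \<Rightarrow> nat ^ 'd ^ 'k ^ 'l \<Rightarrow> complex" where
  "level_part S \<phi> = (\<lambda>M. if mat_abs M = S then \<phi> M else 0)"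

definition Pker :: "nat ^ 'd ^ 'k ^ 'l \<Rightarrow> nat ^ 'd ^ 'k ^ 'l \<Rightarrow> real" where
  "Pker M N = (\<integral>x. (\<Prod>i\<in>UNIV. \<Prod>j\<in>UNIV.
       Herm (M $ i $ j) (lam CARD('k) *\<^sub>R x i) * Herm (N $ i $ j) (lam CARD('k) *\<^sub>R x i))
     \<partial>(Pi\<^sub>M (UNIV :: 'l set) (\<lambda>_. gauss :: (real ^ 'd) measure)))"

definition Pop ::
    "(nat ^ 'd ^ 'k ^ 'l \<Rightarrow> complex) \<Rightarrow> nat ^ 'd ^ 'k ^ 'l \<Rightarrow> complex" where
  "Pop \<phi> M = (\<Sum>N | mat_abs N = mat_abs M. \<phi> N * of_real (Pker M N / mat_fact M))"

text \<open>Projections are understood as orthogonal projections.\<close>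

definition projection_on ::
    "(nat ^ 'd ^ 'k ^ 'l \<Rightarrow> complex) set \<Rightarrow>
     ((nat ^ 'd ^ 'k ^ 'l \<Rightarrow> complex) \<Rightarrow> nat ^ 'd ^ 'k ^ 'l \<Rightarrow> complex) \<Rightarrow> bool" where
  "projection_on V T \<longleftrightarrow>
     (\<forall>\<phi>\<in>V. T \<phi> \<in> V) \<and>
     (\<forall>\<phi>\<in>V. \<forall>\<psi>\<in>V. \<forall>a b. T (\<lambda>M. a * \<phi> M + b * \<psi> M) = (\<lambda>M. a * T \<phi> M + b * T \<psi> M)) \<and>
     (\<forall>\<phi>\<in>V. T (T \<phi>) = T \<phi>) \<and>
     (\<forall>\<phi>\<in>V. \<forall>\<psi>\<in>V. Fock_inner (T \<phi>) \<psi> = Fock_inner \<phi> (T \<psi>))"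

text \<open>The operator norm takes values in \<open>[0, \<infinity>]\<close>, so that the supremum always exists.\<close>

definition Fock_opnorm ::
    "(nat ^ 'd ^ 'k ^ 'l \<Rightarrow> complex) set \<Rightarrow>
     ((nat ^ 'd ^ 'k ^ 'l \<Rightarrow> complex) \<Rightarrow> nat ^ 'd ^ 'k ^ 'l \<Rightarrow> complex) \<Rightarrow> ennreal" where
  "Fock_opnorm V T = (SUP \<phi>\<in>{\<phi>\<in>V. Fock_norm \<phi> \<le> 1}. ennreal (Fock_norm (T \<phi>)))"

text \<open>
  For \<open>\<phi>\<close> in the Fock space, \<open>Pop \<phi>\<close> need not belong to it when \<open>Pop\<close> is unbounded. The pairing of
  \<open>\<phi>\<close> with \<open>Pop \<phi>\<close> is then taken level by level, with value in \<open>[0, \<infinity>]\<close>. Each level is a finite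
  sum; that it is real and nonnegative is part of the theorem.
\<close>

definition Pform :: "(nat ^ 'd ^ 'k ^ 'l \<Rightarrow> complex) \<Rightarrow> ennreal" where
  "Pform \<phi> = (\<Sum>S. ennreal (Re (Fock_inner (level_part S \<phi>) (Pop (level_part S \<phi>)))))"

end

theory Submission
  imports Defs "HOL-Probability.Distributions" "HOL-Real_Asymp.Real_Asymp"
begin

text \<open>
  Let \<open>l\<close>, \<open>k\<close>, \<open>d\<close> be the three dimensions, \<open>\<lambda> = 1 / sqrt k\<close>, and let \<open>A\<close> send
  \<open>x = (x\<^sub>1, \<dots>, x\<^sub>l)\<close> to the \<open>l \<times> k\<close> matrix with entries \<open>\<lambda> x\<^sub>i\<close>. Since \<open>k \<lambda>\<^sup>2 = 1\<close>, \<open>A\<close> is an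
  isometric embedding of an \<open>l d\<close>-dimensional space into an \<open>l k d\<close>-dimensional one, of
  codimension \<open>2 \<mu>\<close>.

  \<^bold>\<open>The spectrum.\<close> Let \<open>B \<phi> = (\<Sum>M. \<phi> M * H\<^sub>M (A x))\<close> on level \<open>S\<close>. Then \<open>Pop\<close> is \<open>B\<close> followed by
  its adjoint, so its nonzero spectrum is that of \<open>B\<close> preceded by its adjoint, an integral operator
  with kernel \<open>(\<Sum>M. H\<^sub>M (A x) H\<^sub>M (A y) / M!)\<close>, the sum running over \<open>|M| = S\<close>. By Mehler's formula
  the generating function in \<open>z\<close> of these kernels is a power of \<open>(1 - z\<^sup>2)\<^sup>-\<^sup>1\<^sup>/\<^sup>2\<close> times a function of
  \<open>z\<close> and of the inner products of \<open>A x\<close> and \<open>A y\<close>, which are those of \<open>x\<close> and \<open>y\<close>. Passing from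
  \<open>A x, A y\<close> to \<open>x, y\<close> therefore only costs the factor \<open>(1 - z\<^sup>2)\<^sup>-\<^sup>\<mu> = (\<Sum>m. (\<mu>)\<^sub>m / m! * z\<^sup>2\<^sup>m)\<close>:
  the kernel on level \<open>S\<close> is diagonal in the Hermite basis, with eigenvalue \<open>(\<mu>)\<^sub>m / m!\<close> on the Hermite
  polynomials of degree \<open>S - 2 m\<close>. The proof works with the coefficients of \<open>H\<^sub>M (A x)\<close> in the
  Hermite basis (\<open>mat_coeff\<close>); \<open>Pker_expansion\<close> expresses \<open>Pop\<close> through them and
  \<open>mat_coeff_orthogonality\<close> is the diagonalization. It reduces to one coordinate, where
  \<open>fps_Mehler_scaled_power\<close> compares two solutions of a linear differential equation of first order.

  All eigenvalues are \<open>0\<close> or \<open>1\<close> when \<open>\<mu> = 1\<close>; the eigenvalue \<open>\<mu>\<close> (for \<open>m = 1\<close>) occurs on every level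
  \<open>S \<ge> 2\<close>, so \<open>\<mu> = 1\<close> is also necessary for a projection. For \<open>\<mu> \<ge> 1\<close> the eigenvalues increase
  with \<open>m\<close>, and the norm on level \<open>S\<close> is the one for \<open>m = S div 2\<close>.

  \<^bold>\<open>The mixed norm.\<close> For a finite Hermite expansion the formula for the space-time integral is
  obtained by multiplying out the \<open>2 k l\<close> factors and using the orthogonality of the waves
  \<open>exp (2 \<pi> i n t)\<close> over a period (\<open>finite_expansion_identity\<close>). In general both sides may be
  infinite, and each inequality needs its own approximation of \<open>g\<close> by finite expansions.

  The integral is bounded by the quadratic form: damp the coefficients by \<open>\<rho>\<^sup>|\<^sup>m\<^sup>|\<close> and truncate. On
  low levels damping only decreases the form, and on high levels the form is at most the largest
  eigenvalue, which grows polynomially, times an exponentially damped norm. Let the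
  truncation tend to infinity, then \<open>\<rho>\<close> to \<open>1\<close>, and use Fatou's lemma (\<open>mixed_norm_le_forms\<close>).

  The quadratic form is bounded by the integral: the integral is the power \<open>2 k l\<close> of the norm of
  \<open>Hop k t g\<close> in \<open>L\<^sup>2\<^sup>k\<^sup>l\<close> in time with values in \<open>L\<^sup>2\<^sup>k\<close> in space. This norm is convex and invariant
  under time translations, so averaging over translations with a Fejer kernel does not increase it.
  Fejer averaging makes the expansion finite and multiplies each coefficient by a weight that tends
  to \<open>1\<close>, so the form of each level is recovered in the limit (\<open>forms_le_mixed_norm\<close>).

  \<^bold>\<open>The operators.\<close> \<open>Hop k t\<close> exists because multiplying Hermite coefficients by phases preserves the
  norm of the series (by Bessel's inequality and completeness) and because the dilation by \<open>\<lambda> \<le> 1\<close> is bounded for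
  the Gaussian measure (\<open>Hop_exists\<close>). By boundedness it is determined almost everywhere on every
  function that has a Hermite expansion, with estimates uniform in \<open>t\<close> (\<open>Hop_approx\<close>).
\<close>

section \<open>Hermite polynomials\<close>

text \<open>
  The recursion \<open>H\<^sub>n\<^sub>+\<^sub>1 = x H\<^sub>n - H\<^sub>n'\<close> makes integration by parts immediate; \<open>hermite_eq_He\<close>
  identifies this sequence with the one characterized by orthogonality.
\<close>

fun He :: "nat \<Rightarrow> real poly" where
  "He 0 = 1"
| "He (Suc n) = pCons 0 (He n) - pderiv (He n)"

lemma degree_lead_coeff_He: "degree (He n) = n \<and> lead_coeff (He n) = 1"
proof (induction n)
  case (Suc n)
  have ne: "He n \<noteq> 0" using Suc by auto
  have d1: "degree (pCons 0 (He n)) = Suc n" using Suc ne by simp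
  have d2: "degree (pderiv (He n)) < Suc n" using Suc by (simp add: degree_pderiv)
  have "degree (He (Suc n)) = Suc n"
    using degree_add_eq_left[of "- pderiv (He n)" "pCons 0 (He n)"] d1 d2 by simp
  moreover have "coeff (pderiv (He n)) (Suc n) = 0" using d2 by (rule coeff_eq_0)
  moreover have "coeff (He n) n = 1" using Suc by metis
  ultimately show ?case by simp
qed simp

lemma degree_He [simp]: "degree (He n) = n" and lead_coeff_He: "coeff (He n) n = 1"
  using degree_lead_coeff_He[of n] by auto

lemma pderiv_He: "pderiv (He (Suc n)) = smult (of_nat (Suc n)) (He n)"
proof (induction n)
  case 0 show ?case by (simp add: pderiv_pCons)
next
  case (Suc n)
  have scale: "pCons 0 (smult c p) - smult c q = smult c (pCons 0 p - q)" for c and p q :: "real poly"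
    by (simp add: smult_diff_right)
  have "pderiv (He (Suc (Suc n)))
      = He (Suc n) + (pCons 0 (pderiv (He (Suc n))) - pderiv (pderiv (He (Suc n))))"
    by (simp only: He.simps(2)[of "Suc n"] pderiv_diff pderiv_pCons add_diff_eq)
  also have "\<dots> = He (Suc n) + smult (of_nat (Suc n)) (He (Suc n))"
    by (simp only: Suc pderiv_smult scale) simp
  also have "\<dots> = smult (1 + of_nat (Suc n)) (He (Suc n))"
    by (simp only: smult_add_left smult_1_left)
  finally show ?case by (simp only: of_nat_Suc[of "Suc n"])
qed

lemma poly_He_recurrence:
  "poly (He (Suc (Suc n))) x = x * poly (He (Suc n)) x - real (Suc n) * poly (He n) x"
  by (simp only: He.simps(2)[of "Suc n"] poly_diff poly_pCons pderiv_He poly_smult of_nat_Suc mult_zero_right add_0_left)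

definition gint :: "real poly \<Rightarrow> real" where
  "gint p = (\<integral>x. poly p x \<partial>gauss)"

lemma gauss_real: "(gauss :: real measure) = density lborel std_normal_density"
proof -
  have "(2 * pi) powr (- real DIM(real) / 2) = 1 / sqrt (2 * pi)"
    by (simp add: powr_minus_divide powr_half_sqrt)
  then show ?thesis
    unfolding gauss_def std_normal_density_def by simp
qed

lemma borel_measurable_poly [measurable]: "poly (p :: real poly) \<in> borel_measurable borel"
  by (intro borel_measurable_continuous_onI continuous_intros)

lemma integrable_poly_gauss [simp]: "integrable gauss (\<lambda>x. poly p x :: real)"
proof -
  have "integrable lborel (\<lambda>x. \<Sum>i\<le>degree p. coeff p i * (std_normal_density x * x ^ i))"
    by (intro Bochner_Integration.integrable_sum integrable_mult_right integrable_std_normal_moment)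
  also have "(\<lambda>x. \<Sum>i\<le>degree p. coeff p i * (std_normal_density x * x ^ i))
      = (\<lambda>x. std_normal_density x * poly p x)"
    by (auto simp: poly_altdef sum_distrib_left mult_ac)
  finally show ?thesis
    by (subst gauss_real, subst integrable_density) simp_all
qed

lemma gint_add: "gint (p + q) = gint p + gint q"
  and gint_diff: "gint (p - q) = gint p - gint q"
  and gint_smult: "gint (smult c p) = c * gint p"
  by (simp_all add: gint_def)

lemma gint_sum: "gint (\<Sum>i\<in>A. f i) = (\<Sum>i\<in>A. gint (f i))"
  by (simp add: gint_def poly_sum)

lemma gint_monom: "gint (monom 1 n) = (if even n then fact n / (2 ^ (n div 2) * fact (n div 2)) else 0)"
proof (cases "even n")
  case True
  then obtain k where "n = 2 * k" by blast
  then show ?thesis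
    using integral_std_normal_moment_even[of k]
    by (simp add: gint_def gauss_real integral_density poly_monom)
next
  case False
  then obtain k where "n = 2 * k + 1" by (auto elim: oddE)
  then show ?thesis
    using integral_std_normal_moment_odd[of k]
    by (simp add: gint_def gauss_real integral_density poly_monom)
qed

lemma gint_pCons_monom: "gint (pCons 0 (monom 1 n)) = gint (pderiv (monom 1 n))"
proof -
  have p: "pCons 0 (monom 1 n) = (monom 1 (Suc n) :: real poly)" by (simp add: monom_Suc)
  have d: "pderiv (monom 1 n :: real poly) = smult (of_nat n) (monom 1 (n - 1))"
    by (simp add: pderiv_monom smult_monom)
  show ?thesis
  proof (cases "odd n")
    case True
    then obtain k where k: "n = 2 * k + 1" by (auto elim: oddE)
    have "fact (2 * k + 2) / (2 ^ (k + 1) * fact (k + 1)) = real (2 * k + 1) * (fact (2 * k) / (2 ^ k * fact k))"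
    proof -
      have "fact (2 * k + 2) = (2 * real (k + 1)) * (real (2 * k + 1) * fact (2 * k))"
        by (simp add: mult_ac)
      moreover have "2 ^ (k + 1) * fact (k + 1) = (2 * real (k + 1)) * (2 ^ k * fact k)" by simp
      ultimately show ?thesis
        by (simp only: mult_divide_mult_cancel_left_if times_divide_eq_right) simp
    qed
    then show ?thesis unfolding p d gint_smult gint_monom using k by simp
  next
    case False
    then show ?thesis unfolding p d gint_smult gint_monom by (cases n) auto
  qed
qed

text \<open>
  Integration by parts against the Gaussian weight, checked on monomials with the known moments.
\<close>

lemma gint_pCons: "gint (pCons 0 p) = gint (pderiv p)"
proof -
  have p: "p = (\<Sum>i\<le>degree p. smult (coeff p i) (monom 1 i))"
    by (simp add: poly_as_sum_of_monoms smult_monom)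
  have "gint (pCons 0 (\<Sum>i\<le>n. smult (c i) (monom 1 i))) = gint (pderiv (\<Sum>i\<le>n. smult (c i) (monom 1 i)))" for c n
  proof (induction n)
    case 0
    have "pCons 0 (smult (c 0) (monom 1 0)) = smult (c 0) (pCons 0 (monom 1 0))" by simp
    then show ?case using gint_pCons_monom[of 0] by (simp only: gint_smult pderiv_smult atMost_0 sum.insert finite.emptyI empty_iff sum.empty add_0_right if_False simp_thms)
  next
    case (Suc n)
    have *: "pCons 0 (p + q) = pCons 0 p + pCons 0 q" for p q :: "real poly" by simp
    have **: "pCons 0 (smult a q) = smult a (pCons 0 q)" for a and q :: "real poly" by simp
    show ?case using Suc gint_pCons_monom[of "Suc n"]
      by (simp only: sum.atMost_Suc * ** pderiv_add gint_add pderiv_smult gint_smult)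
  qed
  from this[of "coeff p" "degree p"] show ?thesis by (simp only: p[symmetric])
qed

lemma gint_He_mult: "gint (He (Suc n) * q) = gint (He n * pderiv q)"
proof -
  have "gint (He (Suc n) * q) = gint (pCons 0 (He n * q)) - gint (pderiv (He n) * q)"
    by (simp add: algebra_simps gint_diff)
  also have "\<dots> = gint (He n * pderiv q)"
    by (simp add: gint_pCons pderiv_mult gint_add mult.commute)
  finally show ?thesis .
qed

lemma gint_1: "gint 1 = 1"
  using gint_monom[of 0] by (simp add: one_pCons monom_0)

lemma gint_He_low_degree: "degree q < n \<Longrightarrow> gint (He n * q) = 0"
proof (induction n arbitrary: q)
  case (Suc n)
  show ?case
  proof (cases "degree q = 0")
    case True
    then have "pderiv q = 0" by (simp add: pderiv_eq_0_iff)
    then show ?thesis by (simp only: gint_He_mult) (simp add: gint_def)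
  next
    case False
    then have "degree (pderiv q) < n" using Suc by (simp add: degree_pderiv)
    then show ?thesis using Suc by (simp only: gint_He_mult)
  qed
qed simp

lemma gint_He_He: "gint (He m * He n) = (if m = n then fact n else 0)"
proof -
  have eq: "gint (He n * He n) = fact n" for n
  proof (induction n)
    case (Suc n)
    show ?case using Suc
      by (simp only: gint_He_mult pderiv_He mult_smult_right gint_smult fact_Suc)
  qed (simp add: gint_1)
  show ?thesis
    using eq gint_He_low_degree[of "He n" m] gint_He_low_degree[of "He m" n]
    by (cases m n rule: linorder_cases) (auto simp: mult.commute)
qed

text \<open>
  Monic polynomials of every degree span, and orthogonality identifies the coefficients.
\<close>

lemma He_expansion:
  assumes "degree q \<le> N"
  shows "q = (\<Sum>n\<le>N. smult (gint (q * He n) / fact n) (He n))"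
proof -
  have "\<exists>a. q = (\<Sum>n\<le>N. smult (a n) (He n))"
    using assms
  proof (induction N arbitrary: q)
    case 0
    then have "q = smult (coeff q 0) (He 0)" by (simp add: degree_0_id)
    then show ?case by (intro exI[of _ "\<lambda>_. coeff q 0"]) simp
  next
    case (Suc N)
    define r where "r = q - smult (coeff q (Suc N)) (He (Suc N))"
    have "degree r \<le> N"
    proof (rule degree_le)
      show "\<forall>i>N. coeff r i = 0"
      proof (intro allI impI)
        fix i assume "N < i"
        then consider "i = Suc N" | "i > Suc N" by linarith
        then show "coeff r i = 0"
        proof cases
          case 1 then show ?thesis unfolding r_def by (simp only: coeff_diff coeff_smult lead_coeff_He)
        next
          case 2
          then show ?thesis using Suc.prems unfolding r_def
            by (simp only: coeff_diff coeff_smult) (simp add: coeff_eq_0 del: He.simps)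
        qed
      qed
    qed
    then obtain a where a: "r = (\<Sum>n\<le>N. smult (a n) (He n))" using Suc.IH by blast
    have "q = (\<Sum>n\<le>Suc N. smult ((a(Suc N := coeff q (Suc N))) n) (He n))"
    proof -
      have "(\<Sum>n\<le>N. smult ((a(Suc N := coeff q (Suc N))) n) (He n)) = r"
        unfolding a by (intro sum.cong) auto
      then show ?thesis by (simp add: r_def del: He.simps)
    qed
    then show ?case by blast
  qed
  then obtain a where a: "q = (\<Sum>n\<le>N. smult (a n) (He n))" by blast
  have "gint (q * He m) = a m * fact m" if "m \<le> N" for m
    unfolding a sum_distrib_right gint_sum
    using that by (simp add: gint_smult gint_He_He if_distrib sum.delta cong: if_cong)
  then have "(\<Sum>n\<le>N. smult (gint (q * He n) / fact n) (He n)) = (\<Sum>n\<le>N. smult (a n) (He n))"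
    by (intro sum.cong) auto
  then show ?thesis using a by simp
qed

lemma gint_mult_He_expansion:
  assumes "degree q \<le> N"
  shows "gint (q * q') = (\<Sum>n\<le>N. gint (q * He n) * gint (q' * He n) / fact n)"
proof -
  have "gint (q * q') = gint ((\<Sum>n\<le>N. smult (gint (q * He n) / fact n) (He n)) * q')"
    by (rule arg_cong[OF He_expansion[OF assms], of "\<lambda>r. gint (r * q')"])
  also have "\<dots> = (\<Sum>n\<le>N. gint (q * He n) * gint (q' * He n) / fact n)"
    by (simp add: sum_distrib_right gint_sum gint_smult mult.commute[of "He _" q'])
  finally show ?thesis .
qed

text \<open>
  A second monic orthogonal sequence agrees with \<open>He\<close> by strong induction: expanded in \<open>He\<close>, its
  \<open>m\<close>-th member is orthogonal to all lower ones, so only the term of degree \<open>m\<close> survives.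
\<close>

lemma hermite_eq_He: "hermite = He"
  unfolding hermite_def
proof (rule the_equality)
  show "(\<forall>m. degree (He m) = m \<and> lead_coeff (He m) = 1) \<and>
      (\<forall>m n. m \<noteq> n \<longrightarrow> (\<integral>x. poly (He m) x * poly (He n) x \<partial>gauss) = 0)"
    using degree_lead_coeff_He gint_He_He unfolding gint_def poly_mult by auto
next
  fix h :: "nat \<Rightarrow> real poly"
  assume h: "(\<forall>m. degree (h m) = m \<and> lead_coeff (h m) = 1) \<and>
     (\<forall>m n. m \<noteq> n \<longrightarrow> (\<integral>x. poly (h m) x * poly (h n) x \<partial>gauss) = 0)"
  have orth: "m \<noteq> n \<Longrightarrow> gint (h m * h n) = 0" for m n
    using h by (simp add: gint_def)
  have "h m = He m" for m
  proof (induction m rule: less_induct)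
    case (less m)
    have "degree (h m) \<le> m" using h by simp
    then have "h m = (\<Sum>n\<le>m. smult (gint (h m * He n) / fact n) (He n))"
      by (rule He_expansion)
    also have "\<dots> = (\<Sum>n\<in>{m}. smult (gint (h m * He n) / fact n) (He n))"
    proof (intro sum.mono_neutral_right ballI)
      fix n assume "n \<in> {..m} - {m}"
      then have "gint (h m * He n) = 0" using less[of n] orth[of m n] by simp
      then show "smult (gint (h m * He n) / fact n) (He n) = 0" by simp
    qed auto
    finally have eq: "h m = smult (gint (h m * He m) / fact m) (He m)" by simp
    have "coeff (h m) m = gint (h m * He m) / fact m"
      by (subst eq) (simp only: coeff_smult lead_coeff_He mult_1_right)
    moreover have "coeff (h m) m = 1" using h by metis
    ultimately show "h m = He m" using eq by (simp only: smult_1_left)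
  qed
  then show "h = He" by blast
qed

section \<open>Mehler's formula as an identity of power series\<close>

definition fps_Mehler :: "real \<Rightarrow> real \<Rightarrow> real fps" where
  "fps_Mehler u v = Abs_fps (\<lambda>n. poly (He n) u * poly (He n) v / fact n)"

text \<open>
  The logarithmic derivative in \<open>z\<close> of the Mehler kernel
  \<open>(1 - z\<^sup>2)\<^sup>-\<^sup>1\<^sup>/\<^sup>2 exp ((2 u v z - (u\<^sup>2 + v\<^sup>2) z\<^sup>2) / (2 (1 - z\<^sup>2)))\<close>, times \<open>(1 - z\<^sup>2)\<^sup>2\<close> to clear
  denominators. Logarithmic derivatives turn products of kernels into sums, so the differential
  equation replaces the closed form.
\<close>

definition mehler_rate :: "real \<Rightarrow> real \<Rightarrow> real fps" where
  "mehler_rate u v = fps_X * (1 - fps_X\<^sup>2) + fps_const (u * v) * (1 + fps_X\<^sup>2)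
     - fps_const (u\<^sup>2 + v\<^sup>2) * fps_X"

lemma fps_Mehler_ODE:
  "(1 - fps_X\<^sup>2)\<^sup>2 * fps_deriv (fps_Mehler u v) = mehler_rate u v * fps_Mehler u v"
proof -
  define B where "B u v = Abs_fps (\<lambda>n. poly (He (Suc n)) u * poly (He n) v / fact n)" for u v
  define C where "C = Abs_fps (\<lambda>n. poly (He (Suc (Suc n))) u * poly (He n) v / fact n)"
  let ?A = "fps_Mehler u v"
  have He1: "poly (He (Suc 0)) x = x" for x by (simp add: pderiv_1 one_pCons)
  \<comment> \<open>The three-term recurrence gives linear relations between the shifted series A, B and C; eliminating B and C leaves the equation for A.\<close>
  have B: "B u v = fps_const u * fps_Mehler u v - fps_X * B v u" for u v
  proof (rule fps_ext)
    fix n show "fps_nth (B u v) n = fps_nth (fps_const u * fps_Mehler u v - fps_X * B v u) n"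
    proof (cases n)
      case 0 then show ?thesis by (simp add: B_def fps_Mehler_def He1 del: He.simps(2))
    next
      case (Suc m)
      have "(u * a - real (Suc m) * b) * w / (real (Suc m) * f) = u * (a * w / (real (Suc m) * f)) - b * w / f"
        if "f \<noteq> 0" for a b w f
        using that by (simp add: divide_simps del: of_nat_Suc) (simp add: algebra_simps)
      then show ?thesis using Suc
        by (simp add: B_def fps_Mehler_def poly_He_recurrence mult.commute[of "poly (He m) u"] del: He.simps of_nat_Suc)
    qed
  qed
  have A': "fps_deriv ?A = fps_const v * B u v - fps_X * C"
  proof (rule fps_ext)
    fix n show "fps_nth (fps_deriv ?A) n = fps_nth (fps_const v * B u v - fps_X * C) n"
    proof (cases n)
      case 0 then show ?thesis by (simp add: B_def fps_Mehler_def He1 del: He.simps(2))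
    next
      case (Suc m)
      have "fps_nth (fps_deriv ?A) n = poly (He (Suc (Suc m))) u * poly (He (Suc (Suc m))) v / fact (Suc m)"
        using Suc by (simp add: fps_Mehler_def divide_simps del: He.simps)
      also have "\<dots> = fps_nth (fps_const v * B u v - fps_X * C) n"
      proof -
        have "w * (v * a - real (Suc m) * b) / (real (Suc m) * f) = v * (w * a / (real (Suc m) * f)) - w * b / f"
          if "f \<noteq> 0" for a b w f
          using that by (simp add: divide_simps del: of_nat_Suc) (simp add: algebra_simps)
        then show ?thesis using Suc
          by (simp add: B_def C_def poly_He_recurrence[of m v] del: He.simps of_nat_Suc)
      qed
      finally show ?thesis .
    qed
  qed
  have C: "C = fps_const u * B u v - fps_deriv (fps_X * ?A)"
    by (rule fps_ext)
       (simp add: B_def C_def fps_Mehler_def poly_He_recurrence field_simps del: He.simps fps_deriv_mult)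
  have C': "C = fps_const u * B u v - ?A - fps_X * fps_deriv ?A"
    unfolding C by simp
  have sym: "fps_Mehler v u = ?A" by (simp add: fps_Mehler_def mult.commute)
  have c: "fps_const (u * v) = fps_const u * fps_const v"
    "fps_const (u\<^sup>2 + v\<^sup>2) = (fps_const u)\<^sup>2 + (fps_const v)\<^sup>2"
    by (simp_all add: power2_eq_square)
  have B2: "(1 - fps_X\<^sup>2) * B u v = (fps_const u - fps_X * fps_const v) * ?A"
    using B[of u v] B[of v u] unfolding sym by algebra
  have A2: "(1 - fps_X\<^sup>2) * fps_deriv ?A = (fps_const v - fps_X * fps_const u) * B u v + fps_X * ?A"
    using A' unfolding C' by algebra
  show ?thesis unfolding mehler_rate_def c using A2 B2 by algebra
qed

text \<open>
  The factor \<open>(1 - z\<^sup>2)\<^sup>2\<close> is a unit, so the equation determines each coefficient from the lower ones.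
\<close>

lemma fps_first_order_ODE_unique:
  fixes f g :: "real fps"
  assumes f: "(1 - fps_X\<^sup>2)\<^sup>2 * fps_deriv f = q * f"
    and g: "(1 - fps_X\<^sup>2)\<^sup>2 * fps_deriv g = q * g"
    and init: "fps_nth f 0 = fps_nth g 0"
  shows "f = g"
proof -
  define h where "h = f - g"
  define p where "p = inverse ((1 - fps_X\<^sup>2)\<^sup>2 :: real fps) * q"
  have "inverse ((1 - fps_X\<^sup>2)\<^sup>2 :: real fps) * (1 - fps_X\<^sup>2)\<^sup>2 = 1"
    by (rule inverse_mult_eq_1) (simp add: power2_eq_square)
  moreover have "(1 - fps_X\<^sup>2)\<^sup>2 * fps_deriv h = q * h"
    using f g unfolding h_def fps_deriv_sub by algebra
  ultimately have h: "fps_deriv h = p * h"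
    unfolding p_def by algebra
  have "fps_nth h n = 0" for n
  proof (induction n rule: less_induct)
    case (less n)
    show ?case
    proof (cases n)
      case 0 then show ?thesis using init by (simp add: h_def)
    next
      case (Suc m)
      have "real (Suc m) * fps_nth h (Suc m) = fps_nth (p * h) m"
        using arg_cong[OF h, of "\<lambda>f. fps_nth f m"] by simp
      also have "\<dots> = 0" using less Suc by (simp add: fps_mult_nth)
      finally show ?thesis using Suc by (simp del: of_nat_Suc)
    qed
  qed
  then show ?thesis by (simp add: h_def fps_eq_iff)
qed

text \<open>
  The power series of \<open>(1 - z\<^sup>2)\<^sup>-\<^sup>a\<close>.
\<close>

definition fps_eigenvalues :: "real \<Rightarrow> real fps" where
  "fps_eigenvalues a = Abs_fps (\<lambda>n. if even n then pochhammer a (n div 2) / fact (n div 2) else 0)"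

lemma fps_eigenvalues_ODE:
  "(1 - fps_X\<^sup>2)\<^sup>2 * fps_deriv (fps_eigenvalues a) = fps_const (2 * a) * fps_X * (1 - fps_X\<^sup>2) * fps_eigenvalues a"
proof -
  have "(1 - fps_X\<^sup>2) * fps_deriv (fps_eigenvalues a) = fps_const (2 * a) * fps_X * fps_eigenvalues a"
  proof (rule fps_ext)
    fix n
    let ?G = "fps_eigenvalues a"
    have l: "fps_nth ((1 - fps_X\<^sup>2) * fps_deriv ?G) n = fps_nth (fps_deriv ?G) n - (if n < 2 then 0 else fps_nth (fps_deriv ?G) (n - 2))"
      by (simp add: left_diff_distrib fps_X_power_mult_nth)
    have r: "fps_nth (fps_const (2 * a) * fps_X * ?G) n = 2 * a * (if n = 0 then 0 else fps_nth ?G (n - 1))"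
      by (simp add: mult.assoc)
    show "fps_nth ((1 - fps_X\<^sup>2) * fps_deriv ?G) n = fps_nth (fps_const (2 * a) * fps_X * ?G) n"
    proof (cases "even n")
      case True
      then show ?thesis unfolding l r by (auto simp: fps_eigenvalues_def)
    next
      case False
      then obtain m where n: "n = 2 * m + 1" by (auto elim: oddE)
      show ?thesis
      proof (cases m)
        case 0 then show ?thesis unfolding l r n by (simp add: fps_eigenvalues_def)
      next
        case (Suc i)
        define c where "c = pochhammer a m / fact m"
        have c1: "fps_nth ?G (n + 1) * real (Suc m) = c * (a + m)"
          unfolding n c_def by (simp add: fps_eigenvalues_def pochhammer_Suc divide_simps)
        have c0: "fps_nth ?G (n - 1) = c"
          unfolding n c_def by (simp add: fps_eigenvalues_def)
        have "fps_nth (fps_deriv ?G) n = 2 * c * (a + m)"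
          using c1 unfolding n by (simp add: algebra_simps)
        moreover have "fps_nth (fps_deriv ?G) (n - 2) = 2 * m * c"
          using c0 Suc unfolding n by (simp add: algebra_simps)
        ultimately show ?thesis unfolding l r c0 using n Suc by (simp add: algebra_simps)
      qed
    qed
  qed
  then show ?thesis by (simp add: power2_eq_square mult.assoc)
qed

lemma fps_eigenvalues_0: "fps_nth (fps_eigenvalues a) 0 = 1"
  by (simp add: fps_eigenvalues_def)

lemma fps_power_ODE:
  fixes f r q :: "real fps"
  assumes "r * fps_deriv f = q * f"
  shows "r * fps_deriv (f ^ n) = fps_const (real n) * q * f ^ n"
proof (induction n)
  case (Suc n)
  define h where "h = f ^ n"
  have "r * fps_deriv (f ^ Suc n) = r * (fps_deriv f * h + f * fps_deriv h)"
    by (simp add: h_def add.commute)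
  also have "\<dots> = (fps_const (real n) + 1) * q * (f * h)"
    using Suc assms unfolding h_def[symmetric] by algebra
  also have "fps_const (real n) + 1 = fps_const (real (Suc n))"
    by (simp only: of_nat_Suc fps_const_add[symmetric] fps_const_1_eq_1 add.commute)
  finally show ?case by (simp add: h_def)
qed simp

lemma fps_eigenvalues_power: "fps_eigenvalues a ^ n = fps_eigenvalues (real n * a)"
proof (rule fps_first_order_ODE_unique)
  show "(1 - fps_X\<^sup>2)\<^sup>2 * fps_deriv (fps_eigenvalues a ^ n)
      = fps_const (real n) * (fps_const (2 * a) * fps_X * (1 - fps_X\<^sup>2)) * fps_eigenvalues a ^ n"
    by (rule fps_power_ODE[OF fps_eigenvalues_ODE])
  show "(1 - fps_X\<^sup>2)\<^sup>2 * fps_deriv (fps_eigenvalues (real n * a))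
      = fps_const (real n) * (fps_const (2 * a) * fps_X * (1 - fps_X\<^sup>2)) * fps_eigenvalues (real n * a)"
  proof -
    have "fps_const (2 * (real n * a)) = fps_const (real n) * fps_const (2 * a)" by simp
    then show ?thesis using fps_eigenvalues_ODE[of "real n * a"] by (simp only: mult.assoc)
  qed
qed (simp add: fps_eigenvalues_0 fps_power_zeroth)

text \<open>
  With \<open>k \<lambda>\<^sup>2 = 1\<close> the part of the rate that depends on \<open>u\<close> and \<open>v\<close> is reproduced exactly by \<open>k\<close>
  copies at \<open>\<lambda> u\<close>, \<open>\<lambda> v\<close>. Only the term \<open>z (1 - z\<^sup>2)\<close> is counted \<open>k\<close> times, which is what the factor
  \<open>(1 - z\<^sup>2)\<^sup>-\<^sup>(\<^sup>k\<^sup>-\<^sup>1\<^sup>)\<^sup>/\<^sup>2\<close> accounts for.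
\<close>

lemma fps_Mehler_scaled_power:
  assumes "k \<ge> 1"
  shows "fps_Mehler (lam k * u) (lam k * v) ^ k = fps_eigenvalues ((real k - 1) / 2) * fps_Mehler u v"
proof (rule fps_first_order_ODE_unique)
  let ?l = "lam k"
  let ?M = "fps_Mehler (?l * u) (?l * v)"
  have l2: "real k * ?l\<^sup>2 = 1" using assms by (simp add: lam_def)
  have q: "fps_const (real k) * mehler_rate (?l * u) (?l * v)
      = mehler_rate u v + fps_const (real k - 1) * fps_X * (1 - fps_X\<^sup>2)"
  proof -
    have "real k * ((?l * u) * (?l * v)) = u * v" "real k * ((?l * u)\<^sup>2 + (?l * v)\<^sup>2) = u\<^sup>2 + v\<^sup>2"
      using l2 by algebra+
    then have "fps_const (u * v) = fps_const (real k) * fps_const ((?l * u) * (?l * v))"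
      "fps_const (u\<^sup>2 + v\<^sup>2) = fps_const (real k) * fps_const ((?l * u)\<^sup>2 + (?l * v)\<^sup>2)"
      by simp_all
    moreover have "fps_const (real k - 1) = fps_const (real k) - 1"
      by (simp only: fps_const_sub[symmetric] fps_const_1_eq_1)
    ultimately show ?thesis unfolding mehler_rate_def by algebra
  qed
  show "(1 - fps_X\<^sup>2)\<^sup>2 * fps_deriv (?M ^ k)
      = (mehler_rate u v + fps_const (real k - 1) * fps_X * (1 - fps_X\<^sup>2)) * ?M ^ k"
    unfolding q[symmetric] by (rule fps_power_ODE[OF fps_Mehler_ODE])
  let ?G = "fps_eigenvalues ((real k - 1) / 2)"
  have "(1 - fps_X\<^sup>2)\<^sup>2 * fps_deriv ?G = fps_const (real k - 1) * fps_X * (1 - fps_X\<^sup>2) * ?G"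
    using fps_eigenvalues_ODE[of "(real k - 1) / 2"] by simp
  moreover have "fps_deriv (?G * fps_Mehler u v) = ?G * fps_deriv (fps_Mehler u v) + fps_deriv ?G * fps_Mehler u v"
    by simp
  ultimately show "(1 - fps_X\<^sup>2)\<^sup>2 * fps_deriv (?G * fps_Mehler u v)
      = (mehler_rate u v + fps_const (real k - 1) * fps_X * (1 - fps_X\<^sup>2)) * (?G * fps_Mehler u v)"
    using fps_Mehler_ODE[of u v] by algebra
  show "fps_nth (?M ^ k) 0 = fps_nth (?G * fps_Mehler u v) 0"
    by (simp add: fps_eigenvalues_0 fps_power_zeroth fps_Mehler_def)
qed

section \<open>Products of Gaussian integrals\<close>

lemma integral_lborel_prod:
  fixes f :: "'a::euclidean_space \<Rightarrow> real \<Rightarrow> real"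
  assumes int: "\<And>b. b \<in> Basis \<Longrightarrow> integrable lborel (f b)"
  shows "integrable lborel (\<lambda>x. \<Prod>b\<in>Basis. f b (x \<bullet> b))"
    and "(\<integral>x. (\<Prod>b\<in>Basis. f b (x \<bullet> b)) \<partial>lborel) = (\<Prod>b\<in>Basis. \<integral>x. f b x \<partial>lborel)"
proof -
  interpret product_sigma_finite "\<lambda>_::'a. lborel :: real measure" ..
  have [measurable]: "b \<in> Basis \<Longrightarrow> f b \<in> borel_measurable borel" for b
    using borel_measurable_integrable[OF int] by simp
  have [measurable]: "(\<lambda>f. \<Sum>b\<in>Basis. f b *\<^sub>R b) \<in> (\<Pi>\<^sub>M b\<in>(Basis::'a set). (lborel :: real measure)) \<rightarrow>\<^sub>M borel"
    by measurable
  have [measurable]: "(\<lambda>x. \<Prod>b\<in>Basis. f b (x \<bullet> b)) \<in> borel_measurable borel"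
    by measurable
  have i: "integrable (\<Pi>\<^sub>M b\<in>(Basis::'a set). (lborel :: real measure)) (\<lambda>x. \<Prod>b\<in>Basis. f b (x b))"
    by (rule product_integrable_prod) (use int in auto)
  have s: "(\<Prod>b\<in>Basis. f b ((\<Sum>b\<in>Basis. g b *\<^sub>R b) \<bullet> b)) = (\<Prod>b\<in>Basis. f b (g b))" for g :: "'a \<Rightarrow> real"
    by (intro prod.cong) simp_all
  show "integrable lborel (\<lambda>x. \<Prod>b\<in>Basis. f b (x \<bullet> b))"
    by (subst lborel_eq, subst integrable_distr_eq) (simp_all only: s i, measurable)
  show "(\<integral>x. (\<Prod>b\<in>Basis. f b (x \<bullet> b)) \<partial>lborel) = (\<Prod>b\<in>Basis. \<integral>x. f b x \<partial>lborel)"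
    by (subst lborel_eq, subst integral_distr)
       (simp_all only: s product_integral_prod[OF finite_Basis int], measurable)
qed

lemma gauss_density_prod:
  fixes x :: "'a::euclidean_space"
  shows "(2 * pi) powr (- real DIM('a) / 2) * exp (- (norm x)\<^sup>2 / 2)
     = (\<Prod>b\<in>Basis. std_normal_density (x \<bullet> b))"
proof -
  have "(2 * pi) powr (- real DIM('a) / 2) = (1 / sqrt (2 * pi)) ^ DIM('a)"
  proof -
    have "(2 * pi) powr (- real DIM('a) / 2) = ((2 * pi) powr (- 1 / 2)) powr real DIM('a)"
      by (simp add: powr_powr)
    also have "(2 * pi) powr (- 1 / 2) = 1 / sqrt (2 * pi)"
      by (simp add: powr_minus_divide powr_half_sqrt)
    finally show ?thesis by (simp add: powr_realpow)
  qed
  moreover have "exp (- (norm x)\<^sup>2 / 2) = (\<Prod>b\<in>Basis. exp (- (x \<bullet> b)\<^sup>2 / 2))"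
    unfolding exp_sum[OF finite_Basis, symmetric]
    by (simp add: norm_eq_sqrt_inner euclidean_inner[of x x] sum_nonneg power2_eq_square sum_negf sum_divide_distrib[symmetric])
  ultimately show ?thesis
    by (simp add: std_normal_density_def prod_dividef power_divide)
qed

lemma sets_gauss [measurable_cong, simp]: "sets gauss = sets borel"
  and space_gauss [simp]: "space gauss = UNIV"
  by (simp_all add: gauss_def)

lemma measurable_gauss_iff [simp]: "borel_measurable gauss = borel_measurable borel"
  by (intro measurable_cong_sets) simp_all

text \<open>
  The Gaussian measure on \<open>real ^ 'd\<close> is a product of one-dimensional ones, so all integrals of
  Hermite polynomials below reduce to one variable.
\<close>

lemma integral_gauss_prod:
  fixes f :: "'d::finite \<Rightarrow> real \<Rightarrow> real"
  assumes int: "\<And>c. integrable gauss (f c)"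
  shows "integrable gauss (\<lambda>x::real^'d. \<Prod>c\<in>UNIV. f c (x $ c))"
    and "(\<integral>x. (\<Prod>c\<in>UNIV. f c (x $ c)) \<partial>(gauss :: (real^'d) measure)) = (\<Prod>c\<in>UNIV. \<integral>x. f c x \<partial>gauss)"
proof -
  have m [measurable]: "f c \<in> borel_measurable borel" for c
    using borel_measurable_integrable[OF int] by simp
  define F where "F b y = std_normal_density y * f (axis_index b) y" for b :: "real^'d" and y
  have inj: "inj_on (\<lambda>c. axis c 1 :: real^'d) UNIV" by (simp add: inj_on_def axis_eq_axis)
  have B: "(Basis :: (real^'d) set) = (\<lambda>c. axis c 1) ` UNIV" by (auto simp: Basis_vec_def)
  have F: "(\<Prod>b\<in>Basis. G b) = (\<Prod>c\<in>UNIV. G (axis c 1 :: real^'d))" for G :: "real^'d \<Rightarrow> real"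
    unfolding B by (simp add: prod.reindex[OF inj])
  have ai: "axis_index (axis c (1::real)) = c" for c :: 'd
    by (simp add: axis_index_axis)
  have intF: "integrable lborel (F b)" for b
    using int[of "axis_index b"] unfolding F_def gauss_real
    by (subst (asm) integrable_density) simp_all
  have dens: "(2 * pi) powr (- real DIM(real^'d) / 2) * exp (- (norm x)\<^sup>2 / 2) * (\<Prod>c\<in>UNIV. f c (x $ c))
      = (\<Prod>b\<in>Basis. F b (x \<bullet> b))" for x :: "real^'d"
    unfolding gauss_density_prod F F_def ai by (simp add: inner_axis prod.distrib)
  show "integrable gauss (\<lambda>x::real^'d. \<Prod>c\<in>UNIV. f c (x $ c))"
    using integral_lborel_prod(1)[of F, OF intF]
    unfolding gauss_def by (subst integrable_density) (simp_all only: dens[symmetric], auto)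
  have "(\<integral>x. (\<Prod>c\<in>UNIV. f c (x $ c)) \<partial>(gauss :: (real^'d) measure)) = (\<integral>x. (\<Prod>b\<in>Basis. F b (x \<bullet> b)) \<partial>lborel)"
    unfolding gauss_def by (subst integral_density) (auto simp flip: dens)
  also have "\<dots> = (\<Prod>b\<in>Basis. \<integral>x. F b x \<partial>lborel)"
    by (rule integral_lborel_prod(2)[OF intF])
  also have "\<dots> = (\<Prod>c\<in>UNIV. \<integral>x. f c x \<partial>gauss)"
    unfolding F by (intro prod.cong) (auto simp: F_def[abs_def] ai gauss_real integral_density)
  finally show "(\<integral>x. (\<Prod>c\<in>UNIV. f c (x $ c)) \<partial>(gauss :: (real^'d) measure)) = (\<Prod>c\<in>UNIV. \<integral>x. f c x \<partial>gauss)" .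
qed

lemma prob_space_gauss: "prob_space (gauss :: (real^'d::finite) measure)"
proof -
  have "integrable (gauss :: (real^'d) measure) (\<lambda>_. 1 :: real)"
    "(\<integral>x. 1 \<partial>(gauss :: (real^'d) measure)) = (1::real)"
    using integral_gauss_prod[of "\<lambda>_ _. 1"] gint_1 integrable_poly_gauss[of 1] by (simp_all add: gint_def)
  from nn_integral_eq_integral[OF this(1)] this(2) show ?thesis
    by (intro prob_spaceI) simp
qed

section \<open>Products of generating series\<close>

lemma finite_functions_of_weight:
  fixes deg :: "'b \<Rightarrow> nat"
  assumes fin: "\<And>s. finite {n. deg n = s}" and "finite E"
  shows "finite {h \<in> PiE E (\<lambda>_. UNIV). (\<Sum>e\<in>E. deg (h e)) = S}"
proof (rule finite_subset)
  show "{h \<in> PiE E (\<lambda>_. UNIV). (\<Sum>e\<in>E. deg (h e)) = S} \<subseteq> PiE E (\<lambda>_. \<Union>s\<le>S. {n. deg n = s})"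
  proof
    fix h assume h: "h \<in> {h \<in> PiE E (\<lambda>_. UNIV). (\<Sum>e\<in>E. deg (h e)) = S}"
    then have "deg (h e) \<le> S" if "e \<in> E" for e
      using member_le_sum[of e E "\<lambda>e. deg (h e)"] that \<open>finite E\<close> by simp
    then show "h \<in> PiE E (\<lambda>_. \<Union>s\<le>S. {n. deg n = s})" using h by (simp add: PiE_iff)
  qed
  show "finite (PiE E (\<lambda>_. \<Union>s\<le>S. {n. deg n = s}))"
    using fin \<open>finite E\<close> by (intro finite_PiE) auto
qed

text \<open>
  A product of generating series counts families of indices by their total weight. The index type
  of the factors is arbitrary, since the lemma is used first with numbers and then with rows of numbers.
\<close>

lemma fps_prod_generating:
  fixes deg :: "'b \<Rightarrow> nat" and a :: "'e \<Rightarrow> 'b \<Rightarrow> 'c::comm_ring_1"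
  assumes fin: "\<And>s. finite {n. deg n = s}" and "finite E"
  shows "(\<Prod>e\<in>E. Abs_fps (\<lambda>s. \<Sum>n | deg n = s. a e n))
     = Abs_fps (\<lambda>S. \<Sum>h | h \<in> PiE E (\<lambda>_. UNIV) \<and> (\<Sum>e\<in>E. deg (h e)) = S. \<Prod>e\<in>E. a e (h e))"
  using \<open>finite E\<close>
proof (induction E rule: finite_induct)
  case empty
  show ?case by (rule fps_ext) auto
next
  case (insert e0 E)
  let ?H = "\<lambda>E S. {h. h \<in> PiE E (\<lambda>_. UNIV :: 'b set) \<and> (\<Sum>e\<in>E. deg (h e)) = S}"
  let ?P = "\<lambda>E h. \<Prod>e\<in>E. a e (h e)"
  have finH: "finite (?H E S)" for S
    using finite_functions_of_weight[OF fin insert(1), of S] by simp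
  show ?case
  proof (rule fps_ext)
    fix S
    have "fps_nth (\<Prod>e\<in>insert e0 E. Abs_fps (\<lambda>s. \<Sum>n | deg n = s. a e n)) S
        = (\<Sum>i\<le>S. (\<Sum>n | deg n = i. a e0 n) * (\<Sum>h\<in>?H E (S - i). ?P E h))"
      using insert by (simp add: fps_mult_nth atMost_atLeast0)
    also have "\<dots> = (\<Sum>i\<le>S. \<Sum>(n, h)\<in>{n. deg n = i} \<times> ?H E (S - i). a e0 n * ?P E h)"
      by (simp add: sum_product sum.cartesian_product)
    also have "\<dots> = (\<Sum>(i, n, h)\<in>(SIGMA i:{..S}. {n. deg n = i} \<times> ?H E (S - i)). a e0 n * ?P E h)"
      using fin finH by (subst sum.Sigma) (auto simp: case_prod_unfold)
    \<comment> \<open>A family on the larger set is its value at e0 together with its restriction, which is reset to undefined at e0.\<close>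
    also have "\<dots> = (\<Sum>h\<in>?H (insert e0 E) S. ?P (insert e0 E) h)"
    proof (rule sum.reindex_bij_witness[where i = "\<lambda>h. (deg (h e0), h e0, h(e0 := undefined))"
          and j = "\<lambda>(i, n, h). h(e0 := n)"])
      fix p assume "p \<in> (SIGMA i:{..S}. {n. deg n = i} \<times> ?H E (S - i))"
      then obtain n h where p: "p = (deg n, n, h)" "deg n \<le> S" "h \<in> PiE E (\<lambda>_. UNIV)"
        "(\<Sum>e\<in>E. deg (h e)) = S - deg n" by auto
      have cong: "(\<Sum>e\<in>E. deg ((h(e0 := n)) e)) = (\<Sum>e\<in>E. deg (h e))"
        "?P E (h(e0 := n)) = ?P E h"
        using insert by (auto intro!: sum.cong prod.cong)
      have "h e0 = undefined" using p insert by (auto simp: PiE_def extensional_def)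
      then show "(\<lambda>h. (deg (h e0), h e0, h(e0 := undefined))) (case p of (i, n, h) \<Rightarrow> h(e0 := n)) = p"
        unfolding p by (auto simp: fun_eq_iff)
      have "h(e0 := n) \<in> PiE (insert e0 E) (\<lambda>_. UNIV)" using p(3) by (intro PiE_fun_upd) auto
      then show "(case p of (i, n, h) \<Rightarrow> h(e0 := n)) \<in> ?H (insert e0 E) S"
        using p insert cong by simp
      show "?P (insert e0 E) (case p of (i, n, h) \<Rightarrow> h(e0 := n)) = (case p of (i, n, h) \<Rightarrow> a e0 n * ?P E h)"
        using p insert cong by simp
    next
      fix h assume h: "h \<in> ?H (insert e0 E) S"
      have cong: "(\<Sum>e\<in>E. deg ((h(e0 := undefined)) e)) = (\<Sum>e\<in>E. deg (h e))"
        using insert by (auto intro!: sum.cong)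
      show "(case (deg (h e0), h e0, h(e0 := undefined)) of (i, n, h) \<Rightarrow> h(e0 := n)) = h" by simp
      have "h(e0 := undefined) \<in> PiE E (\<lambda>_. UNIV)"
        using h by (auto simp: PiE_def extensional_def)
      then show "(deg (h e0), h e0, h(e0 := undefined)) \<in> (SIGMA i:{..S}. {n. deg n = i} \<times> ?H E (S - i))"
        using h insert cong by auto
    qed
    finally show "fps_nth (\<Prod>e\<in>insert e0 E. Abs_fps (\<lambda>s. \<Sum>n | deg n = s. a e n)) S
      = fps_nth (Abs_fps (\<lambda>S. \<Sum>h\<in>?H (insert e0 E) S. ?P (insert e0 E) h)) S" by simp
  qed
qed

lemma fps_prod_generating_UNIV:
  fixes deg :: "'b \<Rightarrow> nat" and a :: "'e::finite \<Rightarrow> 'b \<Rightarrow> 'c::comm_ring_1"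
  assumes "\<And>s. finite {n. deg n = s}"
  shows "(\<Prod>e\<in>UNIV. Abs_fps (\<lambda>s. \<Sum>n | deg n = s. a e n))
     = Abs_fps (\<lambda>S. \<Sum>h | (\<Sum>e\<in>UNIV. deg (h e)) = S. \<Prod>e\<in>UNIV. a e (h e))"
  using fps_prod_generating[OF assms, of UNIV a] by simp

lemma finite_functions_of_weight_UNIV:
  fixes deg :: "'b \<Rightarrow> nat"
  assumes "\<And>s. finite {n. deg n = s}"
  shows "finite {h :: 'e::finite \<Rightarrow> 'b. (\<Sum>e\<in>UNIV. deg (h e)) = S}"
  using finite_functions_of_weight[OF assms, of "UNIV :: 'e set"] by simp

section \<open>The kernel of the operator in the Hermite basis\<close>

text \<open>
  In the product defining \<open>Pker\<close> one scalar variable occurs in the \<open>k\<close> factors of one row. Their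
  product is \<open>row_poly\<close>, and \<open>row_coeff\<close> are its unnormalized Hermite coefficients.
\<close>

definition row_poly :: "('k::finite \<Rightarrow> nat) \<Rightarrow> real poly" where
  "row_poly n = (\<Prod>j\<in>UNIV. pcompose (He (n j)) [:0, lam CARD('k):])"

definition row_coeff :: "('k::finite \<Rightarrow> nat) \<Rightarrow> nat \<Rightarrow> real" where
  "row_coeff n r = gint (row_poly n * He r)"

lemma poly_row_poly:
  "poly (row_poly (n :: 'k::finite \<Rightarrow> nat)) x = (\<Prod>j\<in>UNIV. poly (He (n j)) (lam CARD('k) * x))"
  by (simp add: row_poly_def poly_prod poly_pcompose mult.commute)

lemma degree_row_poly: "degree (row_poly (n :: 'k::finite \<Rightarrow> nat)) \<le> (\<Sum>j\<in>UNIV. n j)"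
proof -
  have "degree (row_poly n) \<le> (\<Sum>j\<in>UNIV. degree (pcompose (He (n j)) [:0, lam CARD('k):]))"
    unfolding row_poly_def by (rule degree_prod_sum_le[unfolded comp_def]) simp
  also have "\<dots> \<le> (\<Sum>j\<in>UNIV. n j)"
    by (intro sum_mono) (simp add: degree_pcompose)
  finally show ?thesis .
qed

text \<open>
  Coefficient extraction from \<open>fps_Mehler_scaled_power\<close>: the reproducing kernel of \<open>k\<close> rescaled copies
  of a variable, expressed by that of the variable itself.
\<close>

lemma row_addition_formula:
  fixes x y :: real
  shows "(\<Sum>n :: 'k::finite \<Rightarrow> nat | (\<Sum>j\<in>UNIV. n j) = S. poly (row_poly n) x * poly (row_poly n) y / (\<Prod>j\<in>UNIV. fact (n j)))
    = (\<Sum>r\<le>S. fps_nth (fps_eigenvalues ((real CARD('k) - 1) / 2)) (S - r) *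
        (poly (He r) x * poly (He r) y / fact r))"
  (is "(\<Sum>n | _ n = S. ?t n) = _")
proof -
  let ?l = "lam CARD('k)"
  let ?a = "\<lambda>n. poly (He n) (?l * x) * poly (He n) (?l * y) / fact n"
  have "fps_Mehler (?l * x) (?l * y) ^ CARD('k) = (\<Prod>j\<in>(UNIV::'k set). Abs_fps (\<lambda>s. \<Sum>n | id n = s. ?a n))"
    by (simp add: fps_Mehler_def)
  also have "\<dots> = Abs_fps (\<lambda>S. \<Sum>h | (\<Sum>e\<in>(UNIV::'k set). id (h e)) = S. \<Prod>e\<in>UNIV. ?a (h e))"
    by (rule fps_prod_generating_UNIV) simp
  finally have "fps_nth (fps_Mehler (?l * x) (?l * y) ^ CARD('k)) S
     = (\<Sum>h | (\<Sum>e\<in>(UNIV::'k set). h e) = S. \<Prod>e\<in>UNIV. ?a (h e))" by simp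
  also have "\<dots> = (\<Sum>h | (\<Sum>e\<in>UNIV. h e) = S. ?t h)"
    by (intro sum.cong refl) (simp add: poly_row_poly prod.distrib prod_dividef)
  finally have "(\<Sum>n | (\<Sum>j\<in>UNIV. n j) = S. ?t n) = fps_nth (fps_Mehler (?l * x) (?l * y) ^ CARD('k)) S" ..
  also have "\<dots> = fps_nth (fps_Mehler x y * fps_eigenvalues ((real CARD('k) - 1) / 2)) S"
    by (subst fps_Mehler_scaled_power) (auto simp: mult.commute Suc_le_eq)
  also have "\<dots> = (\<Sum>r\<le>S. fps_nth (fps_eigenvalues ((real CARD('k) - 1) / 2)) (S - r) *
        (poly (He r) x * poly (He r) y / fact r))"
    by (simp add: fps_mult_nth fps_Mehler_def atMost_atLeast0) (simp add: mult_ac)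
  finally show ?thesis .
qed

text \<open>
  Integrate the addition formula against \<open>H\<^sub>r (x)\<close> and then against \<open>H\<^sub>r\<^sub>' (y)\<close>.
\<close>

lemma row_coeff_orthogonality:
  "(\<Sum>n :: 'k::finite \<Rightarrow> nat | (\<Sum>j\<in>UNIV. n j) = S. row_coeff n r * row_coeff n r' / (\<Prod>j\<in>UNIV. fact (n j)))
    = (if r = r' \<and> r \<le> S then fact r * fps_nth (fps_eigenvalues ((real CARD('k) - 1) / 2)) (S - r) else 0)"
  (is "sum _ ?N = _")
proof -
  let ?g = "\<lambda>r. fps_nth (fps_eigenvalues ((real CARD('k) - 1) / 2)) (S - r)"
  let ?w = "\<lambda>n :: 'k \<Rightarrow> nat. (\<Prod>j\<in>UNIV. fact (n j)) :: real"
  have delta: "(\<Sum>i\<le>S. f i * (if i = r then fact r else 0) / fact i) = (if r \<le> S then f r else 0)"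
    for r and f :: "nat \<Rightarrow> real"
  proof -
    have "(\<Sum>i\<le>S. f i * (if i = r then fact r else 0) / fact i) = (\<Sum>i\<le>S. if i = r then f r else 0)"
      by (intro sum.cong) auto
    then show ?thesis by simp
  qed
  have 1: "(\<Sum>n\<in>?N. poly (row_poly n) y * row_coeff n r / ?w n) = (if r \<le> S then ?g r * poly (He r) y else 0)" for y r
  proof -
    have "(\<Sum>n\<in>?N. smult (poly (row_poly n) y / ?w n) (row_poly n))
        = (\<Sum>i\<le>S. smult (?g i * poly (He i) y / fact i) (He i))"
      unfolding poly_eq_poly_eq_iff[symmetric]
      by (rule ext) (use row_addition_formula[where 'k='k and y=y and S=S] in \<open>simp add: poly_sum mult_ac\<close>)
    then have "gint ((\<Sum>n\<in>?N. smult (poly (row_poly n) y / ?w n) (row_poly n)) * He r)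
        = gint ((\<Sum>i\<le>S. smult (?g i * poly (He i) y / fact i) (He i)) * He r)"
      by simp
    then show ?thesis
      by (simp add: sum_distrib_right gint_sum gint_smult gint_He_He delta row_coeff_def)
  qed
  have "(\<Sum>n\<in>?N. smult (row_coeff n r / ?w n) (row_poly n)) = (if r \<le> S then smult (?g r) (He r) else 0)"
    unfolding poly_eq_poly_eq_iff[symmetric]
    by (rule ext) (use 1[where r=r] in \<open>simp add: poly_sum mult_ac\<close>)
  then have "gint ((\<Sum>n\<in>?N. smult (row_coeff n r / ?w n) (row_poly n)) * He r')
      = gint ((if r \<le> S then smult (?g r) (He r) else 0) * He r')" by simp
  also have "gint ((\<Sum>n\<in>?N. smult (row_coeff n r / ?w n) (row_poly n)) * He r')
      = (\<Sum>n\<in>?N. row_coeff n r * row_coeff n r' / ?w n)"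
    by (simp add: sum_distrib_right gint_sum gint_smult row_coeff_def)
  also have "gint ((if r \<le> S then smult (?g r) (He r) else 0) * He r')
      = (if r = r' \<and> r \<le> S then fact r * ?g r else 0)"
    by (simp add: gint_smult gint_He_He gint_def[of 0])
  finally show ?thesis .
qed

text \<open>
  A matrix is cut into the rows of scalar indices that share a variable; such rows are indexed by a
  row number and a coordinate of the space.
\<close>

definition mat_row :: "nat ^ 'd ^ 'k ^ 'l \<Rightarrow> 'l \<times> 'd \<Rightarrow> 'k \<Rightarrow> nat" where
  "mat_row M e j = M $ fst e $ j $ snd e"

lemma bij_mat_row: "bij (mat_row :: nat ^ 'd ^ 'k ^ 'l \<Rightarrow> _)"
  by (rule bij_betw_byWitness[where f' = "\<lambda>h. \<chi> i j c. h (i, c) j"])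
     (auto simp: mat_row_def vec_eq_iff fun_eq_iff)

lemma sum_UNIV_prod: "(\<Sum>e\<in>UNIV. f e) = (\<Sum>i\<in>UNIV. \<Sum>c\<in>UNIV. f (i, c))"
  by (simp add: sum.cartesian_product)

lemma prod_UNIV_prod: "(\<Prod>e\<in>UNIV. f e) = (\<Prod>i\<in>UNIV. \<Prod>c\<in>UNIV. f (i, c))"
  by (simp add: prod.cartesian_product)

lemma mat_abs_rows: "mat_abs M = (\<Sum>e\<in>UNIV. \<Sum>j\<in>UNIV. mat_row M e j)"
  unfolding mat_abs_def mi_abs_def mat_row_def sum_UNIV_prod fst_conv snd_conv
  by (intro sum.cong refl sum.swap)

lemma mat_fact_rows: "mat_fact M = (\<Prod>e\<in>UNIV. \<Prod>j\<in>UNIV. fact (mat_row M e j))"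
  unfolding mat_fact_def mi_fact_def mat_row_def prod_UNIV_prod fst_conv snd_conv
  by (intro prod.cong refl prod.swap)

lemma mat_fact_pos: "mat_fact M > 0"
  unfolding mat_fact_def mi_fact_def by (intro prod_pos) auto

lemma finite_row_level: "finite {n :: 'k::finite \<Rightarrow> nat. (\<Sum>j\<in>UNIV. n j) = s}"
  using finite_functions_of_weight_UNIV[of id] by simp

lemma finite_level: "finite {M :: nat ^ 'd ^ 'k ^ 'l. mat_abs M = S}"
proof -
  have "finite (mat_row ` {M :: nat ^ 'd ^ 'k ^ 'l. mat_abs M = S})"
    by (rule finite_subset[OF _ finite_functions_of_weight_UNIV[OF finite_row_level, of S]])
       (auto simp: mat_abs_rows)
  then show ?thesis
    by (rule finite_imageD) (rule inj_on_subset[OF bij_is_inj[OF bij_mat_row]], simp)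
qed

text \<open>
  The unnormalized Hermite coefficients of the function \<open>H\<^sub>M (A x)\<close>.
\<close>

definition mat_coeff :: "nat ^ 'd ^ 'k ^ 'l \<Rightarrow> ('l \<times> 'd \<Rightarrow> nat) \<Rightarrow> real" where
  "mat_coeff M p = (\<Prod>e\<in>UNIV. row_coeff (mat_row M e) (p e))"

text \<open>
  The coefficient of \<open>z\<^sup>S\<close> in \<open>z\<^sup>r (1 - z\<^sup>2)\<^sup>-\<^sup>\<mu>\<close>, which will be the eigenvalue of \<open>Pop\<close> on level \<open>S\<close>
  for the Hermite polynomials of degree \<open>r\<close>.
\<close>

definition level_eigenvalue :: "real \<Rightarrow> nat \<Rightarrow> nat \<Rightarrow> real" where
  "level_eigenvalue \<mu> S r = (if r \<le> S then fps_nth (fps_eigenvalues \<mu>) (S - r) else 0)"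

text \<open>
  The vectors of Hermite coefficients, indexed by \<open>p\<close>, are orthogonal in the Fock space of a level. The
  generating function over all levels factors over the scalar variables, and the exponents
  \<open>(k - 1) / 2\<close> of the \<open>l d\<close> factors add up to \<open>\<mu>\<close>.
\<close>

lemma mat_coeff_orthogonality:
  fixes p q :: "'l::finite \<times> 'd::finite \<Rightarrow> nat"
  assumes mu: "\<mu> = (real CARD('k::finite) - 1) * real CARD('l) * real CARD('d) / 2"
  shows "(\<Sum>M :: nat ^ 'd ^ 'k ^ 'l | mat_abs M = S. mat_coeff M p * mat_coeff M q / mat_fact M)
    = (if p = q then (\<Prod>e\<in>UNIV. fact (p e)) * level_eigenvalue \<mu> S (\<Sum>e\<in>UNIV. p e) else 0)"
proof -
  let ?a = "\<lambda>e n :: 'k \<Rightarrow> nat. row_coeff n (p e) * row_coeff n (q e) / (\<Prod>j\<in>UNIV. fact (n j))"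
  let ?G = "fps_eigenvalues ((real CARD('k) - 1) / 2)"
  have "(\<Sum>M :: nat ^ 'd ^ 'k ^ 'l | mat_abs M = S. mat_coeff M p * mat_coeff M q / mat_fact M)
      = (\<Sum>M :: nat ^ 'd ^ 'k ^ 'l | mat_abs M = S. \<Prod>e\<in>UNIV. ?a e (mat_row M e))"
    by (simp add: mat_coeff_def mat_fact_rows prod.distrib prod_dividef)
  also have "\<dots> = (\<Sum>h | (\<Sum>e\<in>(UNIV :: ('l \<times> 'd) set). \<Sum>j\<in>UNIV. h e j) = S. \<Prod>e\<in>UNIV. ?a e (h e))"
  proof (rule sum.reindex_bij_betw)
    show "bij_betw mat_row {M :: nat ^ 'd ^ 'k ^ 'l. mat_abs M = S}
        {h. (\<Sum>e\<in>UNIV. \<Sum>j\<in>UNIV. h e j) = S}"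
    proof (rule bij_betw_subset[OF bij_mat_row subset_UNIV], intro equalityI subsetI)
      fix h :: "'l \<times> 'd \<Rightarrow> 'k \<Rightarrow> nat" assume h: "h \<in> {h. (\<Sum>e\<in>UNIV. \<Sum>j\<in>UNIV. h e j) = S}"
      obtain M where "h = mat_row M" using bij_is_surj[OF bij_mat_row] by (metis surjD)
      then show "h \<in> mat_row ` {M. mat_abs M = S}" using h by (auto simp: mat_abs_rows)
    qed (auto simp: mat_abs_rows)
  qed
  also have "\<dots> = fps_nth (\<Prod>e\<in>UNIV. Abs_fps (\<lambda>s. \<Sum>n | (\<Sum>j\<in>UNIV. n j) = s. ?a e n)) S"
    by (subst fps_prod_generating_UNIV[OF finite_row_level]) simp
  also have "(\<lambda>e. Abs_fps (\<lambda>s. \<Sum>n | (\<Sum>j\<in>UNIV. n j) = s. ?a e n))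
      = (\<lambda>e. if p e = q e then fps_const (fact (p e)) * (fps_X ^ p e * ?G) else 0)"
    by (rule ext, rule fps_ext) (simp add: row_coeff_orthogonality fps_X_power_mult_nth)
  also have "fps_nth (\<Prod>e\<in>UNIV. if p e = q e then fps_const (fact (p e)) * (fps_X ^ p e * ?G) else 0) S
      = (if p = q then (\<Prod>e\<in>UNIV. fact (p e)) * level_eigenvalue \<mu> S (\<Sum>e\<in>UNIV. p e) else 0)"
  proof (cases "p = q")
    case False
    then obtain e where "p e \<noteq> q e" by (metis ext)
    then have "(\<Prod>e\<in>UNIV. if p e = q e then fps_const (fact (p e)) * (fps_X ^ p e * ?G) else 0) = 0"
      by (intro prod_zero bexI[of _ e]) simp_all
    then show ?thesis using False by (simp only: fps_zero_nth if_False)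
  next
    case True
    have const: "(\<Prod>e\<in>UNIV. fps_const (fact (p e) :: real)) = fps_const (\<Prod>e\<in>UNIV. fact (p e))"
      by (induction rule: infinite_finite_induct[of _ "UNIV :: ('l \<times> 'd) set"]) simp_all
    have "real CARD('l \<times> 'd) * ((real CARD('k) - 1) / 2) = \<mu>"
      unfolding mu by (simp add: card_prod)
    then have G: "?G ^ CARD('l \<times> 'd) = fps_eigenvalues \<mu>"
      by (simp only: fps_eigenvalues_power)
    have "(\<Prod>e\<in>UNIV. fps_const (fact (p e)) * (fps_X ^ p e * ?G))
       = fps_const (\<Prod>e\<in>UNIV. fact (p e)) * (fps_X ^ (\<Sum>e\<in>UNIV. p e) * fps_eigenvalues \<mu>)"
      by (simp only: prod.distrib const power_sum[symmetric] prod_constant G)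
    then show ?thesis using True
      by (simp add: level_eigenvalue_def fps_X_power_mult_nth)
  qed
  finally show ?thesis .
qed


lemma product_sigma_finite_gauss: "product_sigma_finite (\<lambda>_::'l. gauss :: (real ^ 'd::finite) measure)"
  by (simp add: product_sigma_finite_def prob_space_gauss prob_space_imp_sigma_finite)

lemma prod_Herm_rows:
  fixes M N :: "nat ^ 'd ^ 'k ^ 'l"
  shows "(\<Prod>j\<in>UNIV. Herm (M $ i $ j) (lam CARD('k) *\<^sub>R x) * Herm (N $ i $ j) (lam CARD('k) *\<^sub>R x))
    = (\<Prod>c\<in>UNIV. poly (row_poly (mat_row M (i, c)) * row_poly (mat_row N (i, c))) (x $ c))"
  unfolding Herm_def hermite_eq_He poly_mult poly_row_poly mat_row_def prod.distrib[symmetric]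
  by (subst prod.swap) simp

lemma Pker_rows:
  "Pker M N = (\<Prod>e\<in>UNIV. gint (row_poly (mat_row M e) * row_poly (mat_row N e)))"
  for M N :: "nat ^ 'd ^ 'k ^ 'l"
proof -
  interpret product_sigma_finite "\<lambda>_::'l. gauss :: (real ^ 'd) measure"
    by (rule product_sigma_finite_gauss)
  let ?q = "\<lambda>i c. row_poly (mat_row M (i, c)) * row_poly (mat_row N (i, c))"
  have "Pker M N = (\<Prod>i\<in>UNIV. \<integral>x. (\<Prod>c\<in>UNIV. poly (?q i c) (x $ c)) \<partial>gauss)"
    unfolding Pker_def prod_Herm_rows
    by (rule product_integral_prod) (simp_all only: finite_class.finite_UNIV integral_gauss_prod(1)[OF integrable_poly_gauss])
  also have "\<dots> = (\<Prod>i\<in>UNIV. \<Prod>c\<in>UNIV. gint (?q i c))"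
    by (simp only: integral_gauss_prod(2)[OF integrable_poly_gauss] gint_def)
  finally show ?thesis by (simp only: prod_UNIV_prod)
qed

text \<open>
  \<open>Pker\<close> is the Gram matrix of the functions \<open>H\<^sub>M (A x)\<close>; expand it by Parseval's identity in each variable.
\<close>

lemma Pker_expansion:
  fixes M N :: "nat ^ 'd ^ 'k ^ 'l"
  assumes M: "mat_abs M \<le> S"
  shows "Pker M N = (\<Sum>p | \<forall>e. p e \<le> S. mat_coeff M p * mat_coeff N p / (\<Prod>e\<in>UNIV. fact (p e)))"
proof -
  have "(\<Sum>j\<in>UNIV. mat_row M e j) \<le> S" for e
    using M member_le_sum[of e UNIV "\<lambda>e. \<Sum>j\<in>UNIV. mat_row M e j"] unfolding mat_abs_rows by simp
  then have deg: "degree (row_poly (mat_row M e)) \<le> S" for e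
    by (rule order_trans[OF degree_row_poly])
  have "Pker M N = (\<Prod>e\<in>UNIV. \<Sum>r\<le>S. row_coeff (mat_row M e) r * row_coeff (mat_row N e) r / fact r)"
    unfolding Pker_rows row_coeff_def by (intro prod.cong refl gint_mult_He_expansion[OF deg])
  also have "\<dots> = (\<Sum>p\<in>PiE UNIV (\<lambda>_. {..S}). \<Prod>e\<in>UNIV. row_coeff (mat_row M e) (p e) * row_coeff (mat_row N e) (p e) / fact (p e))"
    by (rule prod_sum_PiE) auto
  also have "PiE UNIV (\<lambda>_. {..S}) = {p :: 'l \<times> 'd \<Rightarrow> nat. \<forall>e. p e \<le> S}"
    by (auto simp: PiE_def)
  finally show ?thesis
    by (simp add: mat_coeff_def prod.distrib prod_dividef)
qed

section \<open>Spectral decomposition on a level\<close>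

definition index_set :: "nat \<Rightarrow> ('l::finite \<times> 'd::finite \<Rightarrow> nat) set" where
  "index_set S = {p. \<forall>e. p e \<le> S}"

definition index_fact :: "('l::finite \<times> 'd::finite \<Rightarrow> nat) \<Rightarrow> real" where
  "index_fact p = (\<Prod>e\<in>UNIV. fact (p e))"

text \<open>
  The unnormalized Hermite coefficients of the polynomial \<open>(\<Sum>M. \<phi> M * H\<^sub>M (A x))\<close> of level \<open>S\<close>; its squared
  norm is \<open>level_form\<close>, which turns out to be the quadratic form of \<open>Pop\<close>.
\<close>

definition level_coeff :: "nat \<Rightarrow> (nat ^ 'd ^ 'k ^ 'l \<Rightarrow> complex) \<Rightarrow> ('l \<times> 'd \<Rightarrow> nat) \<Rightarrow> complex" where
  "level_coeff S \<phi> p = (\<Sum>M | mat_abs M = S. \<phi> M * of_real (mat_coeff M p))"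

definition level_inner :: "nat \<Rightarrow> (nat ^ 'd ^ 'k ^ 'l \<Rightarrow> complex) \<Rightarrow> (nat ^ 'd ^ 'k ^ 'l \<Rightarrow> complex) \<Rightarrow> complex" where
  "level_inner S \<phi> \<psi> = (\<Sum>M | mat_abs M = S. \<phi> M * cnj (\<psi> M) * of_real (mat_fact M))"

definition level_norm2 :: "nat \<Rightarrow> (nat ^ 'd ^ 'k ^ 'l \<Rightarrow> complex) \<Rightarrow> real" where
  "level_norm2 S \<phi> = (\<Sum>M | mat_abs M = S. (cmod (\<phi> M))\<^sup>2 * mat_fact M)"

definition level_form :: "nat \<Rightarrow> (nat ^ 'd ^ 'k ^ 'l \<Rightarrow> complex) \<Rightarrow> real" where
  "level_form S \<phi> = (\<Sum>p\<in>index_set S. (cmod (level_coeff S \<phi> p))\<^sup>2 / index_fact p)"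

text \<open>
  The Hermite coefficients at one multi-index \<open>q\<close>, as a vector of level \<open>S\<close>. By \<open>Pop_level_vector\<close> it is an eigenvector of \<open>Pop\<close> or zero.
\<close>

definition level_vector :: "nat \<Rightarrow> ('l \<times> 'd \<Rightarrow> nat) \<Rightarrow> nat ^ 'd ^ 'k ^ 'l \<Rightarrow> complex" where
  "level_vector S q M = (if mat_abs M = S then of_real (mat_coeff M q / mat_fact M) else 0)"

lemma index_fact_pos: "index_fact p > 0"
  unfolding index_fact_def by (intro prod_pos) auto

lemma index_fact_neq_0 [simp]: "index_fact p \<noteq> 0"
  using index_fact_pos[of p] by simp

lemma mat_fact_neq_0 [simp]: "mat_fact M \<noteq> 0"
  using mat_fact_pos[of M] by simp

lemma finite_index_set: "finite (index_set S :: ('l::finite \<times> 'd::finite \<Rightarrow> nat) set)"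
proof -
  have "finite (PiE (UNIV :: ('l \<times> 'd) set) (\<lambda>_. {..S}))" by (intro finite_PiE) auto
  then show ?thesis by (simp add: index_set_def PiE_def Pi_def)
qed

lemma level_norm2_nonneg: "level_norm2 S \<phi> \<ge> 0"
  unfolding level_norm2_def using mat_fact_pos by (intro sum_nonneg mult_nonneg_nonneg) (auto intro: less_imp_le)

lemma level_form_nonneg: "level_form S \<phi> \<ge> 0"
  unfolding level_form_def using index_fact_pos by (intro sum_nonneg divide_nonneg_pos) auto

lemma level_inner_self: "level_inner S \<phi> \<phi> = of_real (level_norm2 S \<phi>)"
  unfolding level_inner_def level_norm2_def of_real_sum
  by (intro sum.cong refl) (simp add: complex_norm_square[symmetric] del: of_real_power)

lemma Pop_expansion:
  fixes \<phi> :: "nat ^ 'd ^ 'k ^ 'l \<Rightarrow> complex"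
  assumes M: "mat_abs M = S"
  shows "Pop \<phi> M * of_real (mat_fact M)
    = (\<Sum>p\<in>index_set S. level_coeff S \<phi> p * of_real (mat_coeff M p / index_fact p))"
proof -
  have "Pop \<phi> M * of_real (mat_fact M) = (\<Sum>N | mat_abs N = S. \<phi> N * of_real (Pker M N))"
    using mat_fact_pos[of M] unfolding Pop_def M by (simp add: sum_distrib_right)
  also have "\<dots> = (\<Sum>N | mat_abs N = S. \<Sum>p\<in>index_set S. \<phi> N * of_real (mat_coeff N p) * of_real (mat_coeff M p / index_fact p))"
    unfolding Pker_expansion[OF eq_refl[OF M]] index_set_def[symmetric] index_fact_def[symmetric]
    by (simp add: sum_distrib_left mult_ac)
  also have "\<dots> = (\<Sum>p\<in>index_set S. level_coeff S \<phi> p * of_real (mat_coeff M p / index_fact p))"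
    unfolding level_coeff_def sum_distrib_right by (rule sum.swap)
  finally show ?thesis .
qed

lemma level_inner_Pop_right:
  "level_inner S \<phi> (Pop \<psi>) = (\<Sum>p\<in>index_set S. level_coeff S \<phi> p * cnj (level_coeff S \<psi> p) / of_real (index_fact p))"
proof -
  have "level_inner S \<phi> (Pop \<psi>) = (\<Sum>M | mat_abs M = S. \<phi> M * cnj (Pop \<psi> M * of_real (mat_fact M)))"
    unfolding level_inner_def by (simp add: mult_ac)
  also have "\<dots> = (\<Sum>M | mat_abs M = S. \<Sum>p\<in>index_set S. \<phi> M * of_real (mat_coeff M p) * (cnj (level_coeff S \<psi> p) / of_real (index_fact p)))"
    by (intro sum.cong refl) (simp add: Pop_expansion sum_distrib_left mult_ac)
  also have "\<dots> = (\<Sum>p\<in>index_set S. level_coeff S \<phi> p * (cnj (level_coeff S \<psi> p) / of_real (index_fact p)))"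
    unfolding level_coeff_def[of S \<phi>] sum_distrib_right by (rule sum.swap)
  finally show ?thesis by simp
qed

lemma level_inner_Pop_left:
  "level_inner S (Pop \<phi>) \<psi> = level_inner S \<phi> (Pop \<psi>)"
proof -
  have c: "level_inner S \<phi> \<psi> = cnj (level_inner S \<psi> \<phi>)" for \<phi> \<psi> :: "nat ^ 'd ^ 'k ^ 'l \<Rightarrow> complex"
    unfolding level_inner_def by (simp add: mult_ac)
  show ?thesis
    unfolding c[of "Pop \<phi>"] level_inner_Pop_right by (simp add: mult_ac)
qed

lemma level_inner_Pop_self: "level_inner S \<phi> (Pop \<phi>) = of_real (level_form S \<phi>)"
  unfolding level_inner_Pop_right level_form_def of_real_sum
  by (intro sum.cong refl) (simp add: complex_norm_square[symmetric] del: of_real_power)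

text \<open>
  By orthogonality \<open>Pop\<close> acts diagonally on the coefficients.
\<close>

lemma level_coeff_Pop:
  fixes \<phi> :: "nat ^ 'd ^ 'k ^ 'l \<Rightarrow> complex"
  assumes mu: "\<mu> = (real CARD('k::finite) - 1) * real CARD('l::finite) * real CARD('d::finite) / 2"
    and q: "q \<in> index_set S"
  shows "level_coeff S (Pop \<phi>) q = of_real (level_eigenvalue \<mu> S (\<Sum>e\<in>UNIV. q e)) * level_coeff S \<phi> q"
proof -
  have "level_coeff S (Pop \<phi>) q
      = (\<Sum>M | mat_abs M = S. Pop \<phi> M * of_real (mat_fact M) * of_real (mat_coeff M q / mat_fact M))"
    unfolding level_coeff_def by (intro sum.cong refl) simp
  also have "\<dots> = (\<Sum>M :: nat ^ 'd ^ 'k ^ 'l | mat_abs M = S. \<Sum>p\<in>index_set S. level_coeff S \<phi> p / of_real (index_fact p)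
       * of_real (mat_coeff M p * mat_coeff M q / mat_fact M))"
    by (intro sum.cong refl) (simp add: Pop_expansion sum_distrib_left sum_divide_distrib mult_ac)
  also have "\<dots> = (\<Sum>p\<in>index_set S. level_coeff S \<phi> p / of_real (index_fact p)
       * of_real (\<Sum>M :: nat ^ 'd ^ 'k ^ 'l | mat_abs M = S. mat_coeff M p * mat_coeff M q / mat_fact M))"
    unfolding of_real_sum sum_distrib_left by (rule sum.swap)
  also have "\<dots> = (\<Sum>p\<in>index_set S. if p = q then of_real (level_eigenvalue \<mu> S (\<Sum>e\<in>UNIV. q e)) * level_coeff S \<phi> q else 0)"
    unfolding mat_coeff_orthogonality[OF mu] index_fact_def[symmetric]
    using index_fact_pos[of q] by (intro sum.cong refl) auto
  also have "\<dots> = of_real (level_eigenvalue \<mu> S (\<Sum>e\<in>UNIV. q e)) * level_coeff S \<phi> q"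
    using q by (simp add: finite_index_set)
  finally show ?thesis .
qed

lemma level_norm2_Pop:
  fixes \<phi> :: "nat ^ 'd ^ 'k ^ 'l \<Rightarrow> complex"
  assumes mu: "\<mu> = (real CARD('k::finite) - 1) * real CARD('l::finite) * real CARD('d::finite) / 2"
  shows "level_norm2 S (Pop \<phi>) = (\<Sum>p\<in>index_set S. level_eigenvalue \<mu> S (\<Sum>e\<in>UNIV. p e)
    * ((cmod (level_coeff S \<phi> p))\<^sup>2 / index_fact p))"
proof -
  have "of_real (level_norm2 S (Pop \<phi>)) = level_inner S (Pop \<phi>) (Pop \<phi>)"
    by (rule level_inner_self[symmetric])
  also have "\<dots> = of_real (\<Sum>p\<in>index_set S. level_eigenvalue \<mu> S (\<Sum>e\<in>UNIV. p e)
    * ((cmod (level_coeff S \<phi> p))\<^sup>2 / index_fact p))"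
    unfolding level_inner_Pop_right of_real_sum
    by (intro sum.cong refl) (simp add: level_coeff_Pop[OF mu] mult_ac complex_norm_square[symmetric] del: of_real_power)
  finally show ?thesis by (simp only: of_real_eq_iff)
qed

text \<open>
  Both bounds come from the diagonal form without completing the eigenvectors to a basis: if \<open>\<Lambda>\<close> bounds
  the eigenvalues, then \<open>|P \<phi>|\<^sup>2 \<le> \<Lambda> \<langle>\<phi>, P \<phi>\<rangle>\<close>, and \<open>|\<Lambda> \<phi> - P \<phi>|\<^sup>2 \<ge> 0\<close> gives the rest.
\<close>

lemma
  fixes \<phi> :: "nat ^ 'd ^ 'k ^ 'l \<Rightarrow> complex"
  assumes mu: "\<mu> = (real CARD('k::finite) - 1) * real CARD('l::finite) * real CARD('d::finite) / 2"
    and bound: "\<And>r. level_eigenvalue \<mu> S r \<le> \<Lambda>" and "\<Lambda> > 0"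
  shows level_form_le: "level_form S \<phi> \<le> \<Lambda> * level_norm2 S \<phi>"
    and level_norm2_Pop_le: "level_norm2 S (Pop \<phi>) \<le> \<Lambda>\<^sup>2 * level_norm2 S \<phi>"
proof -
  have 1: "level_norm2 S (Pop \<phi>) \<le> \<Lambda> * level_form S \<phi>"
    unfolding level_norm2_Pop[OF mu] level_form_def sum_distrib_left
    using index_fact_pos by (intro sum_mono mult_right_mono bound divide_nonneg_pos) auto
  define \<psi> where "\<psi> = (\<lambda>M. of_real \<Lambda> * \<phi> M - Pop \<phi> M)"
  have exp: "level_inner S \<psi> \<psi> = of_real (\<Lambda>\<^sup>2) * level_inner S \<phi> \<phi>
      - of_real \<Lambda> * (level_inner S \<phi> (Pop \<phi>) + level_inner S (Pop \<phi>) \<phi>) + level_inner S (Pop \<phi>) (Pop \<phi>)"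
    unfolding level_inner_def \<psi>_def sum_distrib_left sum.distrib[symmetric] sum_subtractf[symmetric]
    by (intro sum.cong refl) (simp add: algebra_simps power2_eq_square)
  have "of_real (level_norm2 S \<psi>) = (of_real (\<Lambda>\<^sup>2 * level_norm2 S \<phi> - 2 * \<Lambda> * level_form S \<phi> + level_norm2 S (Pop \<phi>)) :: complex)"
    using exp unfolding level_inner_Pop_left level_inner_Pop_self level_inner_self[of S \<psi>]
    level_inner_self[of S \<phi>] 
    unfolding level_inner_Pop_left[symmetric] level_inner_self by (simp add: algebra_simps)
  then have "level_norm2 S \<psi> = \<Lambda>\<^sup>2 * level_norm2 S \<phi> - 2 * \<Lambda> * level_form S \<phi> + level_norm2 S (Pop \<phi>)"
    by (simp only: of_real_eq_iff)
  then have 2: "\<Lambda> * level_form S \<phi> \<le> \<Lambda>\<^sup>2 * level_norm2 S \<phi>"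
    using 1 level_norm2_nonneg[of S \<psi>] by linarith
  then show "level_form S \<phi> \<le> \<Lambda> * level_norm2 S \<phi>"
    using \<open>\<Lambda> > 0\<close> by (simp add: power2_eq_square mult.assoc)
  show "level_norm2 S (Pop \<phi>) \<le> \<Lambda>\<^sup>2 * level_norm2 S \<phi>" using 1 2 by linarith
qed

text \<open>
  For the eigenvalue \<open>0\<close> the orthogonality relation says that the vector vanishes.
\<close>

lemma mat_coeff_eq_0:
  fixes M :: "nat ^ 'd ^ 'k ^ 'l"
  assumes mu: "\<mu> = (real CARD('k::finite) - 1) * real CARD('l::finite) * real CARD('d::finite) / 2"
    and "level_eigenvalue \<mu> (mat_abs M) (\<Sum>e\<in>UNIV. p e) = 0"
  shows "mat_coeff M p = 0"
proof -
  have "(\<Sum>N :: nat ^ 'd ^ 'k ^ 'l | mat_abs N = mat_abs M. mat_coeff N p * mat_coeff N p / mat_fact N) = 0"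
    using mat_coeff_orthogonality[OF mu, of p p "mat_abs M"] assms(2) by simp
  then have "mat_coeff M p * mat_coeff M p / mat_fact M = 0"
    by (subst (asm) sum_nonneg_eq_0_iff) (auto simp: finite_level intro!: divide_nonneg_pos mat_fact_pos)
  then show ?thesis using mat_fact_pos[of M] by simp
qed

lemma Pop_Pop_eq:
  fixes \<phi> :: "nat ^ 'd ^ 'k ^ 'l \<Rightarrow> complex"
  assumes mu: "\<mu> = (real CARD('k::finite) - 1) * real CARD('l::finite) * real CARD('d::finite) / 2"
    and 1: "\<mu> = 1"
  shows "Pop (Pop \<phi>) = Pop \<phi>"
proof
  fix M :: "nat ^ 'd ^ 'k ^ 'l"
  define S where "S = mat_abs M"
  have ev: "level_eigenvalue \<mu> S r = 0 \<or> level_eigenvalue \<mu> S r = 1" for r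
    unfolding level_eigenvalue_def fps_eigenvalues_def 1 by (simp add: pochhammer_fact[symmetric])
  have "Pop (Pop \<phi>) M * of_real (mat_fact M) = Pop \<phi> M * of_real (mat_fact M)"
    unfolding Pop_expansion[OF S_def[symmetric]]
  proof (intro sum.cong refl)
    fix p :: "'l \<times> 'd \<Rightarrow> nat" assume "p \<in> index_set S"
    then show "level_coeff S (Pop \<phi>) p * of_real (mat_coeff M p / index_fact p)
        = level_coeff S \<phi> p * of_real (mat_coeff M p / index_fact p)"
      using ev[of "\<Sum>e\<in>UNIV. p e"] mat_coeff_eq_0[OF mu, of M p] level_coeff_Pop[OF mu, of p S \<phi>]
      unfolding S_def by auto
  qed
  then show "Pop (Pop \<phi>) M = Pop \<phi> M" using mat_fact_pos[of M] by simp
qed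

lemma Pop_level_vector:
  assumes mu: "\<mu> = (real CARD('k::finite) - 1) * real CARD('l::finite) * real CARD('d::finite) / 2"
    and q: "q \<in> index_set S"
  shows "Pop (level_vector S q :: nat ^ 'd ^ 'k ^ 'l \<Rightarrow> complex)
    = (\<lambda>M. of_real (level_eigenvalue \<mu> S (\<Sum>e\<in>UNIV. q e)) * level_vector S q M)"
proof
  fix M :: "nat ^ 'd ^ 'k ^ 'l"
  let ?v = "level_vector S q :: nat ^ 'd ^ 'k ^ 'l \<Rightarrow> complex"
  let ?e = "level_eigenvalue \<mu> S (\<Sum>e\<in>UNIV. q e)"
  show "Pop ?v M = of_real ?e * ?v M"
  proof (cases "mat_abs M = S")
    case False
    then show ?thesis by (auto simp: Pop_def level_vector_def intro!: sum.neutral)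
  next
    case True
    have c: "level_coeff S ?v p = of_real (if q = p then index_fact q * ?e else 0)" for p
    proof -
      have "level_coeff S ?v p = of_real (\<Sum>M :: nat ^ 'd ^ 'k ^ 'l | mat_abs M = S. mat_coeff M q * mat_coeff M p / mat_fact M)"
        unfolding level_coeff_def of_real_sum by (intro sum.cong refl) (simp add: level_vector_def)
      then show ?thesis unfolding mat_coeff_orthogonality[OF mu] index_fact_def .
    qed
    have "Pop ?v M * of_real (mat_fact M) = (\<Sum>p\<in>index_set S. if q = p then of_real (?e * mat_coeff M q) else 0)"
      unfolding Pop_expansion[OF True] c using index_fact_pos[of q] by (intro sum.cong refl) auto
    also have "\<dots> = of_real (?e * mat_coeff M q)"
      using q by (simp add: finite_index_set)
    also have "\<dots> = of_real ?e * ?v M * of_real (mat_fact M)"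
      using True mat_fact_pos[of M] by (simp add: level_vector_def)
    finally show ?thesis using mat_fact_pos[of M] by simp
  qed
qed

lemma level_norm2_level_vector:
  assumes mu: "\<mu> = (real CARD('k::finite) - 1) * real CARD('l::finite) * real CARD('d::finite) / 2"
  shows "level_norm2 S (level_vector S q :: nat ^ 'd ^ 'k ^ 'l \<Rightarrow> complex)
    = index_fact q * level_eigenvalue \<mu> S (\<Sum>e\<in>UNIV. q e)"
proof -
  have "level_norm2 S (level_vector S q :: nat ^ 'd ^ 'k ^ 'l \<Rightarrow> complex)
      = (\<Sum>M :: nat ^ 'd ^ 'k ^ 'l | mat_abs M = S. mat_coeff M q * mat_coeff M q / mat_fact M)"
    unfolding level_norm2_def using mat_fact_pos
    by (intro sum.cong refl)
       (auto simp: level_vector_def norm_divide power2_eq_square abs_mult_self_eq less_imp_neq[symmetric] divide_simps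
         abs_of_pos simp flip: of_real_divide)
  then show ?thesis unfolding mat_coeff_orthogonality[OF mu] index_fact_def by simp
qed

section \<open>Projections, operator norms and their growth\<close>

lemma summable_on_imp_level_sums:
  fixes f :: "nat ^ 'd ^ 'k ^ 'l \<Rightarrow> 'a::banach"
  assumes "f summable_on UNIV"
  shows "(\<lambda>S. \<Sum>M | mat_abs M = S. f M) sums (\<Sum>\<^sub>\<infinity>M. f M)"
proof -
  let ?L = "\<lambda>S. {M :: nat ^ 'd ^ 'k ^ 'l. mat_abs M = S}"
  have bij: "bij_betw snd (Sigma UNIV ?L) UNIV"
    by (rule bij_betwI[of _ _ _ "\<lambda>M. (mat_abs M, M)"]) auto
  have "(f has_sum (\<Sum>\<^sub>\<infinity>M. f M)) UNIV" using assms by simp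
  then have "((\<lambda>x. f (snd x)) has_sum (\<Sum>\<^sub>\<infinity>M. f M)) (Sigma UNIV ?L)"
    by (simp add: has_sum_reindex_bij_betw[OF bij])
  then have "((\<lambda>S. \<Sum>M\<in>?L S. f M) has_sum (\<Sum>\<^sub>\<infinity>M. f M)) UNIV"
    by (rule has_sum_SigmaD) (auto intro!: has_sum_finiteI finite_level)
  then show ?thesis by (rule has_sum_imp_sums)
qed

lemma level_sums_imp_summable_on:
  fixes f :: "nat ^ 'd ^ 'k ^ 'l \<Rightarrow> real"
  assumes nn: "\<And>M. f M \<ge> 0" and s: "summable (\<lambda>S. \<Sum>M | mat_abs M = S. f M)"
  shows "f summable_on UNIV"
proof (rule nonneg_bdd_above_summable_on)
  show "bdd_above (sum f ` {F. F \<subseteq> UNIV \<and> finite F})"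
  proof (rule bdd_aboveI2)
    fix F :: "(nat ^ 'd ^ 'k ^ 'l) set" assume "F \<in> {F. F \<subseteq> UNIV \<and> finite F}"
    then have F: "finite F" by simp
    define N where "N = Suc (Max (insert 0 (mat_abs ` F)))"
    have le: "mat_abs M < N" if "M \<in> F" for M
      unfolding N_def using F that by (intro le_imp_less_Suc Max_ge) auto
    have "sum f F \<le> sum f (\<Union>S<N. {M. mat_abs M = S})"
      using F le nn by (intro sum_mono2) (auto simp: finite_level)
    also have "\<dots> = (\<Sum>S<N. \<Sum>M | mat_abs M = S. f M)"
      by (subst sum.UNION_disjoint) (auto simp: finite_level)
    also have "\<dots> \<le> (\<Sum>S. \<Sum>M | mat_abs M = S. f M)"
      using nn by (intro sum_le_suminf s sum_nonneg) auto
    finally show "sum f F \<le> (\<Sum>S. \<Sum>M | mat_abs M = S. f M)" .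
  qed
qed (rule nn)

lemma Fock_iff: "\<phi> \<in> Fock \<longleftrightarrow> summable (\<lambda>S. level_norm2 S \<phi>)"
proof
  assume "\<phi> \<in> Fock"
  then have "(\<lambda>M. (cmod (\<phi> M))\<^sup>2 * mat_fact M) summable_on UNIV" by (simp add: Fock_def)
  from summable_on_imp_level_sums[OF this] show "summable (\<lambda>S. level_norm2 S \<phi>)"
    unfolding level_norm2_def by (rule sums_summable)
next
  assume "summable (\<lambda>S. level_norm2 S \<phi>)"
  then show "\<phi> \<in> Fock" unfolding Fock_def level_norm2_def mem_Collect_eq
    using mat_fact_pos by (intro level_sums_imp_summable_on mult_nonneg_nonneg) (auto intro: less_imp_le)
qed

lemma Fock_product_summable:
  assumes "\<phi> \<in> Fock" "\<psi> \<in> Fock"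
  shows "(\<lambda>M. \<phi> M * cnj (\<psi> M) * of_real (mat_fact M)) summable_on UNIV"
proof -
  have s: "(\<lambda>M. (cmod (\<phi> M))\<^sup>2 * mat_fact M + (cmod (\<psi> M))\<^sup>2 * mat_fact M) summable_on UNIV"
    using assms unfolding Fock_def by (auto intro: summable_on_add)
  have "(\<lambda>M. norm (\<phi> M * cnj (\<psi> M) * of_real (mat_fact M))) summable_on UNIV"
  proof (rule summable_on_comparison_test[OF s])
    fix M
    have "2 * (cmod (\<phi> M) * cmod (\<psi> M)) \<le> (cmod (\<phi> M))\<^sup>2 + (cmod (\<psi> M))\<^sup>2"
      using sum_squares_bound[of "cmod (\<phi> M)" "cmod (\<psi> M)"] by (simp add: mult_ac)
    moreover have "0 \<le> cmod (\<phi> M) * cmod (\<psi> M)" by simp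
    ultimately have "cmod (\<phi> M) * cmod (\<psi> M) \<le> (cmod (\<phi> M))\<^sup>2 + (cmod (\<psi> M))\<^sup>2" by linarith
    then have "cmod (\<phi> M) * cmod (\<psi> M) * mat_fact M \<le> ((cmod (\<phi> M))\<^sup>2 + (cmod (\<psi> M))\<^sup>2) * mat_fact M"
      using mat_fact_pos[of M] by (intro mult_right_mono) auto
    then show "norm (\<phi> M * cnj (\<psi> M) * of_real (mat_fact M)) \<le> (cmod (\<phi> M))\<^sup>2 * mat_fact M + (cmod (\<psi> M))\<^sup>2 * mat_fact M"
      using mat_fact_pos[of M] by (simp add: norm_mult algebra_simps)
  qed simp
  then show ?thesis by (rule abs_summable_summable)
qed

lemma Fock_inner_sums:
  assumes "(\<lambda>M. \<phi> M * cnj (\<psi> M) * of_real (mat_fact M)) summable_on UNIV"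
  shows "(\<lambda>S. level_inner S \<phi> \<psi>) sums Fock_inner \<phi> \<psi>"
  using summable_on_imp_level_sums[OF assms] unfolding level_inner_def Fock_inner_def .

lemma Fock_inner_level:
  assumes "\<phi> \<in> Fock_level S \<or> \<psi> \<in> Fock_level S"
  shows "Fock_inner \<phi> \<psi> = level_inner S \<phi> \<psi>"
proof -
  have "Fock_inner \<phi> \<psi> = (\<Sum>\<^sub>\<infinity>M\<in>{M. mat_abs M = S}. \<phi> M * cnj (\<psi> M) * of_real (mat_fact M))"
    unfolding Fock_inner_def using assms by (intro infsum_cong_neutral) (auto simp: Fock_level_def)
  then show ?thesis by (simp add: level_inner_def finite_level)
qed

lemma Fock_norm_level: "\<phi> \<in> Fock_level S \<Longrightarrow> Fock_norm \<phi> = sqrt (level_norm2 S \<phi>)"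
  unfolding Fock_norm_def by (simp add: Fock_inner_level level_inner_self)

lemma Pop_level: "\<phi> \<in> Fock_level S \<Longrightarrow> Pop \<phi> \<in> Fock_level S"
  unfolding Fock_level_def Pop_def by (auto intro!: sum.neutral)

lemma Fock_level_subset: "Fock_level S \<subseteq> Fock"
proof
  fix \<phi> :: "nat ^ 'd ^ 'k ^ 'l \<Rightarrow> complex" assume "\<phi> \<in> Fock_level S"
  then have "level_norm2 T \<phi> = 0" if "T \<notin> {S}" for T
    using that unfolding level_norm2_def Fock_level_def by (intro sum.neutral) auto
  then show "\<phi> \<in> Fock" unfolding Fock_iff by (intro summable_finite[of "{S}"]) auto
qed

lemma Fock_norm_scale:
  assumes "\<phi> \<in> Fock_level S" "c \<ge> 0"
  shows "Fock_norm (\<lambda>M. of_real c * \<phi> M) = c * Fock_norm \<phi>"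
proof -
  have "(\<lambda>M. of_real c * \<phi> M) \<in> Fock_level S" using assms(1) by (simp add: Fock_level_def)
  moreover have "level_norm2 S (\<lambda>M. of_real c * \<phi> M) = c\<^sup>2 * level_norm2 S \<phi>"
    unfolding level_norm2_def sum_distrib_left
    by (intro sum.cong refl) (simp add: norm_mult power_mult_distrib)
  ultimately show ?thesis using assms by (simp add: Fock_norm_level real_sqrt_mult)
qed

lemma Pop_linear: "Pop (\<lambda>M. a * \<phi> M + b * \<psi> M) = (\<lambda>M. a * Pop \<phi> M + b * Pop \<psi> M)"
  unfolding Pop_def by (simp add: algebra_simps sum.distrib sum_distrib_left)

lemma projection_on_level:
  assumes "\<forall>\<phi>\<in>Fock_level S :: (nat ^ 'd ^ 'k ^ 'l \<Rightarrow> complex) set. Pop (Pop \<phi>) = Pop \<phi>"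
  shows "projection_on (Fock_level S :: (nat ^ 'd ^ 'k ^ 'l \<Rightarrow> complex) set) Pop"
  unfolding projection_on_def
  using assms by (auto simp: Pop_level Pop_linear Fock_inner_level[of _ S] level_inner_Pop_left)

lemma level_eigenvalue_diff: "level_eigenvalue \<mu> (r + 2 * m) r = pochhammer \<mu> m / fact m"
  by (simp add: level_eigenvalue_def fps_eigenvalues_def)

lemma level_eigenvalue_cases:
  obtains "level_eigenvalue \<mu> S r = 0" | m where "m \<le> S div 2" "level_eigenvalue \<mu> S r = pochhammer \<mu> m / fact m"
proof (cases "r \<le> S \<and> even (S - r)")
  case True
  then have "level_eigenvalue \<mu> S r = pochhammer \<mu> ((S - r) div 2) / fact ((S - r) div 2)"
    by (simp add: level_eigenvalue_def fps_eigenvalues_def del: even_diff_nat)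
  then show ?thesis by (intro that(2)[of "(S - r) div 2"]) (auto intro: div_le_mono)
next
  case False
  then show ?thesis by (intro that(1)) (auto simp: level_eigenvalue_def fps_eigenvalues_def)
qed

lemma pochhammer_fact_mono:
  assumes "\<mu> \<ge> (1::real)" "m \<le> n"
  shows "pochhammer \<mu> m / fact m \<le> pochhammer \<mu> n / fact n"
  using assms(2)
proof (induction n rule: dec_induct)
  case (step n)
  have pos: "pochhammer \<mu> n / fact n > 0" using assms(1) by (intro divide_pos_pos pochhammer_pos) auto
  have "pochhammer \<mu> (Suc n) / fact (Suc n) = pochhammer \<mu> n / fact n * ((\<mu> + n) / (1 + n))"
    by (simp add: pochhammer_Suc)
  moreover have "(\<mu> + n) / (1 + n) \<ge> 1" using assms(1) by simp
  ultimately have "pochhammer \<mu> (Suc n) / fact (Suc n) \<ge> pochhammer \<mu> n / fact n"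
    using mult_left_mono[of 1 "(\<mu> + n) / (1 + n)" "pochhammer \<mu> n / fact n"] pos by simp
  then show ?case using step by linarith
qed simp

lemma pochhammer_fact_pos: "\<mu> > (0::real) \<Longrightarrow> pochhammer \<mu> m / fact m > 0"
  by (intro divide_pos_pos pochhammer_pos) auto

lemma level_eigenvalue_le:
  assumes "\<mu> \<ge> 1"
  shows "level_eigenvalue \<mu> S r \<le> pochhammer \<mu> (S div 2) / fact (S div 2)"
proof (cases rule: level_eigenvalue_cases[of \<mu> S r])
  case 1 then show ?thesis using pochhammer_fact_pos[of \<mu> "S div 2"] assms by simp
next
  case (2 m) then show ?thesis using pochhammer_fact_mono[OF assms, of m "S div 2"] by simp
qed

text \<open>
  For \<open>\<mu> < 1\<close> the eigenvalues decrease in \<open>m\<close>. Raising \<open>\<mu>\<close> by one gives a bound that serves all \<open>\<mu> > 0\<close>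
  and still grows only polynomially.
\<close>

lemma level_eigenvalue_le_shifted:
  assumes "\<mu> > 0"
  shows "level_eigenvalue \<mu> S r \<le> pochhammer (\<mu> + 1) (S div 2) / fact (S div 2)"
proof (cases rule: level_eigenvalue_cases[of \<mu> S r])
  case 1 then show ?thesis using pochhammer_fact_pos[of "\<mu> + 1" "S div 2"] assms by simp
next
  case (2 m)
  have "pochhammer \<mu> m \<le> pochhammer (\<mu> + 1) m"
    unfolding pochhammer_prod using assms by (intro prod_mono) auto
  then have "pochhammer \<mu> m / fact m \<le> pochhammer (\<mu> + 1) m / fact m"
    by (intro divide_right_mono) auto
  then show ?thesis using 2 pochhammer_fact_mono[of "\<mu> + 1" m "S div 2"] assms by simp
qed

text \<open>
  Take the eigenvector of a Hermite polynomial of degree \<open>r\<close> in a single variable.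
\<close>

lemma eigenvector_exists:
  assumes mu: "\<mu> = (real CARD('k::finite) - 1) * real CARD('l::finite) * real CARD('d::finite) / 2"
    and pos: "\<mu> > 0" and S: "S = r + 2 * m"
  obtains v :: "nat ^ 'd ^ 'k ^ 'l \<Rightarrow> complex"
  where "v \<in> Fock_level S" "Fock_norm v = 1" "Pop v = (\<lambda>M. of_real (pochhammer \<mu> m / fact m) * v M)"
proof -
  define e0 :: "'l \<times> 'd" where "e0 = undefined"
  define q :: "'l \<times> 'd \<Rightarrow> nat" where "q = (\<lambda>e. if e = e0 then r else 0)"
  define v :: "nat ^ 'd ^ 'k ^ 'l \<Rightarrow> complex" where "v = level_vector S q"
  let ?ev = "pochhammer \<mu> m / fact m"
  have q: "q \<in> index_set S" "(\<Sum>e\<in>UNIV. q e) = r"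
    using S by (auto simp: q_def index_set_def)
  have v: "v \<in> Fock_level S" by (simp add: v_def Fock_level_def level_vector_def)
  have ev: "level_eigenvalue \<mu> S r = ?ev" unfolding S by (rule level_eigenvalue_diff)
  have P: "Pop v = (\<lambda>M. of_real ?ev * v M)"
    using Pop_level_vector[OF mu q(1)] unfolding v_def q(2) ev .
  have n: "level_norm2 S v = index_fact q * ?ev"
    using level_norm2_level_vector[OF mu, of S q] unfolding v_def q(2) ev .
  define c where "c = sqrt (level_norm2 S v)"
  have "level_norm2 S v > 0"
    unfolding n by (intro mult_pos_pos index_fact_pos pochhammer_fact_pos pos)
  then have c: "c > 0" "level_norm2 S v = c\<^sup>2" by (simp_all add: c_def)
  define w where "w = (\<lambda>M. of_real (1 / c) * v M)"
  have "level_norm2 S w = level_norm2 S v / c\<^sup>2"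
    unfolding level_norm2_def sum_divide_distrib w_def
    by (intro sum.cong refl) (simp add: norm_mult norm_divide power_divide)
  then have "level_norm2 S w = 1" using c by simp
  moreover have w: "w \<in> Fock_level S" using v by (simp add: w_def Fock_level_def)
  ultimately have "Fock_norm w = 1" by (simp add: Fock_norm_level)
  moreover have "Pop w = (\<lambda>M. of_real ?ev * w M)"
    using Pop_linear[of "of_real (1 / c)" v 0 v] unfolding w_def by (simp add: P mult_ac)
  ultimately show ?thesis using w that by blast
qed

lemma Pop_idempotent_on_level_iff:
  assumes mu: "\<mu> = (real CARD('k::finite) - 1) * real CARD('l::finite) * real CARD('d::finite) / 2"
    and pos: "\<mu> > 0" and S: "S \<ge> 2"
  shows "(\<forall>\<phi>\<in>Fock_level S :: (nat ^ 'd ^ 'k ^ 'l \<Rightarrow> complex) set. Pop (Pop \<phi>) = Pop \<phi>) \<longleftrightarrow> \<mu> = 1"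
proof
  assume idem: "\<forall>\<phi>\<in>Fock_level S :: (nat ^ 'd ^ 'k ^ 'l \<Rightarrow> complex) set. Pop (Pop \<phi>) = Pop \<phi>"
  have "S = (S - 2) + 2 * 1" using S by simp
  from eigenvector_exists[OF mu pos this]
  obtain v :: "nat ^ 'd ^ 'k ^ 'l \<Rightarrow> complex" where v: "v \<in> Fock_level S" "Fock_norm v = 1"
    "Pop v = (\<lambda>M. of_real (pochhammer \<mu> 1 / fact 1) * v M)" .
  have Pv: "Pop v = (\<lambda>M. of_real \<mu> * v M)" using v(3) by simp
  have "Pop (Pop v) = (\<lambda>M. of_real \<mu> * (of_real \<mu> * v M))"
    using Pop_linear[of "of_real \<mu>" v 0 v] by (simp add: Pv)
  then have eq: "of_real \<mu> * (of_real \<mu> * v M) = of_real \<mu> * v M" for M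
    using idem v(1) Pv by metis
  obtain M where "v M \<noteq> 0"
  proof -
    have "\<exists>M. v M \<noteq> 0"
    proof (rule ccontr)
      assume "\<nexists>M. v M \<noteq> 0"
      then have "Fock_norm v = 0" by (simp add: Fock_norm_def Fock_inner_def)
      then show False using v(2) by simp
    qed
    then show thesis using that by blast
  qed
  then show "\<mu> = 1" using eq[of M] pos by simp
qed (use Pop_Pop_eq[OF mu] in blast)

lemma
  assumes mu: "\<mu> = (real CARD('k::finite) - 1) * real CARD('l::finite) * real CARD('d::finite) / 2"
    and 1: "\<mu> = 1"
  shows Pop_Fock: "\<phi> \<in> Fock \<Longrightarrow> Pop \<phi> \<in> (Fock :: (nat ^ 'd ^ 'k ^ 'l \<Rightarrow> complex) set)"
    and projection_on_Fock: "projection_on (Fock :: (nat ^ 'd ^ 'k ^ 'l \<Rightarrow> complex) set) Pop"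
proof -
  have le: "level_eigenvalue \<mu> S r \<le> 1" for S r
    using level_eigenvalue_le[of \<mu> S r] unfolding 1 by (simp add: pochhammer_fact[symmetric])
  show F: "Pop \<phi> \<in> Fock" if "\<phi> \<in> Fock" for \<phi> :: "nat ^ 'd ^ 'k ^ 'l \<Rightarrow> complex"
    using that unfolding Fock_iff
  proof (rule summable_comparison_test'[of _ 0])
    fix S show "norm (level_norm2 S (Pop \<phi>)) \<le> level_norm2 S \<phi>"
      using level_norm2_Pop_le[OF mu le, of S \<phi>] level_norm2_nonneg[of S "Pop \<phi>"] by simp
  qed
  have sa: "Fock_inner (Pop \<phi>) \<psi> = Fock_inner \<phi> (Pop \<psi>)" if "\<phi> \<in> Fock" "\<psi> \<in> Fock"
    for \<phi> \<psi> :: "nat ^ 'd ^ 'k ^ 'l \<Rightarrow> complex"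
    using Fock_inner_sums[OF Fock_product_summable[OF F[OF that(1)] that(2)]]
      Fock_inner_sums[OF Fock_product_summable[OF that(1) F[OF that(2)]]]
    unfolding level_inner_Pop_left by (rule sums_unique2)
  show "projection_on (Fock :: (nat ^ 'd ^ 'k ^ 'l \<Rightarrow> complex) set) Pop"
    unfolding projection_on_def using F sa by (auto simp: Pop_linear Pop_Pop_eq[OF mu 1])
qed

lemma Fock_opnorm_level:
  assumes mu: "\<mu> = (real CARD('k::finite) - 1) * real CARD('l::finite) * real CARD('d::finite) / 2"
    and ge: "\<mu> \<ge> 1"
  shows "Fock_opnorm (Fock_level S :: (nat ^ 'd ^ 'k ^ 'l \<Rightarrow> complex) set) Pop
    = ennreal (pochhammer \<mu> (S div 2) / fact (S div 2))"
proof -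
  let ?L = "pochhammer \<mu> (S div 2) / fact (S div 2)"
  have L: "?L > 0" using pochhammer_fact_pos[of \<mu>] ge by simp
  show ?thesis unfolding Fock_opnorm_def
  proof (rule antisym[OF SUP_least])
    fix \<phi> :: "nat ^ 'd ^ 'k ^ 'l \<Rightarrow> complex" assume "\<phi> \<in> {\<phi> \<in> Fock_level S. Fock_norm \<phi> \<le> 1}"
    then have \<phi>: "\<phi> \<in> Fock_level S" "sqrt (level_norm2 S \<phi>) \<le> 1" by (auto simp: Fock_norm_level)
    have "Fock_norm (Pop \<phi>) = sqrt (level_norm2 S (Pop \<phi>))" by (rule Fock_norm_level[OF Pop_level[OF \<phi>(1)]])
    also have "\<dots> \<le> sqrt (?L\<^sup>2 * level_norm2 S \<phi>)"
      by (intro real_sqrt_le_mono level_norm2_Pop_le[OF mu level_eigenvalue_le[OF ge] L])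
    also have "\<dots> = ?L * sqrt (level_norm2 S \<phi>)"
      using L by (simp only: real_sqrt_mult real_sqrt_abs abs_of_pos)
    also have "\<dots> \<le> ?L" by (rule mult_left_le[OF \<phi>(2) less_imp_le[OF L]])
    finally show "ennreal (Fock_norm (Pop \<phi>)) \<le> ennreal ?L" by (rule ennreal_leI)
  next
    have "S = S mod 2 + 2 * (S div 2)" by simp
    then obtain v :: "nat ^ 'd ^ 'k ^ 'l \<Rightarrow> complex" where v: "v \<in> Fock_level S" "Fock_norm v = 1"
      "Pop v = (\<lambda>M. of_real ?L * v M)"
      using eigenvector_exists[OF mu, of S "S mod 2" "S div 2"] ge by auto
    have "Fock_norm (Pop v) = ?L * Fock_norm v"
      unfolding v(3) by (rule Fock_norm_scale[OF v(1) less_imp_le[OF L]])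
    then show "ennreal ?L \<le> (SUP \<phi>\<in>{\<phi> \<in> Fock_level S :: (nat ^ 'd ^ 'k ^ 'l \<Rightarrow> complex) set. Fock_norm \<phi> \<le> 1}. ennreal (Fock_norm (Pop \<phi>)))"
      using v by (intro SUP_upper2[of v]) auto
  qed
qed

text \<open>
  Euler's limit formula for the Gamma function, with one factor of the Pochhammer symbol split off.
\<close>

lemma pochhammer_fact_asymp:
  fixes \<mu> :: real
  assumes "\<mu> > 0"
  shows "(\<lambda>n. (pochhammer \<mu> n / fact n) / (real n powr (\<mu> - 1) / Gamma \<mu>)) \<longlonglongrightarrow> 1"
proof -
  have G: "Gamma \<mu> > 0" using assms by (rule Gamma_real_pos)
  have "(\<lambda>n. Gamma \<mu> / Gamma_series \<mu> n * (real n / (\<mu> + real n))) \<longlonglongrightarrow> Gamma \<mu> / Gamma \<mu> * 1"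
  proof (intro tendsto_intros)
    show "(\<lambda>n. real n / (\<mu> + real n)) \<longlonglongrightarrow> 1" by real_asymp
  qed (use G in auto)
  then have lim: "(\<lambda>n. Gamma \<mu> / Gamma_series \<mu> n * (real n / (\<mu> + real n))) \<longlonglongrightarrow> 1"
    using G by simp
  show ?thesis
  proof (rule Lim_transform_eventually[OF lim])
    show "\<forall>\<^sub>F n in sequentially. Gamma \<mu> / Gamma_series \<mu> n * (real n / (\<mu> + real n))
        = (pochhammer \<mu> n / fact n) / (real n powr (\<mu> - 1) / Gamma \<mu>)"
      using eventually_gt_at_top[of 0]
    proof eventually_elim
      case (elim n)
      have e: "exp (\<mu> * ln (real n)) = real n powr (\<mu> - 1) * real n"
        using elim by (simp add: powr_def exp_diff algebra_simps)
      have p: "pochhammer \<mu> (n + 1) = pochhammer \<mu> n * (\<mu> + real n)"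
        by (simp add: pochhammer_Suc)
      have nz: "real n powr (\<mu> - 1) \<noteq> 0" "\<mu> + real n \<noteq> 0" "real n \<noteq> 0" "pochhammer \<mu> n \<noteq> 0"
        using elim assms pochhammer_pos[OF assms, of n] by auto
      show ?case
        unfolding Gamma_series_def p of_real_eq_id id_apply e using nz by (simp add: divide_simps)
    qed
  qed
qed

lemma pochhammer_fact_asymp_equiv:
  fixes \<mu> :: real
  assumes "\<mu> > 0"
  shows "(\<lambda>S. pochhammer \<mu> (S div 2) / fact (S div 2))
    \<sim>[sequentially] (\<lambda>S. real S powr (\<mu> - 1) / (2 powr (\<mu> - 1) * Gamma \<mu>))"
proof (rule asymp_equivI')
  have G: "Gamma \<mu> > 0" using assms by (rule Gamma_real_pos)
  have half: "filterlim (\<lambda>S::nat. S div 2) sequentially sequentially"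
    by (rule filterlim_at_top_div_const_nat) simp
  have 1: "(\<lambda>S. (pochhammer \<mu> (S div 2) / fact (S div 2)) / (real (S div 2) powr (\<mu> - 1) / Gamma \<mu>)) \<longlonglongrightarrow> 1"
    using filterlim_compose[OF pochhammer_fact_asymp[OF assms] half] .
  have r: "(\<lambda>S. real (S div 2) / (real S / 2)) \<longlonglongrightarrow> 1"
  proof (rule tendsto_sandwich)
    show "\<forall>\<^sub>F S in sequentially. 1 - 1 / real S \<le> real (S div 2) / (real S / 2)"
      using eventually_gt_at_top[of 0]
    proof eventually_elim
      case (elim S)
      have "real S \<le> 2 * real (S div 2) + 1"
      proof -
        have "S \<le> 2 * (S div 2) + 1" by presburger
        then have "real S \<le> real (2 * (S div 2) + 1)" by (simp only: of_nat_le_iff)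
        then show ?thesis by (simp only: of_nat_add of_nat_mult of_nat_numeral of_nat_1)
      qed
      then have "(real S - 1) / real S \<le> (2 * real (S div 2)) / real S"
        by (intro divide_right_mono) auto
      then show ?case using elim by (simp add: diff_divide_distrib mult.commute)
    qed
    show "\<forall>\<^sub>F S in sequentially. real (S div 2) / (real S / 2) \<le> 1"
      using eventually_gt_at_top[of 0]
    proof eventually_elim
      case (elim S)
      have "2 * real (S div 2) \<le> real S"
      proof -
        have "2 * (S div 2) \<le> S" by presburger
        then have "real (2 * (S div 2)) \<le> real S" by (simp only: of_nat_le_iff)
        then show ?thesis by (simp only: of_nat_mult of_nat_numeral)
      qed
      then show ?case using elim by (simp add: field_simps)
    qed
    show "(\<lambda>S. 1 - 1 / real S) \<longlonglongrightarrow> 1" by real_asymp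
  qed simp
  have 2: "(\<lambda>S. (real (S div 2) / (real S / 2)) powr (\<mu> - 1)) \<longlonglongrightarrow> 1 powr (\<mu> - 1)"
    by (intro tendsto_powr r tendsto_const) simp
  have "(\<lambda>S. (pochhammer \<mu> (S div 2) / fact (S div 2)) / (real (S div 2) powr (\<mu> - 1) / Gamma \<mu>)
      * (real (S div 2) / (real S / 2)) powr (\<mu> - 1)) \<longlonglongrightarrow> 1"
    using tendsto_mult[OF 1 2] by simp
  then show "(\<lambda>S. (pochhammer \<mu> (S div 2) / fact (S div 2)) / (real S powr (\<mu> - 1) / (2 powr (\<mu> - 1) * Gamma \<mu>))) \<longlonglongrightarrow> 1"
  proof (rule Lim_transform_eventually)
    show "\<forall>\<^sub>F S in sequentially. (pochhammer \<mu> (S div 2) / fact (S div 2)) / (real (S div 2) powr (\<mu> - 1) / Gamma \<mu>)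
      * (real (S div 2) / (real S / 2)) powr (\<mu> - 1)
      = (pochhammer \<mu> (S div 2) / fact (S div 2)) / (real S powr (\<mu> - 1) / (2 powr (\<mu> - 1) * Gamma \<mu>))"
      using eventually_gt_at_top[of 1]
    proof eventually_elim
      case (elim S)
      have id: "a / (x / g) * (x / (y / z)) = a / (y / (z * g))"
        if "x \<noteq> 0" "y \<noteq> 0" "z \<noteq> 0" "g \<noteq> 0" for a x y z g :: real
        using that by (simp add: divide_simps)
      have nz: "real (S div 2) powr (\<mu> - 1) \<noteq> 0" "real S powr (\<mu> - 1) \<noteq> 0" "2 powr (\<mu> - 1) \<noteq> (0::real)"
        using elim by simp_all
      have "(real (S div 2) / (real S / 2)) powr (\<mu> - 1) = real (S div 2) powr (\<mu> - 1) / (real S powr (\<mu> - 1) / 2 powr (\<mu> - 1))"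
        by (simp only: powr_divide of_nat_0_le_iff zero_le_numeral divide_nonneg_nonneg)
      then show ?case by (simp only: id[OF nz less_imp_neq[OF G, symmetric]])
    qed
  qed
qed

lemma pochhammer_fact_unbounded:
  fixes \<mu> :: real
  assumes "\<mu> > 1"
  shows "\<exists>m. pochhammer \<mu> m / fact m > C"
proof -
  define w where "w n = real n powr (\<mu> - 1) / Gamma \<mu>" for n
  have G: "Gamma \<mu> > 0" using assms by (intro Gamma_real_pos) auto
  have ln: "filterlim (\<lambda>n. ln (real n)) at_top sequentially"
    by (rule filterlim_compose[OF ln_at_top filterlim_real_sequentially])
  have "filterlim (\<lambda>n. (\<mu> - 1) * ln (real n)) at_top sequentially"
    using assms by (intro filterlim_tendsto_pos_mult_at_top[OF tendsto_const _ ln]) simp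
  then have "filterlim (\<lambda>n. exp ((\<mu> - 1) * ln (real n))) at_top sequentially"
    by (rule filterlim_compose[OF exp_at_top])
  then have "filterlim (\<lambda>n. inverse (Gamma \<mu>) * exp ((\<mu> - 1) * ln (real n))) at_top sequentially"
    using G by (intro filterlim_tendsto_pos_mult_at_top[OF tendsto_const]) auto
  moreover have "\<forall>\<^sub>F n in sequentially. inverse (Gamma \<mu>) * exp ((\<mu> - 1) * ln (real n)) = w n"
    using eventually_gt_at_top[of 0]
  proof eventually_elim
    case (elim n)
    then have "exp ((\<mu> - 1) * ln (real n)) = real n powr (\<mu> - 1)" by (simp only: powr_def) simp
    then show ?case by (simp only: w_def divide_real_def mult.commute)
  qed
  ultimately have w: "filterlim w at_top sequentially"
    using filterlim_cong[OF refl refl, of _ w sequentially at_top] by fast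
  have lim: "(\<lambda>n. (pochhammer \<mu> n / fact n) / w n) \<longlonglongrightarrow> 1"
    unfolding w_def by (rule pochhammer_fact_asymp) (use assms in simp)
  have "filterlim (\<lambda>n. (pochhammer \<mu> n / fact n) / w n * w n) at_top sequentially"
    by (rule filterlim_tendsto_pos_mult_at_top[OF lim zero_less_one w])
  then have "\<forall>\<^sub>F n in sequentially. C < (pochhammer \<mu> n / fact n) / w n * w n"
    by (simp add: filterlim_at_top_dense)
  moreover have "\<forall>\<^sub>F n in sequentially. 0 < w n"
    using w by (simp add: filterlim_at_top_dense)
  ultimately have "\<forall>\<^sub>F n in sequentially. C < pochhammer \<mu> n / fact n"
    by eventually_elim simp
  then show ?thesis by (rule eventually_happens'[OF sequentially_bot])
qed

text \<open>
  A bound for \<open>Pop\<close> would bound the norms on all levels, which tend to infinity.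
\<close>

lemma Pop_unbounded:
  assumes mu: "\<mu> = (real CARD('k::finite) - 1) * real CARD('l::finite) * real CARD('d::finite) / 2"
    and gt: "\<mu> > 1"
  shows "\<not> (\<exists>C. \<forall>\<phi>\<in>Fock :: (nat ^ 'd ^ 'k ^ 'l \<Rightarrow> complex) set.
    Pop \<phi> \<in> Fock \<longrightarrow> Fock_norm (Pop \<phi>) \<le> C * Fock_norm \<phi>)"
proof
  assume "\<exists>C. \<forall>\<phi>\<in>Fock :: (nat ^ 'd ^ 'k ^ 'l \<Rightarrow> complex) set.
    Pop \<phi> \<in> Fock \<longrightarrow> Fock_norm (Pop \<phi>) \<le> C * Fock_norm \<phi>"
  then obtain C where C: "\<And>\<phi> :: nat ^ 'd ^ 'k ^ 'l \<Rightarrow> complex. \<phi> \<in> Fock \<Longrightarrow> Pop \<phi> \<in> Fock \<Longrightarrow>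
    Fock_norm (Pop \<phi>) \<le> C * Fock_norm \<phi>" by blast
  obtain m where m: "pochhammer \<mu> m / fact m > C" using pochhammer_fact_unbounded[OF gt] by blast
  let ?S = "2 * m"
  have S: "?S div 2 = m" by simp
  have "ennreal (pochhammer \<mu> m / fact m) = Fock_opnorm (Fock_level ?S :: (nat ^ 'd ^ 'k ^ 'l \<Rightarrow> complex) set) Pop"
    using Fock_opnorm_level[OF mu, of ?S] gt unfolding S by simp
  also have "\<dots> \<le> ennreal C"
    unfolding Fock_opnorm_def
  proof (rule SUP_least)
    fix \<phi> :: "nat ^ 'd ^ 'k ^ 'l \<Rightarrow> complex" assume "\<phi> \<in> {\<phi> \<in> Fock_level ?S. Fock_norm \<phi> \<le> 1}"
    then have \<phi>: "\<phi> \<in> Fock_level ?S" "Fock_norm \<phi> \<le> 1" by auto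
    have "0 \<le> Fock_norm \<phi>" using \<phi>(1) by (simp add: Fock_norm_level level_norm2_nonneg)
    have "Fock_norm (Pop \<phi>) \<le> C * Fock_norm \<phi>"
      by (rule C[OF subsetD[OF Fock_level_subset \<phi>(1)] subsetD[OF Fock_level_subset Pop_level[OF \<phi>(1)]]])
    also have "\<dots> \<le> C"
    proof (cases "C \<ge> 0")
      case True then show ?thesis using \<phi>(2) by (simp add: mult_left_le)
    next
      case False
      obtain v :: "nat ^ 'd ^ 'k ^ 'l \<Rightarrow> complex" where v: "v \<in> Fock_level ?S" "Fock_norm v = 1"
        "Pop v = (\<lambda>M. of_real (pochhammer \<mu> m / fact m) * v M)"
        using eigenvector_exists[OF mu, of ?S 0 m] gt by (metis add_0 less_trans zero_less_one)
      have "0 \<le> Fock_norm (Pop v)"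
        by (simp add: Fock_norm_level[OF Pop_level[OF v(1)]] level_norm2_nonneg)
      moreover have "Fock_norm (Pop v) \<le> C * Fock_norm v"
        by (rule C[OF subsetD[OF Fock_level_subset v(1)] subsetD[OF Fock_level_subset Pop_level[OF v(1)]]])
      ultimately show ?thesis using False v(2) by simp
    qed
    finally show "ennreal (Fock_norm (Pop \<phi>)) \<le> ennreal C" by (rule ennreal_leI)
  qed
  finally show False using m pochhammer_fact_pos[of \<mu> m] gt
    by (simp add: ennreal_le_iff2 not_less)
qed

section \<open>Square integrable functions\<close>

abbreviation sqnorm :: "'a measure \<Rightarrow> ('a \<Rightarrow> complex) \<Rightarrow> real" where
  "sqnorm M f \<equiv> (\<integral>x. (cmod (f x))\<^sup>2 \<partial>M)"

lemma cmod_lincomb_sq: "(cmod (a * x + b * y))\<^sup>2 \<le> 2 * (cmod a)\<^sup>2 * (cmod x)\<^sup>2 + 2 * (cmod b)\<^sup>2 * (cmod y)\<^sup>2"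
proof -
  have "(cmod (a * x + b * y))\<^sup>2 \<le> (cmod (a * x) + cmod (b * y))\<^sup>2"
    by (intro power_mono norm_triangle_ineq) simp
  also have "\<dots> \<le> 2 * (cmod (a * x))\<^sup>2 + 2 * (cmod (b * y))\<^sup>2"
    using sum_squares_bound[of "cmod (a * x)" "cmod (b * y)"] by (simp add: power2_sum)
  finally show ?thesis by (simp add: norm_mult power_mult_distrib)
qed

lemma L2_measurable: "f \<in> L2 M \<Longrightarrow> f \<in> borel_measurable M"
  and L2_integrable: "f \<in> L2 M \<Longrightarrow> integrable M (\<lambda>x. (cmod (f x))\<^sup>2)"
  by (simp_all add: L2_def)

lemma
  assumes f: "f \<in> L2 M" and g: "g \<in> L2 M"
  shows L2_lincomb: "(\<lambda>x. a * f x + b * g x) \<in> L2 M"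
    and sqnorm_lincomb_le: "sqnorm M (\<lambda>x. a * f x + b * g x)
      \<le> 2 * (cmod a)\<^sup>2 * sqnorm M f + 2 * (cmod b)\<^sup>2 * sqnorm M g"
proof -
  have [measurable]: "f \<in> borel_measurable M" "g \<in> borel_measurable M" using f g by (auto simp: L2_def)
  have i: "integrable M (\<lambda>x. 2 * (cmod a)\<^sup>2 * (cmod (f x))\<^sup>2 + 2 * (cmod b)\<^sup>2 * (cmod (g x))\<^sup>2)"
    using f g by (intro Bochner_Integration.integrable_add integrable_mult_right L2_integrable)
  have j: "integrable M (\<lambda>x. (cmod (a * f x + b * g x))\<^sup>2)"
    by (rule Bochner_Integration.integrable_bound[OF i]) (use cmod_lincomb_sq in auto)
  then show "(\<lambda>x. a * f x + b * g x) \<in> L2 M" by (simp add: L2_def)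
  have "sqnorm M (\<lambda>x. a * f x + b * g x) \<le> (\<integral>x. 2 * (cmod a)\<^sup>2 * (cmod (f x))\<^sup>2 + 2 * (cmod b)\<^sup>2 * (cmod (g x))\<^sup>2 \<partial>M)"
    by (rule integral_mono[OF j i cmod_lincomb_sq])
  also have "\<dots> = 2 * (cmod a)\<^sup>2 * sqnorm M f + 2 * (cmod b)\<^sup>2 * sqnorm M g"
    using L2_integrable[OF f] L2_integrable[OF g] by simp
  finally show "sqnorm M (\<lambda>x. a * f x + b * g x) \<le> 2 * (cmod a)\<^sup>2 * sqnorm M f + 2 * (cmod b)\<^sup>2 * sqnorm M g" .
qed

lemma L2_diff: "f \<in> L2 M \<Longrightarrow> g \<in> L2 M \<Longrightarrow> (\<lambda>x. f x - g x) \<in> L2 M"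
  using L2_lincomb[of f M g 1 "-1"] by simp

lemma L2_scale: "f \<in> L2 M \<Longrightarrow> (\<lambda>x. a * f x) \<in> L2 M"
  using L2_lincomb[of f M f a 0] by simp

lemma L2_zero: "(\<lambda>_. 0) \<in> L2 M"
  by (simp add: L2_def)

lemma L2_sum: "(\<And>i. i \<in> A \<Longrightarrow> f i \<in> L2 M) \<Longrightarrow> (\<lambda>x. \<Sum>i\<in>A. f i x) \<in> L2 M"
proof (induction A rule: infinite_finite_induct)
  case (insert i A)
  then show ?case using L2_lincomb[of "f i" M "\<lambda>x. \<Sum>i\<in>A. f i x" 1 1] by simp
qed (simp_all add: L2_zero)

lemma sqnorm_nonneg: "sqnorm M f \<ge> 0"
  by simp

lemma sqnorm_minus: "sqnorm M (\<lambda>x. f x - g x) = sqnorm M (\<lambda>x. g x - f x)"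
  by (simp add: norm_minus_commute)

lemma sqnorm_triangle:
  assumes "f \<in> L2 M" "g \<in> L2 M" "h \<in> L2 M"
  shows "sqnorm M (\<lambda>x. f x - h x) \<le> 2 * sqnorm M (\<lambda>x. f x - g x) + 2 * sqnorm M (\<lambda>x. g x - h x)"
  using sqnorm_lincomb_le[OF L2_diff[OF assms(1,2)] L2_diff[OF assms(2,3)], of 1 1] by simp

lemma sqnorm_eq_0: "f \<in> L2 M \<Longrightarrow> sqnorm M f = 0 \<Longrightarrow> AE x in M. f x = 0"
  using integral_nonneg_eq_0_iff_AE[of M "\<lambda>x. (cmod (f x))\<^sup>2"] by (simp add: L2_def)

lemma sqnorm_cong_AE: "AE x in M. f x = g x \<Longrightarrow> f \<in> borel_measurable M \<Longrightarrow> g \<in> borel_measurable M \<Longrightarrow> sqnorm M f = sqnorm M g"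
  by (rule integral_cong_AE) auto

lemma L2_limit_unique:
  assumes "f \<in> L2 M" "g \<in> L2 M" "\<And>n. h n \<in> L2 M" "F \<noteq> bot"
    and lim: "((\<lambda>n. sqnorm M (\<lambda>x. f x - h n x)) \<longlongrightarrow> 0) F" "((\<lambda>n. sqnorm M (\<lambda>x. g x - h n x)) \<longlongrightarrow> 0) F"
  shows "AE x in M. f x = g x"
proof -
  have "((\<lambda>n. 2 * sqnorm M (\<lambda>x. f x - h n x) + 2 * sqnorm M (\<lambda>x. g x - h n x)) \<longlongrightarrow> 2 * 0 + 2 * 0) F"
    by (intro tendsto_intros lim)
  moreover have "sqnorm M (\<lambda>x. f x - g x) \<le> 2 * sqnorm M (\<lambda>x. f x - h n x) + 2 * sqnorm M (\<lambda>x. g x - h n x)" for n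
    using sqnorm_triangle[OF assms(1,3,2), of n] by (simp add: sqnorm_minus[of M "h n"])
  ultimately have "sqnorm M (\<lambda>x. f x - g x) \<le> 0"
    using tendsto_lowerbound[OF _ _ \<open>F \<noteq> bot\<close>, of _ "2 * 0 + 2 * 0" "sqnorm M (\<lambda>x. f x - g x)"] by auto
  then have "sqnorm M (\<lambda>x. f x - g x) = 0" using sqnorm_nonneg by (intro antisym)
  from sqnorm_eq_0[OF L2_diff[OF assms(1,2)] this] show ?thesis by simp
qed

text \<open>
  The triangle inequality for norms in a form that is linear in the squared norms.
\<close>

lemma sqnorm_perturbation:
  assumes f: "f \<in> L2 M" and h: "h \<in> L2 M" and e: "e > 0"
  shows "\<bar>sqnorm M h - sqnorm M f\<bar> \<le> e * sqnorm M f + (1 + 1 / e) * sqnorm M (\<lambda>x. f x - h x)"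
proof -
  have pt: "\<bar>(cmod b)\<^sup>2 - (cmod a)\<^sup>2\<bar> \<le> e * (cmod a)\<^sup>2 + (1 + 1 / e) * (cmod (a - b))\<^sup>2" for a b
  proof -
    have le1: "cmod b \<le> cmod a + cmod (a - b)" and le2: "cmod a \<le> cmod b + cmod (a - b)"
      using norm_triangle_ineq2[of b a] norm_triangle_ineq2[of a b] by (simp_all add: norm_minus_commute)
    have sq: "(e * p - q)\<^sup>2 / e = e * p\<^sup>2 - 2 * p * q + q\<^sup>2 / e" for p q
      using e by (simp add: field_simps power2_eq_square)
    have "0 \<le> (e * cmod a - cmod (a - b))\<^sup>2 / e" using e by simp
    then have am: "2 * cmod a * cmod (a - b) \<le> e * (cmod a)\<^sup>2 + (cmod (a - b))\<^sup>2 / e"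
      unfolding sq by simp
    have "(cmod b)\<^sup>2 \<le> (cmod a + cmod (a - b))\<^sup>2" using le1 by (intro power_mono) auto
    then have 1: "(cmod b)\<^sup>2 - (cmod a)\<^sup>2 \<le> 2 * cmod a * cmod (a - b) + (cmod (a - b))\<^sup>2" by (simp add: power2_sum)
    have "(cmod a)\<^sup>2 - (cmod b)\<^sup>2 = (cmod a - cmod b) * (cmod a + cmod b)" by (simp add: power2_eq_square algebra_simps)
    also have "\<dots> \<le> cmod (a - b) * (cmod a + cmod b)" using le2 by (intro mult_right_mono) auto
    also have "\<dots> \<le> cmod (a - b) * (cmod a + (cmod a + cmod (a - b)))" using le1 by (intro mult_left_mono) auto
    finally have 2: "(cmod a)\<^sup>2 - (cmod b)\<^sup>2 \<le> 2 * cmod a * cmod (a - b) + (cmod (a - b))\<^sup>2"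
      by (simp add: algebra_simps power2_eq_square)
    show ?thesis using 1 2 am by (simp add: algebra_simps abs_le_iff)
  qed
  have i: "integrable M (\<lambda>x. e * (cmod (f x))\<^sup>2 + (1 + 1 / e) * (cmod (f x - h x))\<^sup>2)"
    using f L2_diff[OF f h] by (intro Bochner_Integration.integrable_add integrable_mult_right L2_integrable)
  have "\<bar>sqnorm M h - sqnorm M f\<bar> = \<bar>\<integral>x. (cmod (h x))\<^sup>2 - (cmod (f x))\<^sup>2 \<partial>M\<bar>"
    using f h by (simp add: L2_integrable)
  also have "\<dots> \<le> (\<integral>x. \<bar>(cmod (h x))\<^sup>2 - (cmod (f x))\<^sup>2\<bar> \<partial>M)" by (rule integral_abs_bound)
  also have "\<dots> \<le> (\<integral>x. e * (cmod (f x))\<^sup>2 + (1 + 1 / e) * (cmod (f x - h x))\<^sup>2 \<partial>M)"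
    using f h by (intro integral_mono i pt integrable_abs Bochner_Integration.integrable_diff L2_integrable)
  also have "\<dots> = e * sqnorm M f + (1 + 1 / e) * sqnorm M (\<lambda>x. f x - h x)"
    using L2_integrable[OF f] L2_integrable[OF L2_diff[OF f h]] by simp
  finally show ?thesis .
qed

lemma sqnorm_tendsto:
  assumes f: "f \<in> L2 M" and h: "\<And>n. h n \<in> L2 M"
    and lim: "((\<lambda>n. sqnorm M (\<lambda>x. f x - h n x)) \<longlongrightarrow> 0) F"
  shows "((\<lambda>n. sqnorm M (h n)) \<longlongrightarrow> sqnorm M f) F"
proof (rule tendstoI)
  fix r :: real assume r: "r > 0"
  define e where "e = r / (2 * (sqnorm M f + 1))"
  have s1: "sqnorm M f + 1 > 0" using sqnorm_nonneg[of M f] by linarith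
  have e: "e > 0" using r s1 by (simp add: e_def)
  have "e * sqnorm M f < e * (sqnorm M f + 1)" using e by simp
  also have "e * (sqnorm M f + 1) = r / 2"
  proof -
    have "r / (2 * q) * q = r / 2" if "q > 0" for q :: real using that by simp
    then show ?thesis unfolding e_def using s1 .
  qed
  finally have es: "e * sqnorm M f < r / 2" .
  have "((\<lambda>n. (1 + 1 / e) * sqnorm M (\<lambda>x. f x - h n x)) \<longlongrightarrow> (1 + 1 / e) * 0) F"
    by (intro tendsto_intros lim)
  then have "\<forall>\<^sub>F n in F. (1 + 1 / e) * sqnorm M (\<lambda>x. f x - h n x) < r / 2"
    by (rule order_tendstoD(2)) (use r in simp)
  then show "\<forall>\<^sub>F n in F. dist (sqnorm M (h n)) (sqnorm M f) < r"
  proof eventually_elim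
    case (elim n)
    have "dist (sqnorm M (h n)) (sqnorm M f) = \<bar>sqnorm M (h n) - sqnorm M f\<bar>" by (rule dist_real_def)
    also have "\<dots> \<le> e * sqnorm M f + (1 + 1 / e) * sqnorm M (\<lambda>x. f x - h n x)"
      by (rule sqnorm_perturbation[OF f h e])
    also have "\<dots> < r" using elim es by linarith
    finally show ?case .
  qed
qed

lemma nn_integral_sqnorm: "f \<in> L2 M \<Longrightarrow> (\<integral>\<^sup>+x. ennreal ((cmod (f x))\<^sup>2) \<partial>M) = ennreal (sqnorm M f)"
  by (intro nn_integral_eq_integral) (auto simp: L2_def)

lemma AE_summable_of_nn_integral:
  fixes u :: "nat \<Rightarrow> 'a \<Rightarrow> real"
  assumes [measurable]: "\<And>j. u j \<in> borel_measurable M" and nn: "\<And>j x. u j x \<ge> 0"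
    and b: "\<And>j. (\<integral>\<^sup>+x. ennreal (u j x) \<partial>M) \<le> ennreal (c j)" and c: "\<And>j. c j \<ge> 0" "summable c"
  shows "AE x in M. summable (\<lambda>j. u j x)"
proof -
  have "(\<integral>\<^sup>+x. (\<Sum>j. ennreal (u j x)) \<partial>M) = (\<Sum>j. \<integral>\<^sup>+x. ennreal (u j x) \<partial>M)"
    by (rule nn_integral_suminf) simp
  also have "\<dots> \<le> (\<Sum>j. ennreal (c j))" using b by (intro suminf_le) auto
  also have "\<dots> = ennreal (suminf c)" using c by (intro suminf_ennreal2) auto
  finally have "(\<integral>\<^sup>+x. (\<Sum>j. ennreal (u j x)) \<partial>M) \<noteq> \<infinity>" by (auto simp: top_unique)
  then have "AE x in M. (\<Sum>j. ennreal (u j x)) \<noteq> \<infinity>"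
    by (intro nn_integral_noteq_infinite) auto
  then show ?thesis
    by eventually_elim (use nn in \<open>auto intro: summable_suminf_not_top\<close>)
qed

lemma summable_quarter: "summable (\<lambda>j. C * (1 / 4 :: real) ^ j)"
  by (intro summable_mult summable_geometric) simp

text \<open>
  Squared distances with a geometric bound are summable almost everywhere, so the whole sequence converges
  there.
\<close>

lemma AE_tendsto_of_sqnorm:
  assumes f: "f \<in> L2 M" and h: "\<And>j. h j \<in> L2 M"
    and b: "\<And>j. sqnorm M (\<lambda>x. f x - h j x) \<le> C * (1 / 4) ^ j"
  shows "AE x in M. (\<lambda>j. h j x) \<longlonglongrightarrow> f x"
proof -
  have [measurable]: "f \<in> borel_measurable M" "\<And>j. h j \<in> borel_measurable M"
    using f h by (auto simp: L2_def)
  have C: "0 \<le> C" using order_trans[OF sqnorm_nonneg b[of 0]] by simp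
  have "AE x in M. summable (\<lambda>j. (cmod (f x - h j x))\<^sup>2)"
  proof (rule AE_summable_of_nn_integral[where c="\<lambda>j. C * (1 / 4) ^ j"])
    show "(\<integral>\<^sup>+x. ennreal ((cmod (f x - h j x))\<^sup>2) \<partial>M) \<le> ennreal (C * (1 / 4) ^ j)" for j
      unfolding nn_integral_sqnorm[OF L2_diff[OF f h]] by (intro ennreal_leI b)
  qed (use C summable_quarter in auto)
  then show ?thesis
  proof eventually_elim
    case (elim x)
    then have "(\<lambda>j. (cmod (f x - h j x))\<^sup>2) \<longlonglongrightarrow> 0" by (rule summable_LIMSEQ_zero)
    then have "(\<lambda>j. sqrt ((cmod (f x - h j x))\<^sup>2)) \<longlonglongrightarrow> sqrt 0" by (rule tendsto_real_sqrt)
    then have "(\<lambda>j. cmod (h j x - f x)) \<longlonglongrightarrow> 0" by (simp add: norm_minus_commute)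
    then show ?case using Lim_null tendsto_norm_zero_iff by blast
  qed
qed

text \<open>
  The Riesz-Fischer theorem, with a prescribed modulus of convergence \<open>\<tau>\<close> that the limit inherits.
\<close>

lemma L2_complete:
  assumes h: "\<And>n. h n \<in> L2 M" and tau: "\<tau> \<longlonglongrightarrow> (0::real)"
    and cauchy: "\<And>n i j. n \<le> i \<Longrightarrow> n \<le> j \<Longrightarrow> sqnorm M (\<lambda>x. h i x - h j x) \<le> \<tau> n"
  shows "\<exists>f\<in>L2 M. \<forall>n. sqnorm M (\<lambda>x. f x - h n x) \<le> \<tau> n"
proof -
  have [measurable]: "h n \<in> borel_measurable M" for n using h by (auto simp: L2_def)
  have tau0: "\<tau> n \<ge> 0" for n using cauchy[of n n n] by simp
  have "\<exists>n. \<forall>m\<ge>n. \<tau> m \<le> (1 / 4) ^ j" for j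
    using order_tendstoD(2)[OF tau, of "(1 / 4) ^ j"] by (auto simp: eventually_sequentially intro: less_imp_le)
  then obtain s where s: "\<And>j m. s j \<le> m \<Longrightarrow> \<tau> m \<le> (1 / 4) ^ j" by metis
  define r where "r j = j + (\<Sum>i\<le>j. s i)" for j
  have r_ge: "j \<le> r j" "s j \<le> r j" for j
    using member_le_sum[of j "{..j}" s] by (auto simp: r_def)
  have r_mono: "r j \<le> r (Suc j)" for j by (simp add: r_def)
  define d where "d j x = h (r (Suc j)) x - h (r j) x" for j x
  have d: "sqnorm M (d j) \<le> (1 / 4) ^ j" for j
    unfolding d_def using cauchy[OF r_mono order_refl] s[OF r_ge(2)] order_trans by blast
  have dL: "d j \<in> L2 M" for j unfolding d_def by (rule L2_diff[OF h h])
  have [measurable]: "d j \<in> borel_measurable M" for j using dL by (auto simp: L2_def)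
  \<comment> \<open>The weights make the integrals of the sums converge and still dominate: |d| is at most 1/2^j + 2^j |d|^2.\<close>
  have "AE x in M. summable (\<lambda>j. 2 ^ j * (cmod (d j x))\<^sup>2)"
  proof (rule AE_summable_of_nn_integral[where c="\<lambda>j. (1 / 2) ^ j"])
    fix j
    have "(\<integral>\<^sup>+x. ennreal (2 ^ j * (cmod (d j x))\<^sup>2) \<partial>M) = ennreal (2 ^ j) * ennreal (sqnorm M (d j))"
      by (simp add: ennreal_mult nn_integral_cmult nn_integral_sqnorm[OF dL])
    also have "\<dots> = ennreal (2 ^ j * sqnorm M (d j))" by (simp add: ennreal_mult)
    also have "\<dots> \<le> ennreal (2 ^ j * (1 / 4) ^ j)" by (intro ennreal_leI mult_left_mono d) simp
    also have "2 ^ j * (1 / 4 :: real) ^ j = (1 / 2) ^ j" by (simp flip: power_mult_distrib)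
    finally show "(\<integral>\<^sup>+x. ennreal (2 ^ j * (cmod (d j x))\<^sup>2) \<partial>M) \<le> ennreal ((1 / 2) ^ j)" .
  qed auto
  then have conv: "AE x in M. convergent (\<lambda>j. h (r j) x)"
  proof eventually_elim
    case (elim x)
    have "summable (\<lambda>j. (1 / 2) ^ j + 2 ^ j * (cmod (d j x))\<^sup>2)"
      by (intro summable_add elim summable_geometric) simp
    moreover have "norm (d j x) \<le> (1 / 2) ^ j + 2 ^ j * (cmod (d j x))\<^sup>2" for j
    proof (cases "cmod (d j x) \<le> (1 / 2) ^ j")
      case False
      then have "2 ^ j * cmod (d j x) \<ge> 1" by (simp add: field_simps)
      then have "cmod (d j x) \<le> 2 ^ j * cmod (d j x) * cmod (d j x)"
        using mult_right_mono[of 1 "2 ^ j * cmod (d j x)" "cmod (d j x)"] by simp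
      then show ?thesis by (simp add: power2_eq_square mult.assoc add_increasing)
    qed (simp add: add_increasing2)
    ultimately have "summable (\<lambda>j. d j x)" by (rule summable_comparison_test'[of _ 0])
    then have "convergent (\<lambda>n. h (r 0) x + (\<Sum>j<n. d j x))"
      by (intro convergent_add convergent_const) (simp add: summable_iff_convergent)
    moreover have "h (r 0) x + (\<Sum>j<n. d j x) = h (r n) x" for n
      using sum_lessThan_telescope[of "\<lambda>j. h (r j) x" n] by (simp add: d_def)
    ultimately show ?case by simp
  qed
  define f where "f x = lim (\<lambda>j. h (r j) x)" for x
  have [measurable]: "f \<in> borel_measurable M" unfolding f_def by (rule borel_measurable_lim_metric) simp
  have b: "(\<integral>\<^sup>+x. ennreal ((cmod (f x - h n x))\<^sup>2) \<partial>M) \<le> ennreal (\<tau> n)" for n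
  proof -
    have "(\<integral>\<^sup>+x. ennreal ((cmod (f x - h n x))\<^sup>2) \<partial>M)
        = (\<integral>\<^sup>+x. liminf (\<lambda>j. ennreal ((cmod (h (r j) x - h n x))\<^sup>2)) \<partial>M)"
    proof (rule nn_integral_cong_AE, use conv in eventually_elim)
      case (elim x)
      then have "(\<lambda>j. h (r j) x) \<longlonglongrightarrow> f x" by (simp add: f_def convergent_LIMSEQ_iff)
      then have "(\<lambda>j. ennreal ((cmod (h (r j) x - h n x))\<^sup>2)) \<longlonglongrightarrow> ennreal ((cmod (f x - h n x))\<^sup>2)"
        by (intro tendsto_intros)
      from lim_imp_Liminf[OF _ this] show ?case by simp
    qed
    also have "\<dots> \<le> liminf (\<lambda>j. \<integral>\<^sup>+x. ennreal ((cmod (h (r j) x - h n x))\<^sup>2) \<partial>M)"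
      by (rule nn_integral_liminf) simp
    also have "\<dots> \<le> liminf (\<lambda>j. ennreal (\<tau> n))"
    proof (rule Liminf_mono)
      show "\<forall>\<^sub>F j in sequentially. (\<integral>\<^sup>+x. ennreal ((cmod (h (r j) x - h n x))\<^sup>2) \<partial>M) \<le> ennreal (\<tau> n)"
        using eventually_ge_at_top[of n]
      proof eventually_elim
        case (elim j)
        then have "n \<le> r j" using r_ge(1)[of j] by simp
        then show ?case unfolding nn_integral_sqnorm[OF L2_diff[OF h h]] by (intro ennreal_leI cauchy) auto
      qed
    qed
    also have "\<dots> = ennreal (\<tau> n)" by (simp add: Liminf_const)
    finally show ?thesis .
  qed
  have L: "(\<lambda>x. f x - h n x) \<in> L2 M" for n
  proof -
    have "integrable M (\<lambda>x. (cmod (f x - h n x))\<^sup>2)"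
      by (rule integrableI_bounded) (use b[of n] in \<open>auto simp: top_unique less_top[symmetric] intro: le_less_trans\<close>)
    then show ?thesis by (simp add: L2_def)
  qed
  have "f \<in> L2 M" using L2_lincomb[OF L[of 0] h[of 0], of 1 1] by simp
  moreover have "sqnorm M (\<lambda>x. f x - h n x) \<le> \<tau> n" for n
    using b[of n] tau0[of n] unfolding nn_integral_sqnorm[OF L] by simp
  ultimately show ?thesis by blast
qed

section \<open>Hermite sums\<close>

lemma borel_measurable_Herm [measurable]: "Herm m \<in> borel_measurable borel"
  unfolding Herm_def by measurable

lemma mi_fact_pos: "mi_fact m > 0"
  unfolding mi_fact_def by (intro prod_pos) auto

lemma mi_fact_neq_0 [simp]: "mi_fact m \<noteq> 0"
  using mi_fact_pos[of m] by simp

lemma Herm_scaled: "Herm m (c *\<^sub>R x) = (\<Prod>i\<in>UNIV. poly (pcompose (He (m $ i)) [:0, c:]) (x $ i))"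
  by (simp add: Herm_def hermite_eq_He poly_pcompose mult.commute)

lemma integrable_Herm_scaled: "integrable gauss (\<lambda>x :: real ^ 'd. Herm m (c *\<^sub>R x) * Herm n (c *\<^sub>R x))"
  unfolding Herm_scaled prod.distrib[symmetric] poly_mult[symmetric]
  by (rule integral_gauss_prod(1)[OF integrable_poly_gauss])

lemma integral_Herm: "(\<integral>x. Herm m x * Herm n x \<partial>gauss) = (if m = n then mi_fact m else 0)"
proof -
  have "(\<integral>x. Herm m x * Herm n x \<partial>gauss) = (\<Prod>i\<in>UNIV. gint (He (m $ i) * He (n $ i)))"
    unfolding Herm_def hermite_eq_He prod.distrib[symmetric] poly_mult[symmetric]
    by (simp only: integral_gauss_prod(2)[OF integrable_poly_gauss] gint_def)
  also have "\<dots> = (if m = n then mi_fact m else 0)"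
    unfolding gint_He_He mi_fact_def by (auto simp: vec_eq_iff)
  finally show ?thesis .
qed

text \<open>
  Partial sums of Hermite expansions, evaluated at dilated points; \<open>hnorm2\<close> is the squared norm for
  dilation factor \<open>1\<close>.
\<close>

definition hsum :: "(nat ^ 'd) set \<Rightarrow> (nat ^ 'd \<Rightarrow> complex) \<Rightarrow> real \<Rightarrow> real ^ 'd \<Rightarrow> complex" where
  "hsum A b c x = (\<Sum>m\<in>A. b m * of_real (Herm m (c *\<^sub>R x)))"

lemma Herm_L2: "(\<lambda>x. of_real (Herm m (c *\<^sub>R x))) \<in> L2 gauss"
  using integrable_Herm_scaled[of m c m] by (simp add: L2_def power2_eq_square abs_mult_self_eq)

lemma hsum_L2: "hsum A b c \<in> L2 gauss"
  unfolding hsum_def using L2_sum[of A "\<lambda>m x. b m * of_real (Herm m (c *\<^sub>R x))" gauss] L2_scale[OF Herm_L2] by blast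

lemma hsum_measurable [measurable]: "hsum A b c \<in> borel_measurable borel"
  using L2_measurable[OF hsum_L2] by simp

definition hnorm2 :: "(nat ^ 'd) set \<Rightarrow> (nat ^ 'd \<Rightarrow> complex) \<Rightarrow> real" where
  "hnorm2 A b = (\<Sum>m\<in>A. (cmod (b m))\<^sup>2 * mi_fact m)"

lemma sqnorm_hsum:
  assumes "finite A"
  shows "sqnorm gauss (hsum A b 1) = hnorm2 A b"
proof -
  have "complex_of_real (sqnorm gauss (hsum A b 1)) = (\<integral>x. of_real ((cmod (hsum A b 1 x))\<^sup>2) \<partial>gauss)"
    by (rule integral_complex_of_real[symmetric])
  also have "\<dots> = (\<integral>x. (\<Sum>m\<in>A. \<Sum>n\<in>A. b m * cnj (b n) * of_real (Herm m x * Herm n x)) \<partial>gauss)"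
    by (intro Bochner_Integration.integral_cong refl)
       (simp only: complex_norm_square hsum_def cnj_sum sum_product complex_cnj_mult complex_cnj_complex_of_real of_real_mult scaleR_one mult_ac)
  also have "\<dots> = (\<Sum>m\<in>A. \<Sum>n\<in>A. b m * cnj (b n) * of_real (\<integral>x. Herm m x * Herm n x \<partial>gauss))"
  proof -
    have i: "integrable gauss (\<lambda>x. b m * cnj (b n) * complex_of_real (Herm m x * Herm n x))" for m n
      using integrable_Herm_scaled[of m 1 n] by (intro integrable_mult_right integrable_of_real) simp
    show ?thesis
      by (simp only: Bochner_Integration.integral_sum[OF Bochner_Integration.integrable_sum[OF i]]
          Bochner_Integration.integral_sum[OF i] integral_mult_right_zero integral_complex_of_real)
  qed
  also have "\<dots> = of_real (hnorm2 A b)"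
    unfolding integral_Herm hnorm2_def of_real_sum
  proof (intro sum.cong refl)
    fix m assume "m \<in> A"
    have "(\<Sum>n\<in>A. b m * cnj (b n) * of_real (if m = n then mi_fact m else 0))
        = (\<Sum>n\<in>A. if m = n then b m * cnj (b m) * of_real (mi_fact m) else 0)"
      by (intro sum.cong) auto
    then show "(\<Sum>n\<in>A. b m * cnj (b n) * of_real (if m = n then mi_fact m else 0)) = complex_of_real ((cmod (b m))\<^sup>2 * mi_fact m)"
      using \<open>m \<in> A\<close> assms by (simp add: complex_norm_square[symmetric] del: of_real_power)
  qed
  finally show ?thesis by (simp only: of_real_eq_iff)
qed

lemma hnorm2_nonneg: "hnorm2 A b \<ge> 0"
  unfolding hnorm2_def using mi_fact_pos by (intro sum_nonneg mult_nonneg_nonneg) (auto intro: less_imp_le)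

text \<open>
  A change of variables replaces the density at \<open>x\<close> by that at \<open>x / c\<close>, which is smaller.
\<close>

lemma nn_integral_gauss_dilate:
  fixes F :: "'a::euclidean_space \<Rightarrow> ennreal"
  assumes [measurable]: "F \<in> borel_measurable borel" and c: "0 < c" "c \<le> 1"
  shows "(\<integral>\<^sup>+x. F (c *\<^sub>R x) \<partial>gauss) \<le> ennreal ((1 / c) ^ DIM('a)) * (\<integral>\<^sup>+x. F x \<partial>gauss)"
proof -
  define D :: "'a \<Rightarrow> real" where "D x = (2 * pi) powr (- real DIM('a) / 2) * exp (- (norm x)\<^sup>2 / 2)" for x
  have D: "gauss = density lborel (\<lambda>x. ennreal (D x))" by (simp add: gauss_def D_def)
  have [measurable]: "D \<in> borel_measurable borel" unfolding D_def by measurable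
  have le: "D ((1 / c) *\<^sub>R y) \<le> D y" for y
  proof -
    have "norm y \<le> norm ((1 / c) *\<^sub>R y)"
      using c mult_right_mono[of 1 "1 / c" "norm y"] by simp
    then have "(norm y)\<^sup>2 \<le> (norm ((1 / c) *\<^sub>R y))\<^sup>2" by (intro power_mono) auto
    then show ?thesis unfolding D_def by (intro mult_left_mono) auto
  qed
  have "(\<integral>\<^sup>+x. F (c *\<^sub>R x) \<partial>gauss) = (\<integral>\<^sup>+x. ennreal (D x) * F (c *\<^sub>R x) \<partial>lborel)"
    unfolding D by (subst nn_integral_density) auto
  also have "\<dots> = (\<integral>\<^sup>+x. ennreal (\<bar>1 / c\<bar> ^ DIM('a)) * (ennreal (D ((1 / c) *\<^sub>R x)) * F x) \<partial>lborel)"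
    using c by (subst lborel_affine[of "1 / c" 0]) (simp_all add: nn_integral_density nn_integral_distr)
  also have "\<dots> \<le> (\<integral>\<^sup>+x. ennreal ((1 / c) ^ DIM('a)) * (ennreal (D x) * F x) \<partial>lborel)"
    using c le by (intro nn_integral_mono mult_mono ennreal_leI) auto
  also have "\<dots> = ennreal ((1 / c) ^ DIM('a)) * (\<integral>\<^sup>+x. F x \<partial>gauss)"
    unfolding D by (simp add: nn_integral_cmult nn_integral_density)
  finally show ?thesis .
qed

lemma sqnorm_hsum_dilated:
  fixes b :: "nat ^ 'd \<Rightarrow> complex"
  assumes A: "finite A" and c: "0 < c" "c \<le> 1"
  shows "sqnorm gauss (hsum A b c) \<le> (1 / c) ^ CARD('d) * hnorm2 A b"
proof -
  have "ennreal (sqnorm gauss (hsum A b c)) = (\<integral>\<^sup>+x. ennreal ((cmod (hsum A b 1 (c *\<^sub>R x)))\<^sup>2) \<partial>gauss)"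
    unfolding nn_integral_sqnorm[OF hsum_L2, symmetric] by (simp add: hsum_def)
  also have "\<dots> \<le> ennreal ((1 / c) ^ DIM(real ^ 'd)) * (\<integral>\<^sup>+x. ennreal ((cmod (hsum A b 1 x))\<^sup>2) \<partial>gauss)"
    by (rule nn_integral_gauss_dilate) (use c in auto)
  also have "\<dots> = ennreal ((1 / c) ^ CARD('d) * hnorm2 A b)"
    using c unfolding nn_integral_sqnorm[OF hsum_L2] sqnorm_hsum[OF A] by (simp add: ennreal_mult hnorm2_nonneg)
  finally show ?thesis
    using c hnorm2_nonneg[of A b] by (subst (asm) ennreal_le_iff) auto
qed

lemma integrable_L2_mult:
  assumes f: "f \<in> L2 M" and g: "g \<in> L2 M"
  shows "integrable M (\<lambda>x. f x * g x)"
proof (rule Bochner_Integration.integrable_bound)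
  show "integrable M (\<lambda>x. (cmod (f x))\<^sup>2 + (cmod (g x))\<^sup>2)"
    using f g by (intro Bochner_Integration.integrable_add L2_integrable)
  show "(\<lambda>x. f x * g x) \<in> borel_measurable M"
    using f g by (intro borel_measurable_times L2_measurable)
  have "cmod (f x) * cmod (g x) \<le> (cmod (f x))\<^sup>2 + (cmod (g x))\<^sup>2" for x
  proof -
    have "2 * (cmod (f x) * cmod (g x)) \<le> (cmod (f x))\<^sup>2 + (cmod (g x))\<^sup>2"
      using sum_squares_bound[of "cmod (f x)" "cmod (g x)"] by (simp add: mult_ac)
    moreover have "0 \<le> cmod (f x) * cmod (g x)" by simp
    ultimately show ?thesis by linarith
  qed
  then show "AE x in M. norm (f x * g x) \<le> norm ((cmod (f x))\<^sup>2 + (cmod (g x))\<^sup>2)"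
    by (simp add: norm_mult)
qed

definition hcoeff :: "(real ^ 'd \<Rightarrow> complex) \<Rightarrow> nat ^ 'd \<Rightarrow> complex" where
  "hcoeff f m = (\<integral>x. f x * of_real (Herm m x) \<partial>gauss) / of_real (mi_fact m)"

lemma integrable_L2_Herm: "f \<in> L2 gauss \<Longrightarrow> integrable gauss (\<lambda>x. f x * of_real (Herm m x))"
  using integrable_L2_mult[OF _ Herm_L2[of m 1]] by simp

lemma hcoeff_lincomb:
  assumes "f \<in> L2 gauss" "g \<in> L2 gauss"
  shows "hcoeff (\<lambda>x. a * f x + b * g x) m = a * hcoeff f m + b * hcoeff g m"
  using integrable_L2_Herm[OF assms(1), of m] integrable_L2_Herm[OF assms(2), of m]
  by (simp add: hcoeff_def distrib_right mult.assoc add_divide_distrib)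

lemma hcoeff_Herm: "hcoeff (\<lambda>x. of_real (Herm n x)) m = (if m = n then 1 else 0)"
proof -
  have "(\<integral>x. complex_of_real (Herm n x) * of_real (Herm m x) \<partial>gauss) = of_real (\<integral>x. Herm n x * Herm m x \<partial>gauss)"
    by (simp only: of_real_mult[symmetric] integral_complex_of_real)
  then show ?thesis by (simp add: hcoeff_def integral_Herm)
qed

text \<open>
  Expand the squared distance of \<open>f\<close> to its Hermite sum.
\<close>

lemma Bessel:
  assumes f: "f \<in> L2 gauss" and A: "finite A"
  shows "hnorm2 A (hcoeff f) \<le> sqnorm gauss f"
proof -
  let ?g = "hsum A (hcoeff f) 1"
  have ii: "integrable gauss (\<lambda>x. of_real ((cmod (f x))\<^sup>2) :: complex)"
    "integrable gauss (\<lambda>x. of_real ((cmod (?g x))\<^sup>2) :: complex)"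
    using L2_integrable[OF f] L2_integrable[OF hsum_L2] by (intro integrable_of_real; simp)+
  have "cnj \<in> borel_measurable borel"
    by (intro borel_measurable_continuous_onI continuous_intros)
  from measurable_compose[OF hsum_measurable this]
  have cg: "(\<lambda>x. cnj (?g x)) \<in> L2 gauss"
    using hsum_L2[of A "hcoeff f" 1] by (simp add: L2_def)
  have i1: "integrable gauss (\<lambda>x. f x * cnj (?g x))" by (rule integrable_L2_mult[OF f cg])
  then have i2: "integrable gauss (\<lambda>x. cnj (f x * cnj (?g x)))" by (rule integrable_cnj)
  have cross: "(\<integral>x. f x * cnj (?g x) \<partial>gauss) = of_real (hnorm2 A (hcoeff f))"
  proof -
    have "(\<integral>x. f x * cnj (?g x) \<partial>gauss) = (\<integral>x. (\<Sum>m\<in>A. cnj (hcoeff f m) * (f x * of_real (Herm m x))) \<partial>gauss)"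
      by (simp add: hsum_def sum_distrib_left mult_ac)
    also have "\<dots> = (\<Sum>m\<in>A. cnj (hcoeff f m) * (\<integral>x. f x * of_real (Herm m x) \<partial>gauss))"
      using integrable_L2_Herm[OF f] by (subst Bochner_Integration.integral_sum) auto
    also have "\<dots> = (\<Sum>m\<in>A. of_real ((cmod (hcoeff f m))\<^sup>2 * mi_fact m))"
    proof (intro sum.cong refl)
      fix m
      have "(\<integral>x. f x * of_real (Herm m x) \<partial>gauss) = hcoeff f m * of_real (mi_fact m)"
        using mi_fact_pos[of m] by (simp add: hcoeff_def)
      then show "cnj (hcoeff f m) * (\<integral>x. f x * of_real (Herm m x) \<partial>gauss) = of_real ((cmod (hcoeff f m))\<^sup>2 * mi_fact m)"
        by (simp only: of_real_mult complex_norm_square mult_ac)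
    qed
    finally show ?thesis by (simp add: hnorm2_def)
  qed
  have "complex_of_real (sqnorm gauss (\<lambda>x. f x - ?g x)) = (\<integral>x. of_real ((cmod (f x - ?g x))\<^sup>2) \<partial>gauss)"
    by (rule integral_complex_of_real[symmetric])
  also have "\<dots> = (\<integral>x. of_real ((cmod (f x))\<^sup>2) - (f x * cnj (?g x) + cnj (f x * cnj (?g x))) + of_real ((cmod (?g x))\<^sup>2) \<partial>gauss)"
    by (intro Bochner_Integration.integral_cong refl) (simp only: complex_norm_square complex_cnj_diff complex_cnj_mult complex_cnj_cnj, simp add: algebra_simps)
  also have "\<dots> = of_real (sqnorm gauss f) - (of_real (hnorm2 A (hcoeff f)) + cnj (of_real (hnorm2 A (hcoeff f)))) + of_real (sqnorm gauss ?g)"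
    using i1 i2 ii by (simp only: Bochner_Integration.integral_add Bochner_Integration.integral_diff
      Bochner_Integration.integrable_add Bochner_Integration.integrable_diff Bochner_Integration.integral_cnj cross integral_complex_of_real)
  also have "\<dots> = of_real (sqnorm gauss f - hnorm2 A (hcoeff f))"
    by (simp add: sqnorm_hsum[OF A])
  finally have "sqnorm gauss (\<lambda>x. f x - ?g x) = sqnorm gauss f - hnorm2 A (hcoeff f)"
    by (simp only: of_real_eq_iff)
  then show ?thesis using sqnorm_nonneg[of gauss "\<lambda>x. f x - ?g x"] by linarith
qed

definition trunc :: "nat \<Rightarrow> (nat ^ 'd) set" where
  "trunc N = {m. mi_abs m \<le> N}"

lemma finite_trunc: "finite (trunc N :: (nat ^ 'd) set)"
proof -
  have "finite {n :: 'd \<Rightarrow> nat. sum n UNIV = s}" for s by (rule finite_row_level)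
  then have "finite (\<Union>s\<le>N. {n :: 'd \<Rightarrow> nat. sum n UNIV = s})" by auto
  then have "finite (($) ` (trunc N :: (nat ^ 'd) set))"
    by (rule rev_finite_subset) (auto simp: trunc_def mi_abs_def)
  then show ?thesis by (rule finite_imageD) (simp add: inj_on_def vec_nth_inject)
qed

lemma trunc_mono: "N \<le> N' \<Longrightarrow> trunc N \<subseteq> trunc N'"
  by (auto simp: trunc_def)

lemma filterlim_trunc: "filterlim trunc (finite_subsets_at_top UNIV) sequentially"
  unfolding filterlim_finite_subsets_at_top
proof (intro allI impI)
  fix X :: "(nat ^ 'd) set" assume X: "finite X \<and> X \<subseteq> UNIV"
  have "X \<subseteq> trunc N" if "N \<ge> (\<Sum>m\<in>X. mi_abs m)" for N
    using X that member_le_sum[of _ X mi_abs] by (fastforce simp: trunc_def intro: order_trans)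
  then show "\<forall>\<^sub>F N in sequentially. finite (trunc N :: (nat ^ 'd) set) \<and> X \<subseteq> trunc N \<and> trunc N \<subseteq> UNIV"
    unfolding eventually_sequentially using finite_trunc by auto
qed

section \<open>Existence and approximation of the evolution operators\<close>

lemma hnorm2_le_infsum:
  fixes b :: "nat ^ 'd \<Rightarrow> complex"
  assumes "(\<lambda>m. (cmod (b m))\<^sup>2 * mi_fact m) summable_on UNIV" "finite A"
  shows "hnorm2 A b \<le> (\<Sum>\<^sub>\<infinity>m. (cmod (b m))\<^sup>2 * mi_fact m)"
  unfolding hnorm2_def using assms
  by (intro finite_sum_le_infsum) (auto intro!: mult_nonneg_nonneg less_imp_le[OF mi_fact_pos])

lemma hnorm2_trunc_tendsto:
  fixes b :: "nat ^ 'd \<Rightarrow> complex"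
  assumes "(\<lambda>m. (cmod (b m))\<^sup>2 * mi_fact m) summable_on UNIV"
  shows "(\<lambda>N. hnorm2 (trunc N) b) \<longlonglongrightarrow> (\<Sum>\<^sub>\<infinity>m. (cmod (b m))\<^sup>2 * mi_fact m)"
  using filterlim_compose[OF infsum_tendsto[OF assms] filterlim_trunc] by (simp add: hnorm2_def)

lemma hsum_diff: "A \<subseteq> B \<Longrightarrow> finite B \<Longrightarrow> hsum B b c x - hsum A b c x = hsum (B - A) b c x"
  by (simp add: hsum_def sum_diff)

lemma hnorm2_diff: "A \<subseteq> B \<Longrightarrow> finite B \<Longrightarrow> hnorm2 (B - A) b = hnorm2 B b - hnorm2 A b"
  by (simp add: hnorm2_def sum_diff)

text \<open>
  Pointwise convergence of a Hermite series may fail, so its sum is a square integrable function that is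
  unique only almost everywhere. The partial sums are taken over the finite sets \<open>trunc n\<close>.
\<close>

definition is_series_limit :: "real \<Rightarrow> (nat ^ 'd \<Rightarrow> complex) \<Rightarrow> (real ^ 'd \<Rightarrow> complex) \<Rightarrow> bool" where
  "is_series_limit c b h \<longleftrightarrow> h \<in> L2 gauss \<and> (\<lambda>n. sqnorm gauss (\<lambda>x. h x - hsum (trunc n) b c x)) \<longlonglongrightarrow> 0"

lemma series_limit_exists:
  fixes b :: "nat ^ 'd \<Rightarrow> complex"
  assumes s: "(\<lambda>m. (cmod (b m))\<^sup>2 * mi_fact m) summable_on UNIV" and c: "0 < c" "c \<le> 1"
  shows "\<exists>h. is_series_limit c b h"
proof -
  define \<tau> where "\<tau> n = (1 / c) ^ CARD('d) * ((\<Sum>\<^sub>\<infinity>m. (cmod (b m))\<^sup>2 * mi_fact m) - hnorm2 (trunc n) b)" for n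
  have "\<tau> \<longlonglongrightarrow> (1 / c) ^ CARD('d) * ((\<Sum>\<^sub>\<infinity>m. (cmod (b m))\<^sup>2 * mi_fact m) - (\<Sum>\<^sub>\<infinity>m. (cmod (b m))\<^sup>2 * mi_fact m))"
    unfolding \<tau>_def by (intro tendsto_intros hnorm2_trunc_tendsto s)
  then have tau: "\<tau> \<longlonglongrightarrow> 0" by simp
  have le: "sqnorm gauss (\<lambda>x. hsum (trunc i) b c x - hsum (trunc j) b c x) \<le> \<tau> n" if "n \<le> j" "j \<le> i" for n i j
  proof -
    have "hnorm2 (trunc n) b \<le> hnorm2 (trunc j) b"
      using hnorm2_diff[OF trunc_mono[OF that(1)] finite_trunc, of b] hnorm2_nonneg[of "trunc j - trunc n" b] by linarith
    have "sqnorm gauss (\<lambda>x. hsum (trunc i) b c x - hsum (trunc j) b c x) \<le> (1 / c) ^ CARD('d) * hnorm2 (trunc i - trunc j) b"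
      unfolding hsum_diff[OF trunc_mono[OF that(2)] finite_trunc] using c
      by (intro sqnorm_hsum_dilated) (auto simp: finite_trunc)
    also have "\<dots> \<le> \<tau> n"
      unfolding \<tau>_def hnorm2_diff[OF trunc_mono[OF that(2)] finite_trunc]
      using hnorm2_le_infsum[OF s finite_trunc, of i] \<open>hnorm2 (trunc n) b \<le> hnorm2 (trunc j) b\<close> c
      by (intro mult_left_mono) auto
    finally show ?thesis .
  qed
  have "\<exists>h\<in>L2 gauss. \<forall>n. sqnorm gauss (\<lambda>x. h x - hsum (trunc n) b c x) \<le> \<tau> n"
  proof (rule L2_complete[OF hsum_L2 tau])
    fix n i j :: nat assume "n \<le> i" "n \<le> j"
    then show "sqnorm gauss (\<lambda>x. hsum (trunc i) b c x - hsum (trunc j) b c x) \<le> \<tau> n"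
      using le[of n j i] le[of n i j] sqnorm_minus[of gauss "hsum (trunc i) b c" "hsum (trunc j) b c"]
      by (cases "j \<le> i") auto
  qed
  then obtain h where h: "h \<in> L2 gauss" "\<And>n. sqnorm gauss (\<lambda>x. h x - hsum (trunc n) b c x) \<le> \<tau> n" by blast
  have "(\<lambda>n. sqnorm gauss (\<lambda>x. h x - hsum (trunc n) b c x)) \<longlonglongrightarrow> 0"
    by (rule tendsto_sandwich[OF _ _ tendsto_const tau]) (use h(2) in auto)
  then show ?thesis using h(1) by (auto simp: is_series_limit_def)
qed

lemma series_limit_unique:
  assumes "is_series_limit c b h" "is_series_limit c b h'"
  shows "AE x in gauss. h x = h' x"
  using assms unfolding is_series_limit_def
  by (intro L2_limit_unique[where F = sequentially, OF _ _ hsum_L2]) auto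

definition phase :: "real \<Rightarrow> nat ^ 'd \<Rightarrow> complex" where
  "phase t m = exp (2 * of_real pi * of_nat (mi_abs m) * \<i> * of_real t)"

lemma norm_phase [simp]: "cmod (phase t m) = 1"
proof -
  have "2 * of_real pi * of_nat (mi_abs m) * \<i> * of_real t = \<i> * complex_of_real (2 * pi * mi_abs m * t)"
    by simp
  then show ?thesis unfolding phase_def by (simp only: norm_exp_i_times)
qed

lemma hcoeff_summable:
  assumes "f \<in> L2 gauss"
  shows "(\<lambda>m. (cmod (hcoeff f m))\<^sup>2 * mi_fact m) summable_on UNIV"
proof (rule nonneg_bdd_above_summable_on)
  show "bdd_above (sum (\<lambda>m. (cmod (hcoeff f m))\<^sup>2 * mi_fact m) ` {F. F \<subseteq> UNIV \<and> finite F})"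
    using Bessel[OF assms] by (intro bdd_aboveI2[where M = "sqnorm gauss f"]) (auto simp: hnorm2_def)
qed (auto intro!: mult_nonneg_nonneg less_imp_le[OF mi_fact_pos])

lemma lam_bounds: "k \<ge> 1 \<Longrightarrow> 0 < lam k" "k \<ge> 1 \<Longrightarrow> lam k \<le> 1"
  by (auto simp: lam_def)

definition Hop_spec :: "nat \<Rightarrow> real \<Rightarrow> ((real ^ 'd \<Rightarrow> complex) \<Rightarrow> real ^ 'd \<Rightarrow> complex) \<Rightarrow> bool" where
  "Hop_spec k t T \<longleftrightarrow> bounded_L2_operator gauss T \<and>
     (\<forall>m. AE x in gauss. T (\<lambda>y. of_real (Herm m y)) x = phase t m * of_real (Herm m (lam k *\<^sub>R x)))"

text \<open>
  Send \<open>f\<close> to the limit of its Hermite series with phases inserted, evaluated at dilated points. Bounding the partial sums uniformly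
  bounds the limit, and limits being unique almost everywhere gives linearity.
\<close>

lemma Hop_exists:
  assumes k: "k \<ge> 1"
  shows "\<exists>T :: (real ^ 'd \<Rightarrow> complex) \<Rightarrow> _. Hop_spec k t T"
proof -
  let ?c = "lam k"
  let ?K = "(1 / ?c) ^ CARD('d)"
  note c = lam_bounds[OF k]
  define B where "B f m = hcoeff f m * phase t m" for f :: "real ^ 'd \<Rightarrow> complex" and m
  define T :: "(real ^ 'd \<Rightarrow> complex) \<Rightarrow> real ^ 'd \<Rightarrow> complex"
    where "T f = (SOME h. is_series_limit ?c (B f) h)" for f
  have nB: "hnorm2 A (B f) = hnorm2 A (hcoeff f)" for A f
    by (simp add: hnorm2_def B_def norm_mult)
  have T: "is_series_limit ?c (B f) (T f)" if "f \<in> L2 gauss" for f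
  proof -
    have "(\<lambda>m. (cmod (B f m))\<^sup>2 * mi_fact m) summable_on UNIV"
      using hcoeff_summable[OF that] by (simp add: B_def norm_mult)
    from series_limit_exists[OF this c] show ?thesis unfolding T_def by (rule someI_ex)
  qed
  have TL: "T f \<in> L2 gauss" if "f \<in> L2 gauss" for f using T[OF that] by (simp add: is_series_limit_def)
  have lin: "AE x in gauss. T (\<lambda>x. a * f x + b * g x) x = a * T f x + b * T g x"
    if f: "f \<in> L2 gauss" and g: "g \<in> L2 gauss" for f g a b
  proof (rule series_limit_unique[OF T[OF L2_lincomb[OF f g]]])
    let ?d = "\<lambda>f n x. T f x - hsum (trunc n) (B f) ?c x"
    have hs: "hsum A (B (\<lambda>x. a * f x + b * g x)) ?c x = a * hsum A (B f) ?c x + b * hsum A (B g) ?c x" for A x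
      by (simp add: hsum_def B_def hcoeff_lincomb[OF f g] sum_distrib_left sum.distrib[symmetric] algebra_simps)
    have dL: "?d f n \<in> L2 gauss" if "f \<in> L2 gauss" for f n by (rule L2_diff[OF TL[OF that] hsum_L2])
    have "(\<lambda>n. 2 * (cmod a)\<^sup>2 * sqnorm gauss (?d f n) + 2 * (cmod b)\<^sup>2 * sqnorm gauss (?d g n))
        \<longlonglongrightarrow> 2 * (cmod a)\<^sup>2 * 0 + 2 * (cmod b)\<^sup>2 * 0"
      using T[OF f] T[OF g] unfolding is_series_limit_def by (intro tendsto_intros) auto
    then have lim: "(\<lambda>n. 2 * (cmod a)\<^sup>2 * sqnorm gauss (?d f n) + 2 * (cmod b)\<^sup>2 * sqnorm gauss (?d g n)) \<longlonglongrightarrow> 0"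
      by simp
    have le: "sqnorm gauss (\<lambda>x. (a * T f x + b * T g x) - hsum (trunc n) (B (\<lambda>x. a * f x + b * g x)) ?c x)
        \<le> 2 * (cmod a)\<^sup>2 * sqnorm gauss (?d f n) + 2 * (cmod b)\<^sup>2 * sqnorm gauss (?d g n)" for n
    proof -
      have "(a * T f x + b * T g x) - hsum (trunc n) (B (\<lambda>x. a * f x + b * g x)) ?c x = a * ?d f n x + b * ?d g n x" for x
        by (simp add: hs algebra_simps)
      then show ?thesis using sqnorm_lincomb_le[OF dL[OF f] dL[OF g], of a n b n] by (simp only:)
    qed
    have "(\<lambda>n. sqnorm gauss (\<lambda>x. (a * T f x + b * T g x) - hsum (trunc n) (B (\<lambda>x. a * f x + b * g x)) ?c x)) \<longlonglongrightarrow> 0"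
      by (rule tendsto_sandwich[OF _ _ tendsto_const lim]) (use le in auto)
    then show "is_series_limit ?c (B (\<lambda>x. a * f x + b * g x)) (\<lambda>x. a * T f x + b * T g x)"
      using L2_lincomb[OF TL[OF f] TL[OF g]] by (simp add: is_series_limit_def)
  qed
  have bdd: "sqnorm gauss (T f) \<le> ?K * sqnorm gauss f" if f: "f \<in> L2 gauss" for f
  proof (rule tendsto_upperbound)
    show "(\<lambda>n. sqnorm gauss (hsum (trunc n) (B f) ?c)) \<longlonglongrightarrow> sqnorm gauss (T f)"
      using T[OF f] unfolding is_series_limit_def by (intro sqnorm_tendsto hsum_L2) auto
    have "sqnorm gauss (hsum (trunc n) (B f) ?c) \<le> ?K * sqnorm gauss f" for n
    proof -
      have "sqnorm gauss (hsum (trunc n) (B f) ?c) \<le> ?K * hnorm2 (trunc n) (hcoeff f)"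
        using sqnorm_hsum_dilated[OF finite_trunc c, of n "B f"] unfolding nB .
      also have "\<dots> \<le> ?K * sqnorm gauss f"
        using c by (intro mult_left_mono Bessel[OF f finite_trunc]) auto
      finally show ?thesis .
    qed
    then show "\<forall>\<^sub>F n in sequentially. sqnorm gauss (hsum (trunc n) (B f) ?c) \<le> ?K * sqnorm gauss f" by simp
  qed simp
  have val: "AE x in gauss. T (\<lambda>y. of_real (Herm m y)) x = phase t m * of_real (Herm m (?c *\<^sub>R x))" for m
  proof (rule series_limit_unique[OF T])
    show H: "(\<lambda>y. complex_of_real (Herm m y)) \<in> L2 gauss" using Herm_L2[of m 1] by simp
    have "phase t m * of_real (Herm m (?c *\<^sub>R x)) - hsum (trunc n) (B (\<lambda>y. of_real (Herm m y))) ?c x = 0"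
      if "n \<ge> mi_abs m" for n x
    proof -
      have "hsum (trunc n) (B (\<lambda>y. of_real (Herm m y))) ?c x
          = (\<Sum>m'\<in>trunc n. if m' = m then phase t m * of_real (Herm m (?c *\<^sub>R x)) else 0)"
        unfolding hsum_def by (intro sum.cong) (auto simp: B_def hcoeff_Herm)
      also have "\<dots> = phase t m * of_real (Herm m (?c *\<^sub>R x))"
      proof -
        have "m \<in> trunc n" using that by (simp add: trunc_def)
        then show ?thesis by (simp add: finite_trunc)
      qed
      finally show ?thesis by simp
    qed
    then have ev: "\<forall>\<^sub>F n in sequentially. 0 = sqnorm gauss (\<lambda>x. phase t m * of_real (Herm m (?c *\<^sub>R x)) - hsum (trunc n) (B (\<lambda>y. of_real (Herm m y))) ?c x)"
      unfolding eventually_sequentially by (intro exI[of _ "mi_abs m"]) simp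
    have "(\<lambda>n. sqnorm gauss (\<lambda>x. phase t m * of_real (Herm m (?c *\<^sub>R x)) - hsum (trunc n) (B (\<lambda>y. of_real (Herm m y))) ?c x)) \<longlonglongrightarrow> 0"
      by (rule Lim_transform_eventually[OF tendsto_const ev])
    then show "is_series_limit ?c (B (\<lambda>y. of_real (Herm m y))) (\<lambda>x. phase t m * of_real (Herm m (?c *\<^sub>R x)))"
      using L2_scale[OF Herm_L2] by (simp add: is_series_limit_def)
  qed
  have "bounded_L2_operator gauss T"
    unfolding bounded_L2_operator_def using TL lin bdd by blast
  then show ?thesis unfolding Hop_spec_def using val by blast
qed

lemma Hop_spec_Hop: "k \<ge> 1 \<Longrightarrow> Hop_spec k t (Hop k t)"
  using someI_ex[OF Hop_exists[of k t]] unfolding Hop_def Hop_spec_def phase_def .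

lemma Hop_L2: "k \<ge> 1 \<Longrightarrow> g \<in> L2 gauss \<Longrightarrow> Hop k t g \<in> L2 gauss"
  using Hop_spec_Hop[of k t] by (auto simp: Hop_spec_def bounded_L2_operator_def)

lemma Hop_hsum:
  fixes b :: "nat ^ 'd \<Rightarrow> complex"
  assumes k: "k \<ge> 1" and A: "finite A"
  shows "AE x in gauss. Hop k t (hsum A b 1) x = hsum A (\<lambda>m. b m * phase t m) (lam k) x"
  using A
proof (induction A rule: finite_induct)
  let ?T = "Hop k t :: (real ^ 'd \<Rightarrow> complex) \<Rightarrow> _"
  have lin: "AE x in gauss. ?T (\<lambda>x. a * f x + b * g x) x = a * ?T f x + b * ?T g x"
    if "f \<in> L2 gauss" "g \<in> L2 gauss" for f g a b
    using Hop_spec_Hop[OF k, of t] that unfolding Hop_spec_def bounded_L2_operator_def by blast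
  have val: "AE x in gauss. ?T (\<lambda>y. of_real (Herm m y)) x = phase t m * of_real (Herm m (lam k *\<^sub>R x))" for m
    using Hop_spec_Hop[OF k, of t] unfolding Hop_spec_def by blast
  have H: "(\<lambda>y. complex_of_real (Herm m y)) \<in> L2 gauss" for m :: "nat ^ 'd" using Herm_L2[of m 1] by simp
  {
    case empty
    have "(\<lambda>x. 0 * of_real (Herm 0 x) + 0 * of_real (Herm 0 x)) = hsum {} b 1" by (simp add: hsum_def fun_eq_iff)
    with lin[OF H H, of 0 0 0 0] show ?case by (simp add: hsum_def)
  next
    case (insert m A)
    have e: "hsum (insert m A) b 1 = (\<lambda>x. b m * of_real (Herm m x) + 1 * hsum A b 1 x)"
      using insert by (simp add: hsum_def fun_eq_iff)
    show ?case
      unfolding e using lin[OF H[of m] hsum_L2[of A b 1], of "b m" 1] val[of m] insert(3)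
    proof eventually_elim
      case (elim x)
      then show ?case using insert(1,2) by (simp add: hsum_def mult_ac)
    qed
  }
qed

lemma has_hermite_expansion_hsum:
  "has_hermite_expansion g \<alpha> \<longleftrightarrow> ((\<lambda>A. sqnorm gauss (\<lambda>x. g x - hsum A \<alpha> 1 x)) \<longlongrightarrow> 0) (finite_subsets_at_top UNIV)"
  by (simp add: has_hermite_expansion_def hsum_def)

text \<open>
  The norm is continuous along the net of partial sums.
\<close>

lemma Parseval:
  assumes g: "g \<in> L2 gauss" and e: "has_hermite_expansion g \<alpha>"
  shows "((\<lambda>m. (cmod (\<alpha> m))\<^sup>2 * mi_fact m) has_sum sqnorm gauss g) UNIV"
proof -
  have "((\<lambda>A. sqnorm gauss (hsum A \<alpha> 1)) \<longlongrightarrow> sqnorm gauss g) (finite_subsets_at_top UNIV)"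
    using e unfolding has_hermite_expansion_hsum by (intro sqnorm_tendsto g hsum_L2)
  moreover have "\<forall>\<^sub>F A in finite_subsets_at_top UNIV. sqnorm gauss (hsum A \<alpha> 1) = (\<Sum>m\<in>A. (cmod (\<alpha> m))\<^sup>2 * mi_fact m)"
    by (rule eventually_finite_subsets_at_top_weakI) (simp add: sqnorm_hsum hnorm2_def)
  ultimately show ?thesis unfolding has_sum_def using tendsto_cong by fast
qed

text \<open>
  The constant is that of the dilation and hence uniform in \<open>t\<close>: boundedness identifies \<open>Hop k t g\<close> as the limit of
  the transformed partial sums, whose distances are then estimated by \<open>sqnorm_hsum_dilated\<close>.
\<close>

lemma Hop_approx:
  fixes g :: "real ^ 'd \<Rightarrow> complex"
  assumes k: "k \<ge> 1" and g: "g \<in> L2 gauss" and e: "has_hermite_expansion g \<alpha>" and A: "finite A"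
    and off: "\<And>m. m \<notin> A \<Longrightarrow> b m = 0"
    and s: "(\<lambda>m. (cmod (\<alpha> m - b m))\<^sup>2 * mi_fact m) summable_on UNIV"
  shows "sqnorm gauss (\<lambda>x. Hop k t g x - hsum A (\<lambda>m. b m * phase t m) (lam k) x)
    \<le> (1 / lam k) ^ CARD('d) * (\<Sum>\<^sub>\<infinity>m. (cmod (\<alpha> m - b m))\<^sup>2 * mi_fact m)"
proof -
  let ?T = "Hop k t :: (real ^ 'd \<Rightarrow> complex) \<Rightarrow> _"
  let ?ph = "\<lambda>a m. a m * phase t m"
  let ?F = "finite_subsets_at_top (UNIV :: (nat ^ 'd) set)"
  note c = lam_bounds[OF k]
  obtain C where C: "\<And>f. f \<in> L2 gauss \<Longrightarrow> sqnorm gauss (?T f) \<le> C * sqnorm gauss f"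
    using Hop_spec_Hop[OF k, of t] unfolding Hop_spec_def bounded_L2_operator_def by blast
  have lin: "AE x in gauss. ?T (\<lambda>x. a * f x + b * g x) x = a * ?T f x + b * ?T g x"
    if "f \<in> L2 gauss" "g \<in> L2 gauss" for f g a b
    using Hop_spec_Hop[OF k, of t] that unfolding Hop_spec_def bounded_L2_operator_def by blast
  have TL: "?T f \<in> L2 gauss" if "f \<in> L2 gauss" for f by (rule Hop_L2[OF k that])
  have le: "sqnorm gauss (\<lambda>x. ?T g x - hsum B (?ph \<alpha>) (lam k) x) \<le> C * sqnorm gauss (\<lambda>x. g x - hsum B \<alpha> 1 x)"
    if B: "finite B" for B
  proof -
    have "AE x in gauss. ?T (\<lambda>x. g x - hsum B \<alpha> 1 x) x = ?T g x - hsum B (?ph \<alpha>) (lam k) x"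
      using lin[OF g hsum_L2[of B \<alpha> 1], of 1 "-1"] Hop_hsum[OF k B, of t \<alpha>]
      by eventually_elim simp
    then have "sqnorm gauss (?T (\<lambda>x. g x - hsum B \<alpha> 1 x)) = sqnorm gauss (\<lambda>x. ?T g x - hsum B (?ph \<alpha>) (lam k) x)"
      by (rule sqnorm_cong_AE) (auto intro!: L2_measurable L2_diff TL g hsum_L2 simp del: measurable_gauss_iff)
    then show ?thesis using C[OF L2_diff[OF g hsum_L2[of B \<alpha> 1]]] by simp
  qed
  have "((\<lambda>B. C * sqnorm gauss (\<lambda>x. g x - hsum B \<alpha> 1 x)) \<longlongrightarrow> C * 0) ?F"
    using e unfolding has_hermite_expansion_hsum by (intro tendsto_intros)
  then have lim0: "((\<lambda>B. C * sqnorm gauss (\<lambda>x. g x - hsum B \<alpha> 1 x)) \<longlongrightarrow> 0) ?F" by simp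
  have lim: "((\<lambda>B. sqnorm gauss (\<lambda>x. ?T g x - hsum B (?ph \<alpha>) (lam k) x)) \<longlongrightarrow> 0) ?F"
    by (rule tendsto_sandwich[OF _ _ tendsto_const lim0])
       (auto intro!: eventually_finite_subsets_at_top_weakI le)
  let ?u = "\<lambda>B x. hsum B (?ph \<alpha>) (lam k) x - hsum A (?ph b) (lam k) x"
  have "((\<lambda>B. sqnorm gauss (?u B)) \<longlongrightarrow> sqnorm gauss (\<lambda>x. ?T g x - hsum A (?ph b) (lam k) x)) ?F"
  proof (rule sqnorm_tendsto)
    show "(\<lambda>x. ?T g x - hsum A (?ph b) (lam k) x) \<in> L2 gauss" by (rule L2_diff[OF TL[OF g] hsum_L2])
    show "?u B \<in> L2 gauss" for B by (rule L2_diff[OF hsum_L2 hsum_L2])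
    show "((\<lambda>B. sqnorm gauss (\<lambda>x. ?T g x - hsum A (?ph b) (lam k) x - ?u B x)) \<longlongrightarrow> 0) ?F"
      using lim by simp
  qed
  then show ?thesis
  proof (rule tendsto_upperbound)
    show "\<forall>\<^sub>F B in ?F. sqnorm gauss (?u B) \<le> (1 / lam k) ^ CARD('d) * (\<Sum>\<^sub>\<infinity>m. (cmod (\<alpha> m - b m))\<^sup>2 * mi_fact m)"
      unfolding eventually_finite_subsets_at_top
    proof (intro exI[of _ A] conjI A subset_UNIV allI impI)
      fix B :: "(nat ^ 'd) set" assume "finite B \<and> A \<subseteq> B \<and> B \<subseteq> UNIV"
      then have B: "finite B" "A \<subseteq> B" by auto
      have "hsum A (?ph b) (lam k) x = hsum B (?ph b) (lam k) x" for x
        unfolding hsum_def using B off by (intro sum.mono_neutral_left) auto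
      then have "?u B x = hsum B (?ph (\<lambda>m. \<alpha> m - b m)) (lam k) x" for x
        by (simp add: hsum_def sum_subtractf[symmetric] algebra_simps)
      then have "sqnorm gauss (?u B) \<le> (1 / lam k) ^ CARD('d) * hnorm2 B (?ph (\<lambda>m. \<alpha> m - b m))"
        using sqnorm_hsum_dilated[OF B(1) c, of "?ph (\<lambda>m. \<alpha> m - b m)"] by (simp only:)
      also have "hnorm2 B (?ph (\<lambda>m. \<alpha> m - b m)) = hnorm2 B (\<lambda>m. \<alpha> m - b m)"
        by (simp add: hnorm2_def norm_mult)
      also have "(1 / lam k) ^ CARD('d) * \<dots> \<le> (1 / lam k) ^ CARD('d) * (\<Sum>\<^sub>\<infinity>m. (cmod (\<alpha> m - b m))\<^sup>2 * mi_fact m)"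
        using c by (intro mult_left_mono hnorm2_le_infsum s B) auto
      finally show "sqnorm gauss (?u B) \<le> (1 / lam k) ^ CARD('d) * (\<Sum>\<^sub>\<infinity>m. (cmod (\<alpha> m - b m))\<^sup>2 * mi_fact m)" .
    qed
  qed simp
qed

section \<open>Power means, waves and Fejer kernels\<close>

text \<open>
  The convex function \<open>x\<^sup>n\<^sup>+\<^sup>1\<close> lies above its tangent at \<open>a\<close>.
\<close>

lemma weighted_power_mean_pointwise:
  fixes a x :: real
  assumes "0 \<le> a" "0 \<le> x"
  shows "real (Suc n) * a ^ n * x \<le> x ^ Suc n + real n * a ^ Suc n"
proof (induction n)
  case (Suc n)
  have "0 \<le> real (Suc n) * a ^ n * (x - a)\<^sup>2" using assms by simp
  also have "\<dots> = x * (real (Suc n) * a ^ n * x) - x * (real n * a ^ Suc n)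
      - (real (Suc (Suc n)) * a ^ Suc n * x - real (Suc n) * a ^ Suc (Suc n))"
    by (simp add: power2_eq_square algebra_simps)
  also have "\<dots> \<le> x * (x ^ Suc n + real n * a ^ Suc n) - x * (real n * a ^ Suc n)
      - (real (Suc (Suc n)) * a ^ Suc n * x - real (Suc n) * a ^ Suc (Suc n))"
    using mult_left_mono[OF Suc assms(2)] by (simp only: diff_right_mono)
  finally show ?case by (simp add: algebra_simps)
qed simp

text \<open>
  Jensen's inequality for powers, with infinite values allowed: integrate the tangent inequality at the
  mean.
\<close>

lemma nn_integral_power_le:
  assumes P: "prob_space P" and [measurable]: "f \<in> borel_measurable P"
  shows "(\<integral>\<^sup>+x. f x \<partial>P) ^ Suc n \<le> (\<integral>\<^sup>+x. f x ^ Suc n \<partial>P)"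
proof -
  interpret prob_space P by (rule P)
  show ?thesis
  proof (cases "(\<integral>\<^sup>+x. f x \<partial>P) = \<infinity>")
    case True
    have "f x \<le> 1 + f x ^ Suc n" for x
    proof (cases "f x \<le> 1")
      case False
      then have "f x * 1 \<le> f x * f x ^ n" by (intro mult_left_mono one_le_power) auto
      then show ?thesis by (simp add: add_increasing)
    qed (simp add: add_increasing2)
    then have "(\<integral>\<^sup>+x. f x \<partial>P) \<le> (\<integral>\<^sup>+x. 1 + f x ^ Suc n \<partial>P)" by (intro nn_integral_mono)
    also have "\<dots> = 1 + (\<integral>\<^sup>+x. f x ^ Suc n \<partial>P)" by (simp add: nn_integral_add emeasure_space_1)
    finally show ?thesis using True by (simp add: top_unique)
  next
    case False
    then obtain a where a: "(\<integral>\<^sup>+x. f x \<partial>P) = ennreal a" "0 \<le> a" by (cases "\<integral>\<^sup>+x. f x \<partial>P") auto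
    have pt: "ennreal (real (Suc n) * a ^ n) * f x \<le> f x ^ Suc n + ennreal (real n * a ^ Suc n)" for x
    proof (cases "f x")
      case (real y)
      then show ?thesis using weighted_power_mean_pointwise[OF a(2) real(1), of n] a(2)
        by (simp add: ennreal_power ennreal_mult'[symmetric] ennreal_plus[symmetric] del: ennreal_plus power_Suc of_nat_Suc)
    next
      case top then show ?thesis by (simp add: ennreal_top_mult)
    qed
    have "ennreal (real (Suc n) * a ^ n) * ennreal a = (\<integral>\<^sup>+x. ennreal (real (Suc n) * a ^ n) * f x \<partial>P)"
      by (simp add: nn_integral_cmult a(1) del: of_nat_Suc)
    also have "\<dots> \<le> (\<integral>\<^sup>+x. f x ^ Suc n + ennreal (real n * a ^ Suc n) \<partial>P)" by (intro nn_integral_mono pt)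
    also have "\<dots> = (\<integral>\<^sup>+x. f x ^ Suc n \<partial>P) + ennreal (real n * a ^ Suc n)"
      by (simp add: nn_integral_add emeasure_space_1 del: power_Suc)
    finally have le: "ennreal (real (Suc n) * a ^ n) * ennreal a \<le> (\<integral>\<^sup>+x. f x ^ Suc n \<partial>P) + ennreal (real n * a ^ Suc n)" .
    have "ennreal (real (Suc n) * a ^ n) * ennreal a = ennreal (a ^ Suc n + real n * a ^ Suc n)"
      using a(2) by (simp add: ennreal_mult[symmetric] algebra_simps)
    also have "\<dots> = ennreal (a ^ Suc n) + ennreal (real n * a ^ Suc n)"
      using a(2) by (intro ennreal_plus) auto
    finally have "ennreal (a ^ Suc n) + ennreal (real n * a ^ Suc n) \<le> (\<integral>\<^sup>+x. f x ^ Suc n \<partial>P) + ennreal (real n * a ^ Suc n)"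
      using le by simp
    then have "ennreal (a ^ Suc n) \<le> (\<integral>\<^sup>+x. f x ^ Suc n \<partial>P)"
      using ennreal_add_left_cancel_le[of "ennreal (real n * a ^ Suc n)"]
      by (simp only: add.commute[of _ "ennreal (real n * a ^ Suc n)"]) simp
    then show ?thesis using a by (simp add: ennreal_power del: power_Suc)
  qed
qed

lemma nn_integral_weighted_power_le:
  assumes [measurable]: "w \<in> borel_measurable M" "f \<in> borel_measurable M" and w: "(\<integral>\<^sup>+x. w x \<partial>M) = 1"
  shows "(\<integral>\<^sup>+x. w x * f x \<partial>M) ^ Suc n \<le> (\<integral>\<^sup>+x. w x * f x ^ Suc n \<partial>M)"
proof -
  have "prob_space (density M w)"
    by (rule prob_spaceI) (simp add: emeasure_density w cong: nn_integral_cong)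
  from nn_integral_power_le[OF this, of f n] show ?thesis
    by (simp add: nn_integral_density del: power_Suc)
qed

text \<open>
  Powers are continuous on the extended half-line, the ambiguous product \<open>0 \<cdot> \<infinity>\<close> does not arise when both factors tend to powers of the same limit.
\<close>

lemma tendsto_power_ennreal:
  fixes f :: "'a \<Rightarrow> ennreal"
  assumes "(f \<longlongrightarrow> l) F"
  shows "((\<lambda>x. f x ^ n) \<longlongrightarrow> l ^ n) F"
proof (induction n)
  case (Suc n)
  have "\<not> (l = 0 \<and> l ^ n = top)" by (cases n) auto
  moreover have "\<not> (l = top \<and> l ^ n = 0)" by (induction n) auto
  ultimately show ?case unfolding power_Suc
    by (intro tendsto_mult_ennreal assms Suc) (auto simp: infinity_ennreal_def)
qed simp

lemma power_liminf_le:
  fixes a :: "nat \<Rightarrow> ennreal"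
  shows "(liminf a) ^ n \<le> liminf (\<lambda>j. a j ^ n)"
proof (rule LIMSEQ_le_const2)
  let ?u = "\<lambda>i. INF j\<in>{i..}. a j"
  have "incseq ?u" by (intro monoI INF_superset_mono) auto
  then have "?u \<longlonglongrightarrow> (SUP i. ?u i)" by (rule LIMSEQ_SUP)
  then have "?u \<longlonglongrightarrow> liminf a" by (simp add: liminf_SUP_INF)
  then show "(\<lambda>i. ?u i ^ n) \<longlonglongrightarrow> (liminf a) ^ n" by (rule tendsto_power_ennreal)
  have "?u i ^ n \<le> liminf (\<lambda>j. a j ^ n)" for i
  proof (rule Liminf_bounded)
    show "\<forall>\<^sub>F j in sequentially. ?u i ^ n \<le> a j ^ n"
      using eventually_ge_at_top[of i] by eventually_elim (auto intro!: power_mono INF_lower)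
  qed
  then show "\<exists>N. \<forall>i\<ge>N. ?u i ^ n \<le> liminf (\<lambda>j. a j ^ n)" by blast
qed

definition period :: "real measure" where
  "period = restrict_space lborel {-1/2..1/2}"

lemma sets_period [measurable_cong]: "sets period = sets (restrict_space borel {-1/2..1/2})"
  unfolding period_def by (rule sets_restrict_space_cong) simp

lemma measurable_period [measurable (raw)]: "f \<in> borel \<rightarrow>\<^sub>M N \<Longrightarrow> f \<in> period \<rightarrow>\<^sub>M N"
  by (simp add: period_def measurable_restrict_space1)

lemma nn_integral_period: "(\<integral>\<^sup>+t. f t \<partial>period) = (\<integral>\<^sup>+t\<in>{-1/2..1/2}. f t \<partial>lborel)"
  unfolding period_def by (rule nn_integral_restrict_space) simp

lemma prob_space_period: "prob_space period"
  by (rule prob_spaceI) (simp add: period_def emeasure_restrict_space space_restrict_space)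

lemma period_integrable_continuous:
  fixes f :: "real \<Rightarrow> 'b::euclidean_space"
  assumes "continuous_on UNIV f"
  shows "integrable period f"
  unfolding period_def
  by (subst integrable_restrict_space)
     (auto intro!: borel_integrable_atLeastAtMost' continuous_on_subset[OF assms] simp: set_integrable_def[symmetric])

text \<open>
  The Fourier basis over a period of length one; frequencies are integers because products with
  conjugates occur.
\<close>

definition wave :: "int \<Rightarrow> real \<Rightarrow> complex" where
  "wave n t = cis (2 * pi * real_of_int n * t)"

lemma wave_add: "wave m t * wave n t = wave (m + n) t"
  by (simp add: wave_def cis_mult algebra_simps)

lemma wave_0 [simp]: "wave 0 t = 1" by (simp add: wave_def)
lemma cnj_wave: "cnj (wave n t) = wave (- n) t" by (simp add: wave_def cis_cnj)
lemma wave_diff: "wave n (t - r) = wave n t * wave (- n) r"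
  by (simp add: wave_def cis_mult algebra_simps)
lemma norm_wave [simp]: "cmod (wave n t) = 1" by (simp add: wave_def)

lemma continuous_wave [continuous_intros]: "continuous_on A f \<Longrightarrow> continuous_on A (\<lambda>t. wave n (f t))"
  unfolding wave_def by (intro continuous_intros)

lemma borel_measurable_wave [measurable]: "wave n \<in> borel_measurable borel"
  by (intro borel_measurable_continuous_onI continuous_intros)

lemma integrable_wave: "integrable period (wave n)"
  by (rule period_integrable_continuous) (intro continuous_intros)

lemma integral_wave: "(\<integral>t. wave n t \<partial>period) = (if n = 0 then 1 else 0)"
proof (cases "n = 0")
  case True
  interpret prob_space period by (rule prob_space_period)
  show ?thesis using True by (simp add: prob_space)
next
  case False
  define c where "c = 2 * pi * real_of_int n"
  have c: "c \<noteq> 0" using False by (simp add: c_def)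
  define F where "F t = cis (c * t) / (\<i> * of_real c)" for t
  have deriv: "(F has_vector_derivative wave n t) (at t within A)" for t A
  proof -
    have "((\<lambda>z. exp (\<i> * of_real c * z)) has_field_derivative exp (\<i> * of_real c * of_real t) * (\<i> * of_real c)) (at (of_real t))"
      by (auto intro!: derivative_eq_intros)
    from has_vector_derivative_real_field[OF this, of A]
    have "((\<lambda>t. cis (c * t)) has_vector_derivative c *\<^sub>R (\<i> * cis (c * t))) (at t within A)"
      by (simp add: cis_conv_exp scaleR_conv_of_real mult_ac)
    then have "(F has_vector_derivative (c *\<^sub>R (\<i> * cis (c * t))) / (\<i> * of_real c)) (at t within A)"
      unfolding F_def by (rule has_vector_derivative_divide)
    then show ?thesis using c by (simp add: wave_def c_def[symmetric] scaleR_conv_of_real)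
  qed
  have "(\<integral>t. wave n t \<partial>period) = (\<integral>t. indicator {-1/2..1/2} t *\<^sub>R wave n t \<partial>lborel)"
    unfolding period_def by (subst integral_restrict_space) auto
  also have "\<dots> = F (1/2) - F (-1/2)"
    by (rule integral_FTC_Icc) (auto intro!: deriv continuous_intros)
  also have "\<dots> = 0"
  proof -
    have "sin (pi * real_of_int n) = 0" by (simp add: sin_zero_iff_int2) 
    then have "cis (pi * real_of_int n) = cis (- (pi * real_of_int n))" by (simp add: complex_eq_iff)
    then show ?thesis by (simp add: F_def c_def diff_divide_distrib[symmetric])
  qed
  finally show ?thesis using False by simp
qed

text \<open>
  Nonnegative because it is a square. For \<open>N \<ge> 1\<close> its integral is one, and convolution with it multiplies the \<open>n\<close>-th Fourier
  coefficient by \<open>(1 - n / N)\<close> for \<open>0 \<le> n \<le> N\<close> and by \<open>0\<close> for larger \<open>n\<close>.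
\<close>

definition Fejer :: "nat \<Rightarrow> real \<Rightarrow> real" where
  "Fejer N s = (cmod (\<Sum>n<N. wave (int n) s))\<^sup>2 / real N"

lemma Fejer_nonneg: "Fejer N s \<ge> 0"
  by (simp add: Fejer_def)

lemma Fejer_even: "Fejer N (- s) = Fejer N s"
proof -
  have "(\<Sum>n<N. wave (int n) (- s)) = cnj (\<Sum>n<N. wave (int n) s)"
    by (simp add: cnj_sum cnj_wave) (simp add: wave_def)
  then show ?thesis by (simp only: Fejer_def complex_mod_cnj)
qed

lemma borel_measurable_Fejer [measurable]: "Fejer N \<in> borel_measurable borel"
  unfolding Fejer_def by measurable

lemma Fejer_expand:
  "complex_of_real (Fejer N s) = (\<Sum>a<N. \<Sum>b<N. wave (int a - int b) s) / of_nat N"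
  unfolding Fejer_def of_real_divide complex_norm_square cnj_sum sum_product cnj_wave wave_add
  by simp

lemma Fejer_convolution_wave:
  shows "integrable period (\<lambda>r. of_real (Fejer N (t - r)) * wave (int m) r)"
    and "(\<integral>r. of_real (Fejer N (t - r)) * wave (int m) r \<partial>period)
      = of_real (real (N - m) / real N) * wave (int m) t"
proof -
  have e: "of_real (Fejer N (t - r)) * wave (int m) r
      = (\<Sum>b<N. \<Sum>a<N. wave (int a - int b) t * wave (int m - (int a - int b)) r) / of_nat N" for r
  proof -
    have "of_real (Fejer N (t - r)) * wave (int m) r
        = (\<Sum>a<N. \<Sum>b<N. wave (int a - int b) t * (wave (- (int a - int b)) r * wave (int m) r)) / of_nat N"
      unfolding Fejer_expand wave_diff by (simp add: sum_distrib_right sum_divide_distrib mult.assoc)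
    also have "\<dots> = (\<Sum>b<N. \<Sum>a<N. wave (int a - int b) t * wave (int m - (int a - int b)) r) / of_nat N"
      unfolding wave_add by (subst sum.swap) (simp add: algebra_simps)
    finally show ?thesis .
  qed
  show "integrable period (\<lambda>r. of_real (Fejer N (t - r)) * wave (int m) r)"
    unfolding e by (intro integrable_divide_zero Bochner_Integration.integrable_sum integrable_mult_right integrable_wave) 
  have "(\<integral>r. of_real (Fejer N (t - r)) * wave (int m) r \<partial>period)
      = (\<Sum>b<N. \<Sum>a<N. wave (int a - int b) t * (if int m - (int a - int b) = 0 then 1 else 0)) / of_nat N"
    unfolding e
    by (simp add: Bochner_Integration.integral_sum integrable_wave integral_wave)
  also have "(\<Sum>b<N. \<Sum>a<N. wave (int a - int b) t * (if int m - (int a - int b) = 0 then 1 else 0))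
      = (\<Sum>b<N. \<Sum>a<N. if a = b + m then wave (int m) t else 0)"
    by (intro sum.cong) auto
  also have "\<dots> = (\<Sum>b<N. if b < N - m then wave (int m) t else 0)"
    by (intro sum.cong) auto
  also have "\<dots> = (\<Sum>b\<in>{..<N - m}. wave (int m) t)"
    by (intro sum.mono_neutral_cong_right) auto
  also have "\<dots> = of_nat (N - m) * wave (int m) t" by simp
  finally show "(\<integral>r. of_real (Fejer N (t - r)) * wave (int m) r \<partial>period)
      = of_real (real (N - m) / real N) * wave (int m) t" by simp
qed

lemma nn_integral_Fejer:
  assumes "N \<ge> 1"
  shows "(\<integral>\<^sup>+r. ennreal (Fejer N (t - r)) \<partial>period) = 1" "(\<integral>\<^sup>+r. ennreal (Fejer N (r - t)) \<partial>period) = 1"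
proof -
  have i: "integrable period (\<lambda>r. complex_of_real (Fejer N (t - r)))"
    using Fejer_convolution_wave(1)[of N t 0] by simp
  have "complex_of_real (\<integral>r. Fejer N (t - r) \<partial>period) = 1"
    using Fejer_convolution_wave(2)[of N t 0] assms by simp
  then have v: "(\<integral>r. Fejer N (t - r) \<partial>period) = 1" by (simp only: of_real_eq_1_iff)
  have i': "integrable period (\<lambda>r. Fejer N (t - r))" using i by (simp add: complex_of_real_integrable_eq)
  show 1: "(\<integral>\<^sup>+r. ennreal (Fejer N (t - r)) \<partial>period) = 1"
    by (subst nn_integral_eq_integral[OF i']) (auto simp: Fejer_nonneg v)
  have "Fejer N (r - t) = Fejer N (t - r)" for r using Fejer_even[of N "t - r"] by simp
  then show "(\<integral>\<^sup>+r. ennreal (Fejer N (r - t)) \<partial>period) = 1" using 1 by simp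
qed

section \<open>The identity for finite Hermite expansions\<close>

text \<open>
  The form written with the matrix \<open>Pker\<close> itself, as it comes out of multiplying integrals.
\<close>

lemma level_form_double_sum:
  fixes \<phi> :: "nat ^ 'd ^ 'k ^ 'l \<Rightarrow> complex"
  shows "complex_of_real (level_form S \<phi>)
    = (\<Sum>M | mat_abs M = S. \<Sum>N | mat_abs N = S. \<phi> M * cnj (\<phi> N) * of_real (Pker M N))"
proof -
  have sym: "Pker M N = Pker N M" for M N :: "nat ^ 'd ^ 'k ^ 'l"
    by (simp add: Pker_def mult.commute)
  have "complex_of_real (level_form S \<phi>) = level_inner S \<phi> (Pop \<phi>)" by (rule level_inner_Pop_self[symmetric])
  also have "\<dots> = (\<Sum>M | mat_abs M = S. \<phi> M * cnj (\<Sum>N | mat_abs N = S. \<phi> N * of_real (Pker N M)))"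
    unfolding level_inner_def
  proof (intro sum.cong refl)
    fix M :: "nat ^ 'd ^ 'k ^ 'l" assume "M \<in> {M. mat_abs M = S}"
    then have "Pop \<phi> M = (\<Sum>N | mat_abs N = S. \<phi> N * of_real (Pker N M)) / of_real (mat_fact M)"
      by (simp add: Pop_def sum_divide_distrib sym)
    then show "\<phi> M * cnj (Pop \<phi> M) * of_real (mat_fact M) = \<phi> M * cnj (\<Sum>N | mat_abs N = S. \<phi> N * of_real (Pker N M))"
      by simp
  qed
  also have "\<dots> = (\<Sum>M | mat_abs M = S. \<Sum>N | mat_abs N = S. \<phi> M * cnj (\<phi> N) * of_real (Pker M N))"
    by (simp add: sum_distrib_left mult.assoc sym)
  finally show ?thesis .
qed

definition matrices_over :: "(nat ^ 'd) set \<Rightarrow> (nat ^ 'd ^ 'k ^ 'l) set" where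
  "matrices_over A = {M. \<forall>i j. M $ i $ j \<in> A}"

lemma bij_mat_entries: "bij (\<lambda>M :: 'a ^ 'k ^ 'l. \<lambda>e. M $ fst e $ snd e)"
  by (rule bij_betw_byWitness[where f' = "\<lambda>h. \<chi> i j. h (i, j)"]) (auto simp: vec_eq_iff fun_eq_iff)

lemma
  assumes A: "finite A"
  shows finite_matrices_over: "finite (matrices_over A :: (nat ^ 'd ^ 'k ^ 'l) set)"
    and prod_sum_matrices_over: "(\<Prod>i\<in>UNIV. \<Prod>j\<in>UNIV. \<Sum>m\<in>A. f i j m)
      = (\<Sum>M\<in>(matrices_over A :: (nat ^ 'd ^ 'k ^ 'l) set). \<Prod>i\<in>UNIV. \<Prod>j\<in>UNIV. f i j (M $ i $ j) :: 'c::comm_semiring_1)"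
proof -
  let ?E = "\<lambda>M :: nat ^ 'd ^ 'k ^ 'l. \<lambda>e. M $ fst e $ snd e"
  let ?P = "PiE (UNIV :: ('l \<times> 'k) set) (\<lambda>_. A)"
  have bij: "bij_betw ?E (matrices_over A) ?P"
  proof (rule bij_betw_subset[OF bij_mat_entries subset_UNIV], intro equalityI subsetI)
    fix h assume h: "h \<in> ?P"
    have "surj ?E" by (rule bij_is_surj[OF bij_mat_entries])
    then obtain M where M: "h = ?E M" by (rule surjE)
    have "M $ i $ j \<in> A" for i j using PiE_mem[OF h, of "(i, j)"] unfolding M by simp
    then have "M \<in> matrices_over A" by (simp add: matrices_over_def)
    then show "h \<in> ?E ` matrices_over A" unfolding M by (rule imageI)
  qed (auto simp: matrices_over_def)
  show "finite (matrices_over A :: (nat ^ 'd ^ 'k ^ 'l) set)"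
    using bij_betw_finite[OF bij] A by (simp add: finite_PiE)
  have "(\<Prod>i\<in>UNIV. \<Prod>j\<in>UNIV. \<Sum>m\<in>A. f i j m) = (\<Prod>e\<in>UNIV. \<Sum>m\<in>A. f (fst e) (snd e) m)"
    unfolding prod_UNIV_prod by simp
  also have "\<dots> = (\<Sum>h\<in>?P. \<Prod>e\<in>UNIV. f (fst e) (snd e) (h e))"
    by (rule prod_sum_PiE) (use A in auto)
  also have "\<dots> = (\<Sum>M\<in>matrices_over A. \<Prod>e\<in>UNIV. f (fst e) (snd e) (?E M e))"
    by (rule sum.reindex_bij_betw[OF bij, symmetric])
  finally show "(\<Prod>i\<in>UNIV. \<Prod>j\<in>UNIV. \<Sum>m\<in>A. f i j m)
      = (\<Sum>M\<in>(matrices_over A :: (nat ^ 'd ^ 'k ^ 'l) set). \<Prod>i\<in>UNIV. \<Prod>j\<in>UNIV. f i j (M $ i $ j))"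
    unfolding prod_UNIV_prod by simp
qed

definition mat_prod :: "(nat ^ 'd \<Rightarrow> complex) \<Rightarrow> nat ^ 'd ^ 'k ^ 'l \<Rightarrow> complex" where
  "mat_prod \<alpha> M = (\<Prod>i\<in>UNIV. \<Prod>j\<in>UNIV. \<alpha> (M $ i $ j))"

definition mat_Herm :: "nat ^ 'd ^ 'k ^ 'l \<Rightarrow> ('l \<Rightarrow> real ^ 'd) \<Rightarrow> real" where
  "mat_Herm M x = (\<Prod>i\<in>UNIV. \<Prod>j\<in>UNIV. Herm (M $ i $ j) (lam CARD('k) *\<^sub>R x i))"

abbreviation gauss_rows :: "('l::finite \<Rightarrow> real ^ 'd::finite) measure" where
  "gauss_rows \<equiv> Pi\<^sub>M UNIV (\<lambda>_. gauss)"

lemma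
  fixes M N :: "nat ^ 'd ^ 'k ^ 'l"
  shows integrable_mat_Herm: "integrable gauss_rows (\<lambda>x. mat_Herm M x * mat_Herm N x)"
    and integral_mat_Herm: "(\<integral>x. mat_Herm M x * mat_Herm N x \<partial>gauss_rows) = Pker M N"
proof -
  interpret product_sigma_finite "\<lambda>_::'l. gauss :: (real ^ 'd) measure"
    by (rule product_sigma_finite_gauss)
  have e: "mat_Herm M x * mat_Herm N x = (\<Prod>i\<in>UNIV. \<Prod>j\<in>UNIV. Herm (M $ i $ j) (lam CARD('k) *\<^sub>R x i) * Herm (N $ i $ j) (lam CARD('k) *\<^sub>R x i))" for x
    by (simp add: mat_Herm_def prod.distrib)
  show "integrable gauss_rows (\<lambda>x. mat_Herm M x * mat_Herm N x)"
    unfolding e prod_Herm_rows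
    by (rule product_integrable_prod) (simp_all only: finite_class.finite_UNIV integral_gauss_prod(1)[OF integrable_poly_gauss])
  show "(\<integral>x. mat_Herm M x * mat_Herm N x \<partial>gauss_rows) = Pker M N"
    unfolding e Pker_def ..
qed

lemma
  fixes c :: "nat ^ 'd ^ 'k ^ 'l \<Rightarrow> complex"
  shows integrable_mat_Herm_sum: "integrable gauss_rows (\<lambda>x. (cmod (\<Sum>M\<in>AA. c M * of_real (mat_Herm M x)))\<^sup>2)"
    and integral_mat_Herm_sum: "complex_of_real (\<integral>x. (cmod (\<Sum>M\<in>AA. c M * of_real (mat_Herm M x)))\<^sup>2 \<partial>gauss_rows)
      = (\<Sum>M\<in>AA. \<Sum>N\<in>AA. c M * cnj (c N) * of_real (Pker M N))"
proof -
  have e: "complex_of_real ((cmod (\<Sum>M\<in>AA. c M * of_real (mat_Herm M x)))\<^sup>2)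
      = (\<Sum>M\<in>AA. \<Sum>N\<in>AA. c M * cnj (c N) * of_real (mat_Herm M x * mat_Herm N x))" for x
    by (simp only: complex_norm_square cnj_sum sum_product complex_cnj_mult complex_cnj_complex_of_real of_real_mult mult_ac)
  have i: "integrable gauss_rows (\<lambda>x. c M * cnj (c N) * complex_of_real (mat_Herm M x * mat_Herm N x))" for M N
    by (intro integrable_mult_right integrable_of_real integrable_mat_Herm)
  have "integrable gauss_rows (\<lambda>x. complex_of_real ((cmod (\<Sum>M\<in>AA. c M * of_real (mat_Herm M x)))\<^sup>2))"
    unfolding e by (intro Bochner_Integration.integrable_sum i)
  then show "integrable gauss_rows (\<lambda>x. (cmod (\<Sum>M\<in>AA. c M * of_real (mat_Herm M x)))\<^sup>2)"
    by (simp only: complex_of_real_integrable_eq)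
  show "complex_of_real (\<integral>x. (cmod (\<Sum>M\<in>AA. c M * of_real (mat_Herm M x)))\<^sup>2 \<partial>gauss_rows)
      = (\<Sum>M\<in>AA. \<Sum>N\<in>AA. c M * cnj (c N) * of_real (Pker M N))"
    unfolding integral_complex_of_real[symmetric] e
    by (simp only: Bochner_Integration.integral_sum[OF Bochner_Integration.integrable_sum[OF i]]
        Bochner_Integration.integral_sum[OF i] integral_mult_right_zero integral_complex_of_real integral_mat_Herm)
qed

lemma phase_wave: "phase t m = wave (int (mi_abs m)) t"
  unfolding phase_def wave_def cis_conv_exp by (simp add: mult_ac)

lemma prod_wave: "(\<Prod>i\<in>A. wave (f i) t) = wave (\<Sum>i\<in>A. f i) t"
  by (induction A rule: infinite_finite_induct) (simp_all add: wave_add)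

lemma mat_prod_phase: "mat_prod (\<lambda>m. b m * phase t m) M = mat_prod b M * wave (int (mat_abs M)) t"
  by (simp add: mat_prod_def phase_wave prod.distrib prod_wave mat_abs_def)

text \<open>
  A power of an integral is an integral over a product space.
\<close>

lemma mixed_norm_power:
  fixes F :: "real ^ 'd \<Rightarrow> complex"
  assumes [measurable]: "F \<in> borel_measurable borel"
  shows "(\<integral>\<^sup>+x. ennreal (cmod (F x) ^ (2 * CARD('k::finite))) \<partial>gauss) ^ CARD('l::finite)
    = (\<integral>\<^sup>+x. ennreal ((cmod (\<Prod>i\<in>(UNIV :: 'l set). \<Prod>j\<in>(UNIV :: 'k set). F (x i)))\<^sup>2) \<partial>gauss_rows)"
proof -
  interpret product_sigma_finite "\<lambda>_::'l. gauss :: (real ^ 'd) measure"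
    by (rule product_sigma_finite_gauss)
  have "(\<integral>\<^sup>+x. ennreal (cmod (F x) ^ (2 * CARD('k))) \<partial>gauss) ^ CARD('l)
      = (\<Prod>i\<in>(UNIV :: 'l set). \<integral>\<^sup>+x. ennreal (cmod (F x) ^ (2 * CARD('k))) \<partial>gauss)" by simp
  also have "\<dots> = (\<integral>\<^sup>+x. (\<Prod>i\<in>(UNIV :: 'l set). ennreal (cmod (F (x i)) ^ (2 * CARD('k)))) \<partial>gauss_rows)"
    by (rule product_nn_integral_prod[symmetric]) auto
  also have "\<dots> = (\<integral>\<^sup>+x. ennreal ((cmod (\<Prod>i\<in>(UNIV :: 'l set). \<Prod>j\<in>(UNIV :: 'k set). F (x i)))\<^sup>2) \<partial>gauss_rows)"
  proof (intro nn_integral_cong)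
    fix x :: "'l \<Rightarrow> real ^ 'd"
    have "(cmod (\<Prod>i\<in>(UNIV :: 'l set). \<Prod>j\<in>(UNIV :: 'k set). F (x i)))\<^sup>2 = (\<Prod>i\<in>(UNIV :: 'l set). cmod (F (x i)) ^ (CARD('k) * 2))"
      by (simp only: prod_constant prod_norm[symmetric] norm_power prod_power_distrib power_mult)
    then show "(\<Prod>i\<in>(UNIV :: 'l set). ennreal (cmod (F (x i)) ^ (2 * CARD('k))))
        = ennreal ((cmod (\<Prod>i\<in>(UNIV :: 'l set). \<Prod>j\<in>(UNIV :: 'k set). F (x i)))\<^sup>2)"
      by (simp only: prod_ennreal zero_le_power norm_ge_zero mult.commute[of 2])
  qed
  finally show ?thesis .
qed

text \<open>
  Multiplying out gives a trigonometric polynomial in \<open>t\<close> with frequencies \<open>|M| - |N|\<close>. Integration over a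
  period keeps the pairs of matrices on a common level.
\<close>

lemma finite_expansion_identity:
  fixes b :: "nat ^ 'd \<Rightarrow> complex"
  assumes A: "finite A" and off: "\<And>m. m \<notin> A \<Longrightarrow> b m = 0"
  shows "(\<integral>\<^sup>+t. (\<integral>\<^sup>+x. ennreal (cmod (hsum A (\<lambda>m. b m * phase t m) (lam CARD('k::finite)) x) ^ (2 * CARD('k))) \<partial>gauss) ^ CARD('l::finite) \<partial>period)
    = (\<Sum>S. ennreal (level_form S (mat_prod b :: nat ^ 'd ^ 'k ^ 'l \<Rightarrow> complex)))"
proof -
  let ?\<phi> = "mat_prod b :: nat ^ 'd ^ 'k ^ 'l \<Rightarrow> complex"
  let ?AA = "matrices_over A :: (nat ^ 'd ^ 'k ^ 'l) set"
  have fin: "finite ?AA" by (rule finite_matrices_over[OF A])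
  have off': "?\<phi> M = 0" if "M \<notin> ?AA" for M
    using that off unfolding mat_prod_def matrices_over_def by (auto intro!: prod_zero)
  have on: "M \<in> ?AA" if "?\<phi> M \<noteq> 0" for M using off' that by blast
  define c where "c t M = ?\<phi> M * wave (int (mat_abs M)) t" for t M
  define h where "h t = (\<integral>x. (cmod (\<Sum>M\<in>?AA. c t M * of_real (mat_Herm M x)))\<^sup>2 \<partial>gauss_rows)" for t
  have 1: "(\<integral>\<^sup>+x. ennreal (cmod (hsum A (\<lambda>m. b m * phase t m) (lam CARD('k)) x) ^ (2 * CARD('k))) \<partial>gauss) ^ CARD('l) = ennreal (h t)" for t
  proof -
    have "(\<Prod>i\<in>(UNIV :: 'l set). \<Prod>j\<in>(UNIV :: 'k set). hsum A (\<lambda>m. b m * phase t m) (lam CARD('k)) (x i))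
        = (\<Sum>M\<in>?AA. c t M * of_real (mat_Herm M x))" for x
      unfolding hsum_def prod_sum_matrices_over[OF A] c_def mat_prod_phase[symmetric]
      by (simp only: mat_prod_def mat_Herm_def of_real_prod prod.distrib[symmetric])
    then show ?thesis
      unfolding mixed_norm_power[where 'l='l and 'k='k, OF hsum_measurable] h_def
      by (simp only: nn_integral_eq_integral[OF integrable_mat_Herm_sum] zero_le_power2 AE_I2)
  qed
  have hC: "complex_of_real (h t) = (\<Sum>M\<in>?AA. \<Sum>N\<in>?AA. (?\<phi> M * cnj (?\<phi> N) * of_real (Pker M N)) * wave (int (mat_abs M) - int (mat_abs N)) t)" for t
    unfolding h_def integral_mat_Herm_sum c_def
    by (simp only: complex_cnj_mult cnj_wave diff_conv_add_uminus wave_add[symmetric] mult_ac)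
  have iC: "integrable period (\<lambda>t. complex_of_real (h t))"
    unfolding hC by (intro Bochner_Integration.integrable_sum integrable_mult_right integrable_wave)
  then have ih: "integrable period h" by (simp only: complex_of_real_integrable_eq)
  have h0: "h t \<ge> 0" for t unfolding h_def by simp
  have "complex_of_real (\<integral>t. h t \<partial>period) = (\<integral>t. of_real (h t) \<partial>period)" by (rule integral_complex_of_real[symmetric])
  also have "\<dots> = (\<Sum>M\<in>?AA. \<Sum>N\<in>?AA. (?\<phi> M * cnj (?\<phi> N) * of_real (Pker M N)) * (if int (mat_abs M) - int (mat_abs N) = 0 then 1 else 0))"
    unfolding hC by (simp add: Bochner_Integration.integral_sum integrable_wave integral_wave)
  also have "\<dots> = (\<Sum>M\<in>?AA. \<Sum>N\<in>{N \<in> ?AA. mat_abs N = mat_abs M}. ?\<phi> M * cnj (?\<phi> N) * of_real (Pker M N))"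
    using fin by (intro sum.cong refl sum.mono_neutral_cong_right) auto
  also have "\<dots> = (\<Sum>S\<in>mat_abs ` ?AA. \<Sum>M\<in>{M \<in> ?AA. mat_abs M = S}. \<Sum>N\<in>{N \<in> ?AA. mat_abs N = mat_abs M}. ?\<phi> M * cnj (?\<phi> N) * of_real (Pker M N))"
    by (rule sum.image_gen[OF fin])
  also have "\<dots> = (\<Sum>S\<in>mat_abs ` ?AA. complex_of_real (level_form S ?\<phi>))"
  proof (intro sum.cong refl)
    fix S
    have "complex_of_real (level_form S ?\<phi>) = (\<Sum>M | mat_abs M = S. \<Sum>N\<in>{N \<in> ?AA. mat_abs N = S}. ?\<phi> M * cnj (?\<phi> N) * of_real (Pker M N))"
      unfolding level_form_double_sum using off'
      by (intro sum.cong refl sum.mono_neutral_right) (auto simp: finite_level)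
    also have "\<dots> = (\<Sum>M\<in>{M \<in> ?AA. mat_abs M = S}. \<Sum>N\<in>{N \<in> ?AA. mat_abs N = S}. ?\<phi> M * cnj (?\<phi> N) * of_real (Pker M N))"
      using off' by (intro sum.mono_neutral_right) (auto simp: finite_level intro!: sum.neutral dest: on)
    finally have L: "complex_of_real (level_form S ?\<phi>) = (\<Sum>M\<in>{M \<in> ?AA. mat_abs M = S}. \<Sum>N\<in>{N \<in> ?AA. mat_abs N = S}. ?\<phi> M * cnj (?\<phi> N) * of_real (Pker M N))" .
    show "(\<Sum>M\<in>{M \<in> ?AA. mat_abs M = S}. \<Sum>N\<in>{N \<in> ?AA. mat_abs N = mat_abs M}. ?\<phi> M * cnj (?\<phi> N) * of_real (Pker M N))
        = complex_of_real (level_form S ?\<phi>)"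
      unfolding L by (rule sum.cong[OF refl]) auto
  qed
  finally have int: "(\<integral>t. h t \<partial>period) = (\<Sum>S\<in>mat_abs ` ?AA. level_form S ?\<phi>)"
    by (simp only: of_real_sum[symmetric] of_real_eq_iff)
  have zero: "level_form S ?\<phi> = 0" if "S \<notin> mat_abs ` ?AA" for S
  proof -
    have "complex_of_real (level_form S ?\<phi>) = 0"
      unfolding level_form_double_sum using off' that by (intro sum.neutral ballI) (auto simp: image_iff)
    then show ?thesis by simp
  qed
  have "(\<integral>\<^sup>+t. ennreal (h t) \<partial>period) = ennreal (\<integral>t. h t \<partial>period)"
    by (rule nn_integral_eq_integral[OF ih]) (simp add: h0)
  also have "\<dots> = (\<Sum>S\<in>mat_abs ` ?AA. ennreal (level_form S ?\<phi>))"
    unfolding int by (rule sum_ennreal[symmetric]) (rule level_form_nonneg)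
  also have "\<dots> = (\<Sum>S. ennreal (level_form S ?\<phi>))"
    by (rule suminf_finite[symmetric]) (use fin zero in auto)
  finally show ?thesis unfolding 1 .
qed

section \<open>Damped expansions\<close>

lemma level_form_tendsto:
  assumes "\<And>M. ((\<lambda>N. \<phi> N M) \<longlongrightarrow> \<psi> M) F"
  shows "((\<lambda>N. level_form S (\<phi> N)) \<longlongrightarrow> level_form S \<psi>) F"
  unfolding level_form_def level_coeff_def by (intro tendsto_intros assms) simp

lemma level_form_scale:
  assumes "\<And>M. mat_abs M = S \<Longrightarrow> \<phi> M = of_real c * \<psi> M"
  shows "level_form S \<phi> = c\<^sup>2 * level_form S \<psi>"
proof -
  have "level_coeff S \<phi> p = of_real c * level_coeff S \<psi> p" for p
    unfolding level_coeff_def sum_distrib_left using assms by (intro sum.cong) (auto simp: mult.assoc)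
  then show ?thesis
    unfolding level_form_def sum_distrib_left by (simp add: norm_mult power_mult_distrib)
qed

lemma level_part_inner: "Fock_inner (level_part S \<phi>) (Pop (level_part S \<phi>)) = of_real (level_form S \<phi>)"
proof -
  have "level_part S \<phi> \<in> Fock_level S" by (simp add: level_part_def Fock_level_def)
  then have "Fock_inner (level_part S \<phi>) (Pop (level_part S \<phi>)) = level_inner S (level_part S \<phi>) (Pop (level_part S \<phi>))"
    by (intro Fock_inner_level) simp
  also have "\<dots> = of_real (level_form S (level_part S \<phi>))" by (rule level_inner_Pop_self)
  also have "level_form S (level_part S \<phi>) = level_form S \<phi>"
    using level_form_scale[of S "level_part S \<phi>" 1 \<phi>] by (simp add: level_part_def)
  finally show ?thesis .
qed

lemma Pform_level: "Pform \<phi> = (\<Sum>S. ennreal (level_form S \<phi>))"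
  by (simp add: Pform_def level_part_inner)

text \<open>
  A family indexed by matrices is exhausted by boxes of matrices with entries in a finite set, and over a
  box the sum factors.
\<close>

lemma has_sum_mat_prod:
  fixes a :: "nat ^ 'd \<Rightarrow> real"
  assumes nn: "\<And>m. a m \<ge> 0" and s: "(a has_sum s) UNIV"
  shows "((\<lambda>M :: nat ^ 'd ^ 'k ^ 'l. \<Prod>i\<in>UNIV. \<Prod>j\<in>UNIV. a (M $ i $ j)) has_sum s ^ (CARD('k) * CARD('l))) UNIV"
proof -
  let ?n = "CARD('k) * CARD('l)"
  let ?p = "\<lambda>M :: nat ^ 'd ^ 'k ^ 'l. \<Prod>i\<in>UNIV. \<Prod>j\<in>UNIV. a (M $ i $ j)"
  have pn: "?p M \<ge> 0" for M using nn by (intro prod_nonneg) auto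
  have box: "sum ?p (matrices_over A) = sum a A ^ ?n" if "finite A" for A
    using prod_sum_matrices_over[where 'k='k and 'l='l and f="\<lambda>_ _. a", OF that] by (simp add: power_mult)
  have le_s: "sum a A \<le> s" if "finite A" for A
    using finite_sum_le_infsum[of a UNIV A] s that nn by (auto simp: has_sum_iff)
  have bd: "sum ?p F \<le> s ^ ?n" if F: "finite F" for F
  proof -
    define A where "A = (\<Union>M\<in>F. \<Union>i. \<Union>j. {M $ i $ j})"
    have A: "finite A" using F by (simp add: A_def)
    have "sum ?p F \<le> sum ?p (matrices_over A)"
      using pn by (intro sum_mono2 finite_matrices_over A) (auto simp: A_def matrices_over_def)
    also have "\<dots> \<le> s ^ ?n" unfolding box[OF A] using nn by (intro power_mono le_s A sum_nonneg) auto
    finally show ?thesis .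
  qed
  have summ: "?p summable_on UNIV"
    by (rule nonneg_bdd_above_summable_on) (auto intro!: pn bdd_aboveI2[where M = "s ^ ?n"] bd)
  have "infsum ?p UNIV \<le> s ^ ?n"
    by (rule infsum_le_finite_sums[OF summ]) (rule bd)
  moreover have "s ^ ?n \<le> infsum ?p UNIV"
  proof (rule tendsto_upperbound)
    show "((\<lambda>A. sum a A ^ ?n) \<longlongrightarrow> s ^ ?n) (finite_subsets_at_top UNIV)"
      using s unfolding has_sum_def by (intro tendsto_intros)
    have "sum a A ^ ?n \<le> infsum ?p UNIV" if "finite A" for A
      unfolding box[OF that, symmetric] using pn
      by (intro finite_sum_le_infsum summ finite_matrices_over that) auto
    then show "\<forall>\<^sub>F A in finite_subsets_at_top UNIV. sum a A ^ ?n \<le> infsum ?p UNIV"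
      by (intro eventually_finite_subsets_at_top_weakI) auto
  qed simp
  ultimately show ?thesis using summ by (auto simp: has_sum_iff)
qed

lemma mat_prod_norm: "(cmod (mat_prod \<alpha> M))\<^sup>2 * mat_fact M = (\<Prod>i\<in>UNIV. \<Prod>j\<in>UNIV. (cmod (\<alpha> (M $ i $ j)))\<^sup>2 * mi_fact (M $ i $ j))"
  by (simp only: mat_prod_def mat_fact_def prod_norm[symmetric] prod_power_distrib prod.distrib)

lemma mat_prod_Fock:
  fixes \<alpha> :: "nat ^ 'd \<Rightarrow> complex"
  assumes "((\<lambda>m. (cmod (\<alpha> m))\<^sup>2 * mi_fact m) has_sum s) UNIV"
  shows "((\<lambda>M :: nat ^ 'd ^ 'k ^ 'l. (cmod (mat_prod \<alpha> M))\<^sup>2 * mat_fact M) has_sum s ^ (CARD('k) * CARD('l))) UNIV"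
  unfolding mat_prod_norm
  by (rule has_sum_mat_prod[OF _ assms]) (auto intro!: mult_nonneg_nonneg less_imp_le[OF mi_fact_pos])

text \<open>
  These are the terms of the binomial series of \<open>(1 - \<rho>)\<^sup>-\<^sup>a\<close>.
\<close>

lemma pochhammer_geometric_bounded:
  fixes a \<rho> :: real
  assumes "a > 0" "0 \<le> \<rho>" "\<rho> < 1"
  shows "\<exists>C\<ge>0. \<forall>m. pochhammer a m / fact m * \<rho> ^ m \<le> C"
proof -
  let ?u = "\<lambda>m. pochhammer a m / fact m * \<rho> ^ m"
  have nn: "?u m \<ge> 0" for m using assms pochhammer_fact_pos[of a m] by (intro mult_nonneg_nonneg) auto
  have "(\<lambda>n. (- a gchoose n) * (- \<rho>) ^ n) sums (1 + - \<rho>) powr (- a)"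
    by (rule gen_binomial_real) (use assms in simp)
  moreover have "(- a gchoose n) * (- \<rho>) ^ n = ?u n" for n
  proof -
    have "(- 1) ^ n * (- 1) ^ n = (1 :: real)" by (simp flip: power_mult_distrib)
    moreover have "(e * p / f) * (e * r) = (e * e) * (p / f * r)" for e p f r :: real by simp
    moreover have "(- \<rho>) ^ n = (- 1) ^ n * \<rho> ^ n" by (rule power_minus)
    ultimately show ?thesis by (simp only: gbinomial_pochhammer minus_minus mult_1_left)
  qed
  ultimately have s: "summable ?u" by (simp add: sums_iff)
  have "?u m \<le> suminf ?u" for m
    using sum_le_suminf[OF s, of "{m}"] nn by simp
  moreover have "suminf ?u \<ge> 0" by (rule suminf_nonneg[OF s nn])
  ultimately show ?thesis by blast
qed

definition damped :: "real \<Rightarrow> nat \<Rightarrow> (nat ^ 'd \<Rightarrow> complex) \<Rightarrow> nat ^ 'd \<Rightarrow> complex" where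
  "damped \<rho> N \<alpha> m = (if mi_abs m \<le> N then of_real (\<rho> ^ mi_abs m) * \<alpha> m else 0)"

lemma mi_abs_le_mat_abs: "mi_abs (M $ i $ j) \<le> mat_abs M"
  unfolding mat_abs_def
  using member_le_sum[of i UNIV "\<lambda>i. \<Sum>j\<in>UNIV. mi_abs (M $ i $ j)"] member_le_sum[of j UNIV "\<lambda>j. mi_abs (M $ i $ j)"] by simp

lemma mat_prod_power: "mat_prod (\<lambda>m. of_real (\<rho> ^ mi_abs m) * \<alpha> m) M = of_real (\<rho> ^ mat_abs M) * mat_prod \<alpha> M"
  by (simp add: mat_prod_def prod.distrib mat_abs_def power_sum)

lemma mat_prod_damped:
  assumes "mat_abs M \<le> N"
  shows "mat_prod (damped \<rho> N \<alpha>) M = of_real (\<rho> ^ mat_abs M) * mat_prod \<alpha> M"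
proof -
  have "damped \<rho> N \<alpha> (M $ i $ j) = of_real (\<rho> ^ mi_abs (M $ i $ j)) * \<alpha> (M $ i $ j)" for i j
    using mi_abs_le_mat_abs[of M i j] assms by (simp add: damped_def)
  then show ?thesis unfolding mat_prod_power[symmetric] by (simp add: mat_prod_def)
qed

lemma mat_prod_damped_le:
  assumes "0 \<le> \<rho>"
  shows "cmod (mat_prod (damped \<rho> N \<alpha>) M) \<le> \<rho> ^ mat_abs M * cmod (mat_prod \<alpha> M)"
proof -
  have "cmod (mat_prod (damped \<rho> N \<alpha>) M) = (\<Prod>i\<in>UNIV. \<Prod>j\<in>UNIV. cmod (damped \<rho> N \<alpha> (M $ i $ j)))"
    by (simp only: mat_prod_def prod_norm)
  also have "\<dots> \<le> (\<Prod>i\<in>UNIV. \<Prod>j\<in>UNIV. cmod (of_real (\<rho> ^ mi_abs (M $ i $ j)) * \<alpha> (M $ i $ j)))"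
    using assms by (intro prod_mono conjI prod_nonneg) (auto simp: damped_def)
  also have "\<dots> = cmod (mat_prod (\<lambda>m. of_real (\<rho> ^ mi_abs m) * \<alpha> m) M)"
    by (simp only: mat_prod_def prod_norm)
  also have "\<dots> = \<rho> ^ mat_abs M * cmod (mat_prod \<alpha> M)"
    unfolding mat_prod_power using assms by (simp add: norm_mult norm_power)
  finally show ?thesis .
qed

text \<open>
  The order of the choices matters: \<open>n0\<close> makes the tail of the norm small, then \<open>\<rho>\<close> is taken so close to
  \<open>1\<close> that damping up to \<open>n0\<close> is harmless. Only then can the truncation \<open>N\<close> be chosen, because the
  constant \<open>C\<close> in the bound of the form on high levels depends on \<open>\<rho>\<close>.
\<close>

lemma damped_approximation:
  fixes \<alpha> :: "nat ^ 'd \<Rightarrow> complex"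
  assumes mu: "\<mu> = (real CARD('k::finite) - 1) * real CARD('l::finite) * real CARD('d::finite) / 2" and mu0: "\<mu> > 0"
    and s: "((\<lambda>m. (cmod (\<alpha> m))\<^sup>2 * mi_fact m) has_sum s) UNIV" and e: "\<epsilon> > 0"
  shows "\<exists>\<rho> N. (\<lambda>m. (cmod (\<alpha> m - damped \<rho> N \<alpha> m))\<^sup>2 * mi_fact m) summable_on UNIV \<and>
    (\<Sum>\<^sub>\<infinity>m. (cmod (\<alpha> m - damped \<rho> N \<alpha> m))\<^sup>2 * mi_fact m) \<le> \<epsilon> \<and>
    (\<Sum>S. ennreal (level_form S (mat_prod (damped \<rho> N \<alpha>) :: nat ^ 'd ^ 'k ^ 'l \<Rightarrow> complex)))
      \<le> (\<Sum>S. ennreal (level_form S (mat_prod \<alpha> :: nat ^ 'd ^ 'k ^ 'l \<Rightarrow> complex))) + ennreal \<epsilon>"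
proof -
  let ?a = "\<lambda>m. (cmod (\<alpha> m))\<^sup>2 * mi_fact m"
  have a0: "?a m \<ge> 0" for m by (auto intro!: mult_nonneg_nonneg less_imp_le[OF mi_fact_pos])
  have summ: "?a summable_on UNIV" and inf: "infsum ?a UNIV = s" using s by (auto simp: has_sum_iff)
  have "(\<lambda>N. hnorm2 (trunc N) \<alpha>) \<longlonglongrightarrow> s" using hnorm2_trunc_tendsto[OF summ] inf by simp
  then have "\<forall>\<^sub>F N in sequentially. s - \<epsilon> / 2 < hnorm2 (trunc N) \<alpha>"
    by (rule order_tendstoD) (use e in simp)
  from eventually_happens'[OF sequentially_bot this]
  obtain n0 where n0: "s - \<epsilon> / 2 < hnorm2 (trunc n0) \<alpha>" ..
  have "((\<lambda>\<rho>::real. (1 - \<rho> ^ n0)\<^sup>2 * s) \<longlongrightarrow> (1 - 1 ^ n0)\<^sup>2 * s) (at_left 1)"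
    by (intro tendsto_intros)
  then have "((\<lambda>\<rho>::real. (1 - \<rho> ^ n0)\<^sup>2 * s) \<longlongrightarrow> 0) (at_left 1)" by simp
  then have "\<forall>\<^sub>F \<rho>::real in at_left 1. (1 - \<rho> ^ n0)\<^sup>2 * s < \<epsilon> / 2"
    by (rule order_tendstoD) (use e in simp)
  moreover have "\<forall>\<^sub>F \<rho>::real in at_left 1. \<rho> \<in> {0<..<1}"
    by (rule eventually_at_left_real) simp
  ultimately have "\<forall>\<^sub>F \<rho>::real in at_left 1. (1 - \<rho> ^ n0)\<^sup>2 * s < \<epsilon> / 2 \<and> \<rho> \<in> {0<..<1}"
    by (rule eventually_conj)
  from eventually_happens'[OF trivial_limit_at_left_real this]
  obtain \<rho> :: real where "(1 - \<rho> ^ n0)\<^sup>2 * s < \<epsilon> / 2 \<and> \<rho> \<in> {0<..<1}" ..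
  then have r: "(1 - \<rho> ^ n0)\<^sup>2 * s < \<epsilon> / 2" "0 < \<rho>" "\<rho> < 1" by simp_all
  let ?d = "\<lambda>N m. (cmod (\<alpha> m - damped \<rho> N \<alpha> m))\<^sup>2 * mi_fact m"
  have cm: "(cmod (\<alpha> m - damped \<rho> N \<alpha> m))\<^sup>2 \<le> (if mi_abs m \<le> n0 then (1 - \<rho> ^ n0)\<^sup>2 else 1) * (cmod (\<alpha> m))\<^sup>2" if "N \<ge> n0" for N m
  proof (cases "mi_abs m \<le> N")
    case True
    have "\<alpha> m - damped \<rho> N \<alpha> m = of_real (1 - \<rho> ^ mi_abs m) * \<alpha> m"
      using True by (simp add: damped_def algebra_simps)
    then have eq: "(cmod (\<alpha> m - damped \<rho> N \<alpha> m))\<^sup>2 = (1 - \<rho> ^ mi_abs m)\<^sup>2 * (cmod (\<alpha> m))\<^sup>2"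
      by (simp only: norm_mult norm_of_real power_mult_distrib power2_abs)
    have p1: "\<rho> ^ mi_abs m \<le> 1" "0 \<le> \<rho> ^ mi_abs m" using r by (auto intro: power_le_one)
    show ?thesis
    proof (cases "mi_abs m \<le> n0")
      case True
      then have "\<rho> ^ n0 \<le> \<rho> ^ mi_abs m" using r by (intro power_decreasing) auto
      then have "(1 - \<rho> ^ mi_abs m)\<^sup>2 \<le> (1 - \<rho> ^ n0)\<^sup>2" using p1 by (intro power_mono) auto
      then show ?thesis unfolding eq using True by (simp add: mult_right_mono)
    next
      case False
      have "(1 - \<rho> ^ mi_abs m)\<^sup>2 \<le> 1" using p1 by (intro power_le_one) auto
      then have "(1 - \<rho> ^ mi_abs m)\<^sup>2 * (cmod (\<alpha> m))\<^sup>2 \<le> 1 * (cmod (\<alpha> m))\<^sup>2" by (rule mult_right_mono) simp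
      then show ?thesis unfolding eq using False by simp
    qed
  next
    case False
    then show ?thesis using that by (simp add: damped_def)
  qed
  have dle: "?d N m \<le> (if mi_abs m \<le> n0 then (1 - \<rho> ^ n0)\<^sup>2 else 1) * ?a m" if "N \<ge> n0" for N m
    using mult_right_mono[OF cm[OF that] less_imp_le[OF mi_fact_pos]] by (simp only: mult.assoc)
  have d0: "?d N m \<ge> 0" for N m by (auto intro!: mult_nonneg_nonneg less_imp_le[OF mi_fact_pos])
  have fin_le: "sum (?d N) F \<le> \<epsilon>" if N: "N \<ge> n0" and F: "finite F" for N F
  proof -
    let ?B = "trunc n0 :: (nat ^ 'd) set"
    have "sum (?d N) F \<le> (\<Sum>m\<in>F. (if m \<in> ?B then (1 - \<rho> ^ n0)\<^sup>2 else 1) * ?a m)"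
      using dle[OF N] by (intro sum_mono) (simp add: trunc_def)
    also have "\<dots> \<le> (\<Sum>m\<in>F \<union> ?B. (if m \<in> ?B then (1 - \<rho> ^ n0)\<^sup>2 else 1) * ?a m)"
      using F a0 finite_trunc by (intro sum_mono2) auto
    also have "\<dots> = (\<Sum>m\<in>?B. (1 - \<rho> ^ n0)\<^sup>2 * ?a m) + (\<Sum>m\<in>F - ?B. ?a m)"
    proof -
      have "F \<union> ?B = ?B \<union> (F - ?B)" by auto
      then have "(\<Sum>m\<in>F \<union> ?B. (if m \<in> ?B then (1 - \<rho> ^ n0)\<^sup>2 else 1) * ?a m)
          = (\<Sum>m\<in>?B. (if m \<in> ?B then (1 - \<rho> ^ n0)\<^sup>2 else 1) * ?a m) + (\<Sum>m\<in>F - ?B. (if m \<in> ?B then (1 - \<rho> ^ n0)\<^sup>2 else 1) * ?a m)"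
        using sum.union_disjoint[OF finite_trunc finite_Diff[OF F] Diff_disjoint] by (simp only:)
      moreover have "(\<Sum>m\<in>?B. (if m \<in> ?B then (1 - \<rho> ^ n0)\<^sup>2 else 1) * ?a m) = (\<Sum>m\<in>?B. (1 - \<rho> ^ n0)\<^sup>2 * ?a m)"
        by (rule sum.cong) auto
      moreover have "(\<Sum>m\<in>F - ?B. (if m \<in> ?B then (1 - \<rho> ^ n0)\<^sup>2 else 1) * ?a m) = (\<Sum>m\<in>F - ?B. ?a m)"
        by (rule sum.cong) auto
      ultimately show ?thesis by (simp only:)
    qed
    also have "(\<Sum>m\<in>?B. (1 - \<rho> ^ n0)\<^sup>2 * ?a m) = (1 - \<rho> ^ n0)\<^sup>2 * hnorm2 ?B \<alpha>"
      by (simp add: hnorm2_def sum_distrib_left)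
    also have "(1 - \<rho> ^ n0)\<^sup>2 * hnorm2 ?B \<alpha> \<le> (1 - \<rho> ^ n0)\<^sup>2 * s"
      using hnorm2_le_infsum[OF summ finite_trunc] inf by (intro mult_left_mono) auto
    also have "(\<Sum>m\<in>F - ?B. ?a m) \<le> \<epsilon> / 2"
    proof -
      have "(\<Sum>m\<in>F - ?B. ?a m) + hnorm2 ?B \<alpha> = (\<Sum>m\<in>F \<union> ?B. ?a m)"
        unfolding hnorm2_def using F finite_trunc by (subst sum.union_disjoint[symmetric]) auto
      also have "\<dots> \<le> s" using hnorm2_le_infsum[OF summ, of "F \<union> ?B"] F inf by (simp add: hnorm2_def finite_trunc)
      finally show ?thesis using n0 by linarith
    qed
    finally show ?thesis using r(1) by linarith
  qed
  have dsum: "?d N summable_on UNIV" if "N \<ge> n0" for N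
  proof (rule nonneg_bdd_above_summable_on[OF d0])
    show "bdd_above (sum (?d N) ` {F. F \<subseteq> UNIV \<and> finite F})"
      by (rule bdd_aboveI2[where M = \<epsilon>], rule fin_le[OF that]) simp
  qed
  have dinf: "infsum (?d N) UNIV \<le> \<epsilon>" if "N \<ge> n0" for N
    by (rule infsum_le_finite_sums[OF dsum[OF that]]) (rule fin_le[OF that])
  let ?\<phi> = "mat_prod \<alpha> :: nat ^ 'd ^ 'k ^ 'l \<Rightarrow> complex"
  let ?\<psi> = "\<lambda>N. mat_prod (damped \<rho> N \<alpha>) :: nat ^ 'd ^ 'k ^ 'l \<Rightarrow> complex"
  let ?L = "\<lambda>S. pochhammer (\<mu> + 1) (S div 2) / fact (S div 2)"
  obtain C where C: "C \<ge> 0" "\<And>m. pochhammer (\<mu> + 1) m / fact m * \<rho> ^ m \<le> C"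
    using pochhammer_geometric_bounded[of "\<mu> + 1" \<rho>] mu0 r by auto
  have Lpos: "?L S > 0" for S using mu0 by (intro pochhammer_fact_pos) simp
  have LC: "?L S * (\<rho> ^ S)\<^sup>2 \<le> C" for S
  proof -
    have "(\<rho> ^ S)\<^sup>2 \<le> \<rho> ^ (S div 2)"
      unfolding power_mult[symmetric] using r by (intro power_decreasing) auto
    then have "?L S * (\<rho> ^ S)\<^sup>2 \<le> ?L S * \<rho> ^ (S div 2)" using Lpos[of S] by (intro mult_left_mono) auto
    then show ?thesis using C(2)[of "S div 2"] by linarith
  qed
  have high: "level_form S (?\<psi> N) \<le> C * level_norm2 S ?\<phi>" for S N
  proof -
    have damp: "level_norm2 S (?\<psi> N) \<le> (\<rho> ^ S)\<^sup>2 * level_norm2 S ?\<phi>"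
      unfolding level_norm2_def sum_distrib_left
    proof (intro sum_mono)
      fix M :: "nat ^ 'd ^ 'k ^ 'l" assume "M \<in> {M. mat_abs M = S}"
      then have "(cmod (?\<psi> N M))\<^sup>2 \<le> (\<rho> ^ S * cmod (?\<phi> M))\<^sup>2"
        using mat_prod_damped_le[of \<rho> N \<alpha> M] r by (intro power_mono) auto
      then have "(cmod (?\<psi> N M))\<^sup>2 * mat_fact M \<le> (\<rho> ^ S * cmod (?\<phi> M))\<^sup>2 * mat_fact M"
        using mat_fact_pos[of M] by (intro mult_right_mono) auto
      then show "(cmod (?\<psi> N M))\<^sup>2 * mat_fact M \<le> (\<rho> ^ S)\<^sup>2 * ((cmod (?\<phi> M))\<^sup>2 * mat_fact M)"
        by (simp only: power_mult_distrib mult.assoc)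
    qed
    have "level_form S (?\<psi> N) \<le> ?L S * level_norm2 S (?\<psi> N)"
      by (rule level_form_le[OF mu level_eigenvalue_le_shifted[OF mu0] Lpos])
    also have "\<dots> \<le> ?L S * ((\<rho> ^ S)\<^sup>2 * level_norm2 S ?\<phi>)"
      by (rule mult_left_mono[OF damp less_imp_le[OF Lpos]])
    also have "?L S * ((\<rho> ^ S)\<^sup>2 * level_norm2 S ?\<phi>) = (?L S * (\<rho> ^ S)\<^sup>2) * level_norm2 S ?\<phi>" by simp
    also have "\<dots> \<le> C * level_norm2 S ?\<phi>" by (intro mult_right_mono LC level_norm2_nonneg)
    finally show ?thesis .
  qed
  have low: "level_form S (?\<psi> N) \<le> level_form S ?\<phi>" if "S \<le> N" for S N
  proof -
    have "level_form S (?\<psi> N) = (\<rho> ^ S)\<^sup>2 * level_form S ?\<phi>"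
      by (rule level_form_scale) (use that in \<open>simp add: mat_prod_damped\<close>)
    moreover have "(\<rho> ^ S)\<^sup>2 \<le> 1" using r by (intro power_le_one) (auto intro: power_le_one)
    ultimately show ?thesis using mult_right_mono[of "(\<rho> ^ S)\<^sup>2" 1 "level_form S ?\<phi>"] level_form_nonneg[of S ?\<phi>] by simp
  qed
  have Fs: "summable (\<lambda>S. C * level_norm2 S ?\<phi>)"
  proof -
    have "?\<phi> \<in> Fock"
      unfolding Fock_def mem_Collect_eq by (rule has_sum_imp_summable[OF mat_prod_Fock[OF s]])
    then show ?thesis unfolding Fock_iff by (rule summable_mult)
  qed
  have "(\<lambda>n. \<Sum>S. C * level_norm2 (S + n) ?\<phi>) \<longlonglongrightarrow> 0"
    by (rule suminf_exist_split2[OF Fs])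
  then have "\<forall>\<^sub>F n in sequentially. (\<Sum>S. C * level_norm2 (S + n) ?\<phi>) < \<epsilon>"
    by (rule order_tendstoD) (use e in simp)
  then obtain N1 where N1: "\<And>n. n \<ge> N1 \<Longrightarrow> (\<Sum>S. C * level_norm2 (S + n) ?\<phi>) < \<epsilon>"
    by (auto simp: eventually_sequentially)
  define N where "N = max n0 N1"
  have "(\<Sum>S. ennreal (level_form S (?\<psi> N))) = (\<Sum>S<Suc N. ennreal (level_form S (?\<psi> N))) + (\<Sum>S. ennreal (level_form (S + Suc N) (?\<psi> N)))"
    using suminf_offset[of "\<lambda>S. ennreal (level_form S (?\<psi> N))" "Suc N"] by (simp add: add.commute)
  also have "\<dots> \<le> (\<Sum>S. ennreal (level_form S ?\<phi>)) + ennreal \<epsilon>"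
  proof (rule add_mono)
    have "(\<Sum>S<Suc N. ennreal (level_form S (?\<psi> N))) \<le> (\<Sum>S<Suc N. ennreal (level_form S ?\<phi>))"
      by (intro sum_mono ennreal_leI low) auto
    also have "\<dots> \<le> (\<Sum>S. ennreal (level_form S ?\<phi>))" by (intro sum_le_suminf) auto
    finally show "(\<Sum>S<Suc N. ennreal (level_form S (?\<psi> N))) \<le> (\<Sum>S. ennreal (level_form S ?\<phi>))" .
    have "(\<Sum>S. ennreal (level_form (S + Suc N) (?\<psi> N))) \<le> (\<Sum>S. ennreal (C * level_norm2 (S + Suc N) ?\<phi>))"
      by (intro suminf_le ennreal_leI high) auto
    also have "\<dots> = ennreal (\<Sum>S. C * level_norm2 (S + Suc N) ?\<phi>)"
      by (intro suminf_ennreal2 mult_nonneg_nonneg C(1) level_norm2_nonneg summable_ignore_initial_segment[OF Fs])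
    also have "\<dots> \<le> ennreal \<epsilon>"
      using N1[of "Suc N"] by (intro ennreal_leI less_imp_le) (simp add: N_def)
    finally show "(\<Sum>S. ennreal (level_form (S + Suc N) (?\<psi> N))) \<le> ennreal \<epsilon>" .
  qed
  finally show ?thesis using dsum[of N] dinf[of N] by (intro exI[of _ \<rho>] exI[of _ N] conjI) (auto simp: N_def)
qed

section \<open>The mixed norm is at most the quadratic form\<close>

lemma measurable_hsum_phase:
  "(\<lambda>p. hsum A (\<lambda>m. b m * phase (fst p) m) c (snd p)) \<in> borel_measurable (period \<Otimes>\<^sub>M gauss)"
proof -
  have w: "(\<lambda>p. wave n (fst p)) \<in> borel_measurable (period \<Otimes>\<^sub>M gauss)" for n
    by (rule measurable_compose[OF measurable_fst measurable_period[OF borel_measurable_wave]])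
  have h: "(\<lambda>p. complex_of_real (Herm m (c *\<^sub>R snd p))) \<in> borel_measurable (period \<Otimes>\<^sub>M gauss)" for m
    by (rule measurable_compose[OF measurable_snd L2_measurable[OF Herm_L2]])
  show ?thesis
    unfolding hsum_def phase_wave
    by (intro borel_measurable_sum borel_measurable_times borel_measurable_const w h)
qed

lemma sigma_finite_gauss: "sigma_finite_measure (gauss :: (real ^ 'd::finite) measure)"
  by (rule prob_space_imp_sigma_finite[OF prob_space_gauss])

lemma lam_card_bounds: "0 < lam CARD('k::finite)" "lam CARD('k) \<le> 1"
  by (rule lam_bounds, simp add: Suc_le_eq)+

lemma card_ge_1: "CARD('k::finite) \<ge> 1"
  by (simp add: Suc_le_eq)

text \<open>
  Fatou's lemma in space, and again in time, along a sequence of damped expansions that converges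
  almost everywhere in space for every \<open>t\<close>.
\<close>

lemma mixed_norm_le_forms:
  fixes g :: "real ^ 'd \<Rightarrow> complex"
  assumes mu: "\<mu> = (real CARD('k::finite) - 1) * real CARD('l::finite) * real CARD('d::finite) / 2" and mu0: "\<mu> > 0"
    and g: "g \<in> L2 gauss" and e: "has_hermite_expansion g \<alpha>"
  shows "(\<integral>\<^sup>+t. (\<integral>\<^sup>+x. ennreal (cmod (Hop CARD('k) t g x) ^ (2 * CARD('k))) \<partial>gauss) ^ CARD('l) \<partial>period)
    \<le> (\<Sum>S. ennreal (level_form S (mat_prod \<alpha> :: nat ^ 'd ^ 'k ^ 'l \<Rightarrow> complex)))"
proof -
  let ?k = "CARD('k)"
  let ?P = "\<Sum>S. ennreal (level_form S (mat_prod \<alpha> :: nat ^ 'd ^ 'k ^ 'l \<Rightarrow> complex))"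
  let ?K = "(1 / lam ?k) ^ CARD('d)"
  define Q where "Q j b N \<longleftrightarrow> (\<forall>m. m \<notin> trunc N \<longrightarrow> b m = 0) \<and> (\<lambda>m. (cmod (\<alpha> m - b m))\<^sup>2 * mi_fact m) summable_on UNIV \<and>
    (\<Sum>\<^sub>\<infinity>m. (cmod (\<alpha> m - b m))\<^sup>2 * mi_fact m) \<le> (1 / 4) ^ j \<and>
    (\<Sum>S. ennreal (level_form S (mat_prod b :: nat ^ 'd ^ 'k ^ 'l \<Rightarrow> complex))) \<le> ?P + ennreal ((1 / 4) ^ j)" for j b N
  have "\<exists>p. Q j (fst p) (snd p)" for j
  proof -
    have "(1 / 4 :: real) ^ j > 0" by simp
    from damped_approximation[OF mu mu0 Parseval[OF g e] this] obtain \<rho> N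
      where *: "(\<lambda>m. (cmod (\<alpha> m - damped \<rho> N \<alpha> m))\<^sup>2 * mi_fact m) summable_on UNIV"
        "(\<Sum>\<^sub>\<infinity>m. (cmod (\<alpha> m - damped \<rho> N \<alpha> m))\<^sup>2 * mi_fact m) \<le> (1 / 4) ^ j"
        "(\<Sum>S. ennreal (level_form S (mat_prod (damped \<rho> N \<alpha>) :: nat ^ 'd ^ 'k ^ 'l \<Rightarrow> complex))) \<le> ?P + ennreal ((1 / 4) ^ j)"
      by blast
    have "\<forall>m. m \<notin> trunc N \<longrightarrow> damped \<rho> N \<alpha> m = 0" by (simp add: trunc_def damped_def)
    with * have "Q j (fst (damped \<rho> N \<alpha>, N)) (snd (damped \<rho> N \<alpha>, N))"
      unfolding Q_def fst_conv snd_conv by (intro conjI)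
    then show ?thesis ..
  qed
  then have "\<forall>j. \<exists>p. Q j (fst p) (snd p)" ..
  from choice[OF this] obtain p where p: "\<And>j. Q j (fst (p j)) (snd (p j))" by blast
  define b where "b j = fst (p j)" for j
  define N where "N j = snd (p j)" for j
  have off: "\<And>j m. m \<notin> trunc (N j) \<Longrightarrow> b j m = 0"
    and s: "\<And>j. (\<lambda>m. (cmod (\<alpha> m - b j m))\<^sup>2 * mi_fact m) summable_on UNIV"
    and le: "\<And>j. (\<Sum>\<^sub>\<infinity>m. (cmod (\<alpha> m - b j m))\<^sup>2 * mi_fact m) \<le> (1 / 4) ^ j"
    and form: "\<And>j. (\<Sum>S. ennreal (level_form S (mat_prod (b j) :: nat ^ 'd ^ 'k ^ 'l \<Rightarrow> complex))) \<le> ?P + ennreal ((1 / 4) ^ j)"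
    using p unfolding Q_def b_def[symmetric] N_def[symmetric] by blast+
  define V where "V j t = hsum (trunc (N j)) (\<lambda>m. b j m * phase t m) (lam ?k)" for j t
  define I where "I f = (\<integral>\<^sup>+x. ennreal (cmod (f x) ^ (2 * ?k)) \<partial>gauss)" for f :: "real ^ 'd \<Rightarrow> complex"
  interpret G: sigma_finite_measure "gauss :: (real ^ 'd) measure" by (rule sigma_finite_gauss)
  have "(\<lambda>z. ennreal (cmod z ^ (2 * ?k))) \<in> borel_measurable borel" by measurable
  from measurable_compose[OF measurable_hsum_phase this]
  have "(\<lambda>(t, x). ennreal (cmod (V j t x) ^ (2 * ?k))) \<in> borel_measurable (period \<Otimes>\<^sub>M gauss)" for j
    unfolding V_def case_prod_unfold .
  then have IV: "(\<lambda>t. I (V j t)) \<in> borel_measurable period" for j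
    unfolding I_def by (rule G.borel_measurable_nn_integral)
  have conv: "AE x in gauss. (\<lambda>j. V j t x) \<longlonglongrightarrow> Hop ?k t g x" for t
    unfolding V_def
  proof (rule AE_tendsto_of_sqnorm[OF Hop_L2[OF card_ge_1 g] hsum_L2])
    fix j
    have "sqnorm gauss (\<lambda>x. Hop ?k t g x - hsum (trunc (N j)) (\<lambda>m. b j m * phase t m) (lam ?k) x)
        \<le> ?K * (\<Sum>\<^sub>\<infinity>m. (cmod (\<alpha> m - b j m))\<^sup>2 * mi_fact m)"
      by (rule Hop_approx[OF card_ge_1 g e finite_trunc off s])
    also have "\<dots> \<le> ?K * (1 / 4) ^ j"
      using lam_card_bounds(1)[where 'k='k] by (intro mult_left_mono le) auto
    finally show "sqnorm gauss (\<lambda>x. Hop ?k t g x - hsum (trunc (N j)) (\<lambda>m. b j m * phase t m) (lam ?k) x) \<le> ?K * (1 / 4) ^ j" .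
  qed
  have Fatou_x: "I (Hop ?k t g) \<le> liminf (\<lambda>j. I (V j t))" for t
  proof -
    have "I (Hop ?k t g) = (\<integral>\<^sup>+x. liminf (\<lambda>j. ennreal (cmod (V j t x) ^ (2 * ?k))) \<partial>gauss)"
      unfolding I_def
    proof (rule nn_integral_cong_AE, use conv[of t] in eventually_elim)
      case (elim x)
      then have "(\<lambda>j. ennreal (cmod (V j t x) ^ (2 * ?k))) \<longlonglongrightarrow> ennreal (cmod (Hop ?k t g x) ^ (2 * ?k))"
        by (intro tendsto_intros)
      from lim_imp_Liminf[OF _ this] show ?case by simp
    qed
    also have "\<dots> \<le> liminf (\<lambda>j. I (V j t))"
      unfolding I_def by (rule nn_integral_liminf) (simp add: V_def)
    finally show ?thesis .
  qed
  have "(\<integral>\<^sup>+t. I (Hop ?k t g) ^ CARD('l) \<partial>period) \<le> (\<integral>\<^sup>+t. liminf (\<lambda>j. I (V j t) ^ CARD('l)) \<partial>period)"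
    by (intro nn_integral_mono order_trans[OF power_mono[OF Fatou_x] power_liminf_le]) simp
  also have "\<dots> \<le> liminf (\<lambda>j. \<integral>\<^sup>+t. I (V j t) ^ CARD('l) \<partial>period)"
    by (rule nn_integral_liminf) (rule measurable_compose[OF IV], measurable)
  also have "\<dots> \<le> liminf (\<lambda>j. ?P + ennreal ((1 / 4) ^ j))"
  proof (intro Liminf_mono always_eventually allI)
    fix j
    have "(\<integral>\<^sup>+t. I (V j t) ^ CARD('l) \<partial>period) = (\<Sum>S. ennreal (level_form S (mat_prod (b j) :: nat ^ 'd ^ 'k ^ 'l \<Rightarrow> complex)))"
      unfolding I_def V_def by (rule finite_expansion_identity[OF finite_trunc off])
    then show "(\<integral>\<^sup>+t. I (V j t) ^ CARD('l) \<partial>period) \<le> ?P + ennreal ((1 / 4) ^ j)" using form[of j] by simp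
  qed
  also have "\<dots> = ?P"
  proof -
    have "(\<lambda>j. (1 / 4 :: real) ^ j) \<longlonglongrightarrow> 0" by (rule LIMSEQ_power_zero) simp
    then have "(\<lambda>j. ?P + ennreal ((1 / 4) ^ j)) \<longlonglongrightarrow> ?P + ennreal 0"
      by (intro tendsto_add tendsto_const tendsto_ennrealI)
    from lim_imp_Liminf[OF _ this] show ?thesis by simp
  qed
  finally show ?thesis unfolding I_def .
qed

lemma nn_integral_le_of_sqnorm:
  assumes P: "prob_space M" and f: "f \<in> L2 M" and le: "sqnorm M f \<le> d\<^sup>2" and d: "d > 0"
  shows "(\<integral>\<^sup>+x. ennreal (cmod (f x)) \<partial>M) \<le> ennreal (2 * d)"
proof -
  interpret prob_space M by (rule P)
  have [measurable]: "f \<in> borel_measurable M" by (rule L2_measurable[OF f])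
  have "cmod (f x) \<le> d + (1 / d) * (cmod (f x))\<^sup>2" for x
  proof (cases "cmod (f x) \<le> d")
    case False
    then have "d * cmod (f x) \<le> cmod (f x) * cmod (f x)" by (intro mult_right_mono) auto
    then have "cmod (f x) \<le> (1 / d) * (cmod (f x))\<^sup>2" using d by (simp add: field_simps power2_eq_square)
    then show ?thesis using d by linarith
  qed (use d in \<open>simp add: add_increasing2\<close>)
  then have "(\<integral>\<^sup>+x. ennreal (cmod (f x)) \<partial>M) \<le> (\<integral>\<^sup>+x. ennreal d + ennreal (1 / d) * ennreal ((cmod (f x))\<^sup>2) \<partial>M)"
    using d by (intro nn_integral_mono) (simp add: ennreal_mult[symmetric] ennreal_plus[symmetric] ennreal_leI del: ennreal_plus)
  also have "\<dots> = ennreal d + ennreal (1 / d) * ennreal (sqnorm M f)"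
    by (simp add: nn_integral_add nn_integral_cmult nn_integral_sqnorm[OF f] emeasure_space_1)
  also have "\<dots> \<le> ennreal d + ennreal (1 / d) * ennreal (d\<^sup>2)"
    using le by (intro add_mono mult_left_mono ennreal_leI) auto
  also have "\<dots> = ennreal (2 * d)"
    using d by (simp add: ennreal_mult[symmetric] ennreal_plus[symmetric] power2_eq_square del: ennreal_plus)
  finally show ?thesis .
qed

definition Fejer_weight :: "nat \<Rightarrow> nat \<Rightarrow> real" where
  "Fejer_weight N n = real (N - n) / real N"

lemma Fejer_weight_tendsto: "(\<lambda>N. Fejer_weight N n) \<longlonglongrightarrow> 1"
proof (rule Lim_transform_eventually)
  show "(\<lambda>N. 1 - real n / real N) \<longlonglongrightarrow> 1" by real_asymp
  show "\<forall>\<^sub>F N in sequentially. 1 - real n / real N = Fejer_weight N n"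
    using eventually_gt_at_top[of n] by eventually_elim (simp add: Fejer_weight_def of_nat_diff diff_divide_distrib)
qed

text \<open>
  The Fejer mean in time of a partial sum is independent of the partial sum once this is long enough.
\<close>

lemma hsum_Fejer:
  fixes \<alpha> :: "nat ^ 'd \<Rightarrow> complex"
  assumes "N \<le> n"
  shows "hsum (trunc N) (\<lambda>m. (of_real (Fejer_weight N (mi_abs m)) * \<alpha> m) * phase t m) c x
    = (\<integral>r. of_real (Fejer N (t - r)) * hsum (trunc n) (\<lambda>m. \<alpha> m * phase r m) c x \<partial>period)"
proof -
  let ?a = "\<lambda>m. \<alpha> m * of_real (Herm m (c *\<^sub>R x))"
  have e: "of_real (Fejer N (t - r)) * hsum (trunc n) (\<lambda>m. \<alpha> m * phase r m) c x
      = (\<Sum>m\<in>trunc n. ?a m * (of_real (Fejer N (t - r)) * wave (int (mi_abs m)) r))" for r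
    by (simp add: hsum_def phase_wave sum_distrib_left mult_ac)
  have "(\<integral>r. of_real (Fejer N (t - r)) * hsum (trunc n) (\<lambda>m. \<alpha> m * phase r m) c x \<partial>period)
      = (\<Sum>m\<in>trunc n. ?a m * (of_real (Fejer_weight N (mi_abs m)) * phase t m))"
    unfolding e unfolding phase_wave
    by (subst Bochner_Integration.integral_sum) (simp_all only: integrable_mult_right Fejer_convolution_wave integral_mult_right_zero Fejer_weight_def)
  also have "\<dots> = (\<Sum>m\<in>trunc N. ?a m * (of_real (Fejer_weight N (mi_abs m)) * phase t m))"
    by (rule sum.mono_neutral_right[OF finite_trunc trunc_mono[OF assms]])
       (auto simp: trunc_def Fejer_weight_def)
  finally show ?thesis by (simp add: hsum_def mult_ac)
qed

section \<open>The quadratic form is at most the mixed norm\<close>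

lemma tail_approximation:
  fixes \<alpha> :: "nat ^ 'd \<Rightarrow> complex"
  assumes s: "((\<lambda>m. (cmod (\<alpha> m))\<^sup>2 * mi_fact m) has_sum s) UNIV"
  defines "b \<equiv> \<lambda>n m. if m \<in> trunc n then \<alpha> m else 0"
  shows "(\<lambda>m. (cmod (\<alpha> m - b n m))\<^sup>2 * mi_fact m) summable_on UNIV"
    and "(\<Sum>\<^sub>\<infinity>m. (cmod (\<alpha> m - b n m))\<^sup>2 * mi_fact m) \<le> s - hnorm2 (trunc n) \<alpha>"
proof -
  let ?d = "\<lambda>m. (cmod (\<alpha> m - b n m))\<^sup>2 * mi_fact m"
  have summ: "(\<lambda>m. (cmod (\<alpha> m))\<^sup>2 * mi_fact m) summable_on UNIV" and inf: "(\<Sum>\<^sub>\<infinity>m. (cmod (\<alpha> m))\<^sup>2 * mi_fact m) = s"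
    using s by (auto simp: has_sum_iff)
  have d0: "?d m \<ge> 0" for m by (auto intro!: mult_nonneg_nonneg less_imp_le[OF mi_fact_pos])
  have le: "sum ?d F \<le> s - hnorm2 (trunc n) \<alpha>" if F: "finite F" for F
  proof -
    have "sum ?d F = hnorm2 (F - trunc n) \<alpha>"
      unfolding hnorm2_def using F by (intro sum.mono_neutral_cong_right) (auto simp: b_def)
    also have "F - trunc n = (F \<union> trunc n) - trunc n" by auto
    also have "hnorm2 ((F \<union> trunc n) - trunc n) \<alpha> = hnorm2 (F \<union> trunc n) \<alpha> - hnorm2 (trunc n) \<alpha>"
      by (rule hnorm2_diff) (auto simp: F finite_trunc)
    also have "hnorm2 (F \<union> trunc n) \<alpha> \<le> s"
      using hnorm2_le_infsum[OF summ, of "F \<union> trunc n"] F inf by (simp add: finite_trunc)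
    finally show ?thesis by simp
  qed
  show 1: "?d summable_on UNIV"
  proof (rule nonneg_bdd_above_summable_on[OF d0])
    show "bdd_above (sum ?d ` {F. F \<subseteq> UNIV \<and> finite F})"
      by (rule bdd_aboveI2[where M = "s - hnorm2 (trunc n) \<alpha>"], rule le) simp
  qed
  show "infsum ?d UNIV \<le> s - hnorm2 (trunc n) \<alpha>"
    by (rule infsum_le_finite_sums[OF 1]) (rule le)
qed

text \<open>
  The values of \<open>Hop k t g\<close> for different \<open>t\<close> are representatives chosen independently of each
  other. They are replaced by the pointwise limit \<open>W\<close> of partial sums, which is jointly measurable and equals \<open>Hop k t g\<close> almost
  everywhere for each \<open>t\<close>.
\<close>

lemma forms_le_mixed_norm:
  fixes g :: "real ^ 'd \<Rightarrow> complex"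
  assumes g: "g \<in> L2 gauss" and e: "has_hermite_expansion g \<alpha>"
  shows "(\<Sum>S. ennreal (level_form S (mat_prod \<alpha> :: nat ^ 'd ^ 'k ^ 'l \<Rightarrow> complex)))
    \<le> (\<integral>\<^sup>+t. (\<integral>\<^sup>+x. ennreal (cmod (Hop CARD('k::finite) t g x) ^ (2 * CARD('k))) \<partial>gauss) ^ CARD('l::finite) \<partial>period)"
proof -
  let ?k = "CARD('k)"
  let ?c = "lam CARD('k)"
  let ?K = "(1 / ?c) ^ CARD('d)"
  let ?T = "\<lambda>t. Hop ?k t g"
  interpret G: sigma_finite_measure "gauss :: (real ^ 'd) measure" by (rule sigma_finite_gauss)
  interpret T: sigma_finite_measure period by (rule prob_space_imp_sigma_finite[OF prob_space_period])
  interpret TG: pair_sigma_finite period "gauss :: (real ^ 'd) measure" ..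
  interpret TT: pair_sigma_finite period period ..
  note s = Parseval[OF g e]
  have summ: "(\<lambda>m. (cmod (\<alpha> m))\<^sup>2 * mi_fact m) summable_on UNIV" and inf: "(\<Sum>\<^sub>\<infinity>m. (cmod (\<alpha> m))\<^sup>2 * mi_fact m) = sqnorm gauss g"
    using s by (auto simp: has_sum_iff)
  have K: "?K \<ge> 0" using lam_card_bounds(1)[where 'k='k] by simp
  have Hc: "sqnorm gauss (\<lambda>x. ?T t x - hsum (trunc n) (\<lambda>m. \<alpha> m * phase t m) ?c x) \<le> ?K * (sqnorm gauss g - hnorm2 (trunc n) \<alpha>)" for t n
  proof -
    let ?b = "\<lambda>m. if m \<in> trunc n then \<alpha> m else 0"
    have "hsum (trunc n) (\<lambda>m. \<alpha> m * phase t m) ?c x = hsum (trunc n) (\<lambda>m. ?b m * phase t m) ?c x" for x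
      unfolding hsum_def by (intro sum.cong) auto
    then have "sqnorm gauss (\<lambda>x. ?T t x - hsum (trunc n) (\<lambda>m. \<alpha> m * phase t m) ?c x)
        = sqnorm gauss (\<lambda>x. ?T t x - hsum (trunc n) (\<lambda>m. ?b m * phase t m) ?c x)" by (simp only:)
    also have "\<dots> \<le> ?K * (\<Sum>\<^sub>\<infinity>m. (cmod (\<alpha> m - ?b m))\<^sup>2 * mi_fact m)"
      by (rule Hop_approx[OF card_ge_1 g e finite_trunc _ tail_approximation(1)[OF s]]) simp
    also have "\<dots> \<le> ?K * (sqnorm gauss g - hnorm2 (trunc n) \<alpha>)"
      by (intro mult_left_mono tail_approximation(2)[OF s] K)
    finally show ?thesis .
  qed
  have "(\<lambda>n. ?K * (sqnorm gauss g - hnorm2 (trunc n) \<alpha>)) \<longlonglongrightarrow> ?K * (sqnorm gauss g - sqnorm gauss g)"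
    using hnorm2_trunc_tendsto[OF summ] unfolding inf by (intro tendsto_intros)
  then have lim0: "(\<lambda>n. ?K * (sqnorm gauss g - hnorm2 (trunc n) \<alpha>)) \<longlonglongrightarrow> 0" by simp
  have "\<forall>j. \<exists>n. n \<ge> j \<and> ?K * (sqnorm gauss g - hnorm2 (trunc n) \<alpha>) \<le> (1 / 4) ^ j"
  proof
    fix j :: nat
    have "\<forall>\<^sub>F n in sequentially. ?K * (sqnorm gauss g - hnorm2 (trunc n) \<alpha>) < (1 / 4) ^ j"
      by (rule order_tendstoD(2)[OF lim0]) simp
    then have "\<forall>\<^sub>F n in sequentially. n \<ge> j \<and> ?K * (sqnorm gauss g - hnorm2 (trunc n) \<alpha>) \<le> (1 / 4) ^ j"
      using eventually_ge_at_top[of j] by eventually_elim simp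
    from eventually_happens'[OF sequentially_bot this]
    show "\<exists>n. n \<ge> j \<and> ?K * (sqnorm gauss g - hnorm2 (trunc n) \<alpha>) \<le> (1 / 4) ^ j" .
  qed
  from choice[OF this] obtain n where n: "\<And>j. j \<le> n j" "\<And>j. ?K * (sqnorm gauss g - hnorm2 (trunc (n j)) \<alpha>) \<le> (1 / 4) ^ j"
    by blast
  define V where "V j t = hsum (trunc (n j)) (\<lambda>m. \<alpha> m * phase t m) ?c" for j t
  define W where "W t x = lim (\<lambda>j. V j t x)" for t x
  have VL: "V j t \<in> L2 gauss" for j t unfolding V_def by (rule hsum_L2)
  have dist: "sqnorm gauss (\<lambda>x. ?T t x - V j t x) \<le> (1 / 4) ^ j" for t j
    unfolding V_def by (rule order_trans[OF Hc n(2)])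
  have WT: "AE x in gauss. W t x = ?T t x" for t
  proof -
    have "AE x in gauss. (\<lambda>j. V j t x) \<longlonglongrightarrow> ?T t x"
      by (rule AE_tendsto_of_sqnorm[where C = 1, OF Hop_L2[OF card_ge_1 g] VL]) (use dist in simp)
    then show ?thesis unfolding W_def by eventually_elim (rule limI)
  qed
  have mV: "(\<lambda>p. V j (fst p) (snd p)) \<in> borel_measurable (period \<Otimes>\<^sub>M gauss)" for j
    unfolding V_def by (rule measurable_hsum_phase)
  have mW: "(\<lambda>p. W (fst p) (snd p)) \<in> borel_measurable (period \<Otimes>\<^sub>M gauss)"
    unfolding W_def by (rule borel_measurable_lim_metric[OF mV])
  have mD: "(\<lambda>p. W (fst p) (snd p) - V j (fst p) (snd p)) \<in> borel_measurable (period \<Otimes>\<^sub>M gauss)" for j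
    by (rule borel_measurable_diff[OF mW mV])
  have slice1: "(\<lambda>r. f (r, x)) \<in> borel_measurable period" if "f \<in> borel_measurable (period \<Otimes>\<^sub>M (gauss :: (real ^ 'd) measure))" for f :: "_ \<Rightarrow> 'z::topological_space" and x
    using measurable_Pair1[OF that, of x] by simp
  have mF: "(\<lambda>p. ennreal (Fejer N (t - fst p))) \<in> borel_measurable (period \<Otimes>\<^sub>M (gauss :: (real ^ 'd) measure))" for N t
    by (rule measurable_compose[OF measurable_fst measurable_period]) measurable
  have mF1: "(\<lambda>r. ennreal (Fejer N (t - r))) \<in> borel_measurable period" for N t
    by (rule measurable_period) measurable
  have mcmod: "(\<lambda>z. ennreal (cmod z)) \<in> borel_measurable borel" by measurable
  have mpow: "(\<lambda>z. ennreal (cmod z ^ (2 * ?k))) \<in> borel_measurable borel" by measurable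
  have near: "(\<integral>\<^sup>+x. ennreal (cmod (W t x - V j t x)) \<partial>gauss) \<le> ennreal (2 * (1 / 2) ^ j)" for t j
  proof -
    have "(\<integral>\<^sup>+x. ennreal (cmod (W t x - V j t x)) \<partial>gauss) = (\<integral>\<^sup>+x. ennreal (cmod (?T t x - V j t x)) \<partial>gauss)"
      by (rule nn_integral_cong_AE) (use WT[of t] in \<open>eventually_elim, simp\<close>)
    also have "\<dots> \<le> ennreal (2 * (1 / 2) ^ j)"
    proof (rule nn_integral_le_of_sqnorm[OF prob_space_gauss L2_diff[OF Hop_L2[OF card_ge_1 g] VL]])
      have "((1 / 2 :: real) ^ j)\<^sup>2 = (1 / 4) ^ j" by (simp add: power2_eq_square flip: power_mult_distrib)
      then show "sqnorm gauss (\<lambda>x. ?T t x - V j t x) \<le> ((1 / 2) ^ j)\<^sup>2" using dist by simp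
    qed simp
    finally show ?thesis .
  qed
  define J where "J t = (\<integral>\<^sup>+x. ennreal (cmod (W t x) ^ (2 * ?k)) \<partial>gauss)" for t
  have JT: "J t = (\<integral>\<^sup>+x. ennreal (cmod (?T t x) ^ (2 * ?k)) \<partial>gauss)" for t
    unfolding J_def by (rule nn_integral_cong_AE) (use WT[of t] in \<open>eventually_elim, simp\<close>)
  have mWp: "(\<lambda>p. ennreal (cmod (W (fst p) (snd p)) ^ (2 * ?k))) \<in> borel_measurable (period \<Otimes>\<^sub>M gauss)"
    by (rule measurable_compose[OF mW mpow])
  have mJ: "J \<in> borel_measurable period"
    unfolding J_def by (rule G.borel_measurable_nn_integral) (use mWp in \<open>simp add: case_prod_unfold\<close>)
  have mJl: "(\<lambda>r. J r ^ CARD('l)) \<in> borel_measurable period"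
    by (rule measurable_compose[OF mJ]) measurable
  let ?w = "\<lambda>N m. of_real (Fejer_weight N (mi_abs m)) * \<alpha> m"
  have mean: "(\<Sum>S. ennreal (level_form S (mat_prod (?w N) :: nat ^ 'd ^ 'k ^ 'l \<Rightarrow> complex))) \<le> (\<integral>\<^sup>+t. J t ^ CARD('l) \<partial>period)"
    if N: "N \<ge> 1" for N
  proof -
    define Y where "Y t = hsum (trunc N) (\<lambda>m. ?w N m * phase t m) ?c" for t
    \<comment> \<open>The finite expansion Y is the Fejer mean of every long partial sum V j, hence it is bounded by the mean of |W| plus an error ?e j whose integral tends to 0.\<close>
    have pw: "AE x in gauss. ennreal (cmod (Y t x)) \<le> (\<integral>\<^sup>+r. ennreal (Fejer N (t - r)) * ennreal (cmod (W r x)) \<partial>period)" for t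
    proof -
      let ?u = "\<lambda>x. \<integral>\<^sup>+r. ennreal (Fejer N (t - r)) * ennreal (cmod (W r x)) \<partial>period"
      let ?e = "\<lambda>j x. \<integral>\<^sup>+r. ennreal (Fejer N (t - r)) * ennreal (cmod (W r x - V j r x)) \<partial>period"
      have mu: "?u \<in> borel_measurable gauss"
        by (rule T.borel_measurable_nn_integral)
           (use measurable_compose[OF measurable_pair_swap' borel_measurable_times_ennreal[OF mF[of N t] measurable_compose[OF mW mcmod]]] in \<open>simp add: case_prod_unfold\<close>)
      have mE: "(\<lambda>p. ennreal (Fejer N (t - fst p)) * ennreal (cmod (W (fst p) (snd p) - V j (fst p) (snd p)))) \<in> borel_measurable (period \<Otimes>\<^sub>M gauss)" for j
        by (rule borel_measurable_times_ennreal[OF mF measurable_compose[OF mD mcmod]])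
      have le: "ennreal (cmod (Y t x)) \<le> ?u x + ?e j x" if j: "N \<le> j" for j x
      proof -
        have nj: "N \<le> n j" using n(1)[of j] j by simp
        let ?f = "\<lambda>r. of_real (Fejer N (t - r)) * V j r x"
        have "Y t x = (\<integral>r. ?f r \<partial>period)"
          unfolding Y_def V_def by (rule hsum_Fejer[OF nj])
        then have "ennreal (cmod (Y t x)) \<le> (\<integral>\<^sup>+r. ennreal (cmod (?f r)) \<partial>period)"
          using integral_norm_bound_ennreal[of period ?f] not_integrable_integral_eq[of period ?f]
          by (cases "integrable period ?f") auto
        also have "\<dots> \<le> (\<integral>\<^sup>+r. ennreal (Fejer N (t - r)) * ennreal (cmod (W r x)) + ennreal (Fejer N (t - r)) * ennreal (cmod (W r x - V j r x)) \<partial>period)"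
        proof (rule nn_integral_mono)
          fix r
          have "cmod (V j r x) \<le> cmod (W r x) + cmod (W r x - V j r x)"
            using norm_triangle_ineq4[of "W r x" "W r x - V j r x"] by simp
          then have "ennreal (cmod (V j r x)) \<le> ennreal (cmod (W r x)) + ennreal (cmod (W r x - V j r x))"
            by (simp add: ennreal_plus[symmetric] ennreal_leI del: ennreal_plus)
          from mult_left_mono[OF this, of "ennreal (Fejer N (t - r))"]
          show "ennreal (cmod (?f r)) \<le> ennreal (Fejer N (t - r)) * ennreal (cmod (W r x)) + ennreal (Fejer N (t - r)) * ennreal (cmod (W r x - V j r x))"
            by (simp add: norm_mult ennreal_mult Fejer_nonneg distrib_left)
        qed
        also have "\<dots> = ?u x + ?e j x"
          by (rule nn_integral_add)
             (use slice1[OF borel_measurable_times_ennreal[OF mF[of N t] measurable_compose[OF mW mcmod]], of x] slice1[OF mE, of x j] in simp_all)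
        finally show ?thesis .
      qed
      have ej: "(\<integral>\<^sup>+x. ?e j x \<partial>gauss) \<le> ennreal (2 * (1 / 2) ^ j)" for j
      proof -
        have "(\<integral>\<^sup>+x. ?e j x \<partial>gauss) = (\<integral>\<^sup>+r. \<integral>\<^sup>+x. ennreal (Fejer N (t - r)) * ennreal (cmod (W r x - V j r x)) \<partial>gauss \<partial>period)"
          using TG.Fubini[OF mE[of j]] by simp
        also have "\<dots> \<le> (\<integral>\<^sup>+r. ennreal (Fejer N (t - r)) * ennreal (2 * (1 / 2) ^ j) \<partial>period)"
        proof (rule nn_integral_mono)
          fix r assume r: "r \<in> space period"
          have "(\<lambda>x. ennreal (cmod (W r x - V j r x))) \<in> borel_measurable gauss"
            using measurable_Pair2[OF measurable_compose[OF mD mcmod] r] by simp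
          then have "(\<integral>\<^sup>+x. ennreal (Fejer N (t - r)) * ennreal (cmod (W r x - V j r x)) \<partial>gauss)
              = ennreal (Fejer N (t - r)) * (\<integral>\<^sup>+x. ennreal (cmod (W r x - V j r x)) \<partial>gauss)"
            by (rule nn_integral_cmult)
          also have "\<dots> \<le> ennreal (Fejer N (t - r)) * ennreal (2 * (1 / 2) ^ j)"
            by (intro mult_left_mono near) simp
          finally show "(\<integral>\<^sup>+x. ennreal (Fejer N (t - r)) * ennreal (cmod (W r x - V j r x)) \<partial>gauss) \<le> ennreal (Fejer N (t - r)) * ennreal (2 * (1 / 2) ^ j)" .
        qed
        also have "\<dots> = ennreal (2 * (1 / 2) ^ j)"
          by (simp only: nn_integral_multc[OF mF1] nn_integral_Fejer[OF N] mult_1_left)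
        finally show ?thesis .
      qed
      have mY: "(\<lambda>x. ennreal (cmod (Y t x))) \<in> borel_measurable gauss"
        unfolding Y_def by (rule measurable_compose[OF L2_measurable[OF hsum_L2] mcmod])
      have bound: "(\<integral>\<^sup>+x. ennreal (cmod (Y t x)) - ?u x \<partial>gauss) \<le> ennreal (2 * (1 / 2) ^ j)" if "N \<le> j" for j
      proof -
        have "(\<integral>\<^sup>+x. ennreal (cmod (Y t x)) - ?u x \<partial>gauss) \<le> (\<integral>\<^sup>+x. ?e j x \<partial>gauss)"
          by (intro nn_integral_mono) (use le[OF that] in \<open>simp add: ennreal_minus_le_iff\<close>)
        then show ?thesis using ej order_trans by blast
      qed
      have "(\<lambda>j. (1 / 2 :: real) ^ j) \<longlonglongrightarrow> 0" by (rule LIMSEQ_power_zero) simp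
      then have "(\<lambda>j. ennreal (2 * (1 / 2) ^ j)) \<longlonglongrightarrow> ennreal (2 * 0)"
        by (intro tendsto_ennrealI tendsto_mult tendsto_const)
      then have "(\<integral>\<^sup>+x. ennreal (cmod (Y t x)) - ?u x \<partial>gauss) \<le> ennreal (2 * 0)"
        by (rule LIMSEQ_le_const) (use bound in blast)
      then have "(\<integral>\<^sup>+x. ennreal (cmod (Y t x)) - ?u x \<partial>gauss) = 0" by simp
      then have "AE x in gauss. ennreal (cmod (Y t x)) - ?u x = 0"
        by (subst (asm) nn_integral_0_iff_AE) (use mY mu in \<open>auto intro: borel_measurable_minus_ennreal\<close>)
      then show ?thesis by eventually_elim (simp add: diff_eq_0_iff_ennreal)
    qed
    \<comment> \<open>Jensen's inequality is applied to the Fejer mean first for the power 2 k and then, after integrating over space, for the power l.\<close>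
    have point: "(\<integral>\<^sup>+x. ennreal (cmod (Y t x) ^ (2 * ?k)) \<partial>gauss) ^ CARD('l) \<le> (\<integral>\<^sup>+r. ennreal (Fejer N (t - r)) * J r ^ CARD('l) \<partial>period)" for t
    proof -
      obtain k' where k': "2 * ?k = Suc k'" by (metis card_ge_1 mult_2 not_one_le_zero old.nat.exhaust add_is_0)
      obtain l' where l': "CARD('l) = Suc l'" by (metis card_ge_1 not_one_le_zero old.nat.exhaust)
      have "(\<integral>\<^sup>+x. ennreal (cmod (Y t x) ^ (2 * ?k)) \<partial>gauss)
          \<le> (\<integral>\<^sup>+x. (\<integral>\<^sup>+r. ennreal (Fejer N (t - r)) * ennreal (cmod (W r x)) \<partial>period) ^ (2 * ?k) \<partial>gauss)"
        by (rule nn_integral_mono_AE, use pw[of t] in eventually_elim)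
           (simp add: ennreal_power[symmetric] power_mono)
      also have "\<dots> \<le> (\<integral>\<^sup>+x. (\<integral>\<^sup>+r. ennreal (Fejer N (t - r)) * ennreal (cmod (W r x) ^ (2 * ?k)) \<partial>period) \<partial>gauss)"
      proof (rule nn_integral_mono)
        fix x
        have m: "(\<lambda>r. ennreal (cmod (W r x))) \<in> borel_measurable period"
          using slice1[OF measurable_compose[OF mW mcmod], of x] by simp
        show "(\<integral>\<^sup>+r. ennreal (Fejer N (t - r)) * ennreal (cmod (W r x)) \<partial>period) ^ (2 * ?k)
          \<le> (\<integral>\<^sup>+r. ennreal (Fejer N (t - r)) * ennreal (cmod (W r x) ^ (2 * ?k)) \<partial>period)"
          using nn_integral_weighted_power_le[where n = k', OF mF1[of N t] m nn_integral_Fejer(1)[OF N]] unfolding k' by (simp only: ennreal_power norm_ge_zero)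
      qed
      also have "\<dots> = (\<integral>\<^sup>+r. (\<integral>\<^sup>+x. ennreal (Fejer N (t - r)) * ennreal (cmod (W r x) ^ (2 * ?k)) \<partial>gauss) \<partial>period)"
        using TG.Fubini[OF borel_measurable_times_ennreal[OF mF[of N t] mWp]] by simp
      also have "\<dots> = (\<integral>\<^sup>+r. ennreal (Fejer N (t - r)) * J r \<partial>period)"
        unfolding J_def
      proof (rule nn_integral_cong)
        fix r assume r: "r \<in> space period"
        show "(\<integral>\<^sup>+x. ennreal (Fejer N (t - r)) * ennreal (cmod (W r x) ^ (2 * ?k)) \<partial>gauss)
            = ennreal (Fejer N (t - r)) * (\<integral>\<^sup>+x. ennreal (cmod (W r x) ^ (2 * ?k)) \<partial>gauss)"
          by (rule nn_integral_cmult) (use measurable_Pair2[OF mWp r] in simp)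
      qed
      finally have "(\<integral>\<^sup>+x. ennreal (cmod (Y t x) ^ (2 * ?k)) \<partial>gauss) ^ CARD('l) \<le> (\<integral>\<^sup>+r. ennreal (Fejer N (t - r)) * J r \<partial>period) ^ CARD('l)"
        by (rule power_mono) simp
      also have "\<dots> \<le> (\<integral>\<^sup>+r. ennreal (Fejer N (t - r)) * J r ^ CARD('l) \<partial>period)"
        unfolding l' by (rule nn_integral_weighted_power_le[OF mF1 mJ nn_integral_Fejer(1)[OF N]])
      finally show ?thesis .
    qed
    have mFF: "(\<lambda>p. ennreal (Fejer N (snd p - fst p)) * J (fst p) ^ CARD('l)) \<in> borel_measurable (period \<Otimes>\<^sub>M period)"
    proof (rule borel_measurable_times_ennreal)
      have "(\<lambda>p. snd p - fst p) \<in> borel_measurable (period \<Otimes>\<^sub>M period)"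
        by (intro borel_measurable_diff measurable_compose[OF measurable_fst measurable_period] measurable_compose[OF measurable_snd measurable_period]) simp_all
      then show "(\<lambda>p. ennreal (Fejer N (snd p - fst p))) \<in> borel_measurable (period \<Otimes>\<^sub>M period)"
        by (rule measurable_compose) measurable
      show "(\<lambda>p. J (fst p) ^ CARD('l)) \<in> borel_measurable (period \<Otimes>\<^sub>M period)"
        by (rule measurable_compose[OF measurable_fst mJl])
    qed
    have off: "?w N m = 0" if "m \<notin> trunc N" for m using that by (simp add: trunc_def Fejer_weight_def)
    have "(\<Sum>S. ennreal (level_form S (mat_prod (?w N) :: nat ^ 'd ^ 'k ^ 'l \<Rightarrow> complex)))
        = (\<integral>\<^sup>+t. (\<integral>\<^sup>+x. ennreal (cmod (Y t x) ^ (2 * ?k)) \<partial>gauss) ^ CARD('l) \<partial>period)"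
      unfolding Y_def by (rule finite_expansion_identity[OF finite_trunc off, symmetric])
    also have "\<dots> \<le> (\<integral>\<^sup>+t. \<integral>\<^sup>+r. ennreal (Fejer N (t - r)) * J r ^ CARD('l) \<partial>period \<partial>period)"
      by (rule nn_integral_mono) (rule point)
    also have "\<dots> = (\<integral>\<^sup>+r. \<integral>\<^sup>+t. ennreal (Fejer N (t - r)) * J r ^ CARD('l) \<partial>period \<partial>period)"
      using TT.Fubini[OF mFF] by simp
    also have "\<dots> = (\<integral>\<^sup>+r. J r ^ CARD('l) \<partial>period)"
    proof (rule nn_integral_cong)
      fix r
      have "(\<lambda>t. ennreal (Fejer N (t - r))) \<in> borel_measurable period" by (rule measurable_period) measurable
      then show "(\<integral>\<^sup>+t. ennreal (Fejer N (t - r)) * J r ^ CARD('l) \<partial>period) = J r ^ CARD('l)"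
        by (simp only: nn_integral_multc nn_integral_Fejer(2)[OF N] mult_1_left)
    qed
    finally show ?thesis .
  qed
  have "(\<Sum>S<n. ennreal (level_form S (mat_prod \<alpha> :: nat ^ 'd ^ 'k ^ 'l \<Rightarrow> complex))) \<le> (\<integral>\<^sup>+t. J t ^ CARD('l) \<partial>period)" for n
  proof (rule LIMSEQ_le_const2)
    show "(\<lambda>N. \<Sum>S<n. ennreal (level_form S (mat_prod (?w N) :: nat ^ 'd ^ 'k ^ 'l \<Rightarrow> complex)))
        \<longlonglongrightarrow> (\<Sum>S<n. ennreal (level_form S (mat_prod \<alpha> :: nat ^ 'd ^ 'k ^ 'l \<Rightarrow> complex)))"
    proof (intro tendsto_sum tendsto_ennrealI level_form_tendsto)
      fix M :: "nat ^ 'd ^ 'k ^ 'l"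
      have "(\<lambda>N. mat_prod (?w N) M) \<longlonglongrightarrow> (\<Prod>i\<in>UNIV. \<Prod>j\<in>UNIV. of_real 1 * \<alpha> (M $ i $ j))"
        unfolding mat_prod_def by (intro tendsto_prod tendsto_mult tendsto_of_real Fejer_weight_tendsto tendsto_const)
      then show "(\<lambda>N. mat_prod (?w N) M) \<longlonglongrightarrow> mat_prod \<alpha> M" by (simp add: mat_prod_def)
    qed
    have "(\<Sum>S<n. ennreal (level_form S (mat_prod (?w N) :: nat ^ 'd ^ 'k ^ 'l \<Rightarrow> complex))) \<le> (\<integral>\<^sup>+t. J t ^ CARD('l) \<partial>period)" if "N \<ge> 1" for N
      by (rule order_trans[OF sum_le_suminf mean[OF that]]) auto
    then show "\<exists>M. \<forall>N\<ge>M. (\<Sum>S<n. ennreal (level_form S (mat_prod (?w N) :: nat ^ 'd ^ 'k ^ 'l \<Rightarrow> complex))) \<le> (\<integral>\<^sup>+t. J t ^ CARD('l) \<partial>period)"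
      by blast
  qed
  then have "(\<Sum>S. ennreal (level_form S (mat_prod \<alpha> :: nat ^ 'd ^ 'k ^ 'l \<Rightarrow> complex))) \<le> (\<integral>\<^sup>+t. J t ^ CARD('l) \<partial>period)"
    unfolding suminf_eq_SUP by (intro SUP_least)
  then show ?thesis unfolding JT .
qed

section \<open>The space-time integral and the three assertions\<close>

lemma mixed_norm_eq_Pform:
  fixes g :: "real ^ 'd \<Rightarrow> complex"
  assumes mu: "\<mu> = (real CARD('k::finite) - 1) * real CARD('l::finite) * real CARD('d::finite) / 2" and "\<mu> > 0"
    and "g \<in> L2 gauss" and "has_hermite_expansion g \<alpha>"
  shows "(\<integral>\<^sup>+t\<in>{-1/2..1/2}. (\<integral>\<^sup>+x. ennreal (cmod (Hop CARD('k) t g x) ^ (2 * CARD('k))) \<partial>gauss) ^ CARD('l) \<partial>lborel)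
    = Pform (mat_prod \<alpha> :: nat ^ 'd ^ 'k ^ 'l \<Rightarrow> complex)"
  unfolding nn_integral_period[symmetric] Pform_level
  by (rule antisym[OF mixed_norm_le_forms[OF assms] forms_le_mixed_norm[OF assms(3,4)]])

lemma Pform_eq_Fock_inner:
  assumes "(\<lambda>M. \<phi> M * cnj (Pop \<phi> M) * of_real (mat_fact M)) summable_on UNIV"
  shows "Pform \<phi> < \<infinity>" "of_real (enn2real (Pform \<phi>)) = Fock_inner \<phi> (Pop \<phi>)"
proof -
  have s: "(\<lambda>S. complex_of_real (level_form S \<phi>)) sums Fock_inner \<phi> (Pop \<phi>)"
    using Fock_inner_sums[OF assms] by (simp add: level_inner_Pop_self)
  have Re: "(\<lambda>S. level_form S \<phi>) sums Re (Fock_inner \<phi> (Pop \<phi>))"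
    using sums_Re[OF s] by simp
  have "(\<lambda>S. 0 :: real) sums Im (Fock_inner \<phi> (Pop \<phi>))" using sums_Im[OF s] by simp
  then have Im: "Im (Fock_inner \<phi> (Pop \<phi>)) = 0" by (rule sums_unique2) (rule sums_zero)
  have P: "Pform \<phi> = ennreal (Re (Fock_inner \<phi> (Pop \<phi>)))"
    unfolding Pform_level by (rule suminf_ennreal_eq[OF level_form_nonneg Re])
  have nn: "Re (Fock_inner \<phi> (Pop \<phi>)) \<ge> 0"
    by (rule sums_le[OF level_form_nonneg sums_zero Re])
  show "Pform \<phi> < \<infinity>" unfolding P by simp
  show "of_real (enn2real (Pform \<phi>)) = Fock_inner \<phi> (Pop \<phi>)"
    unfolding P using nn Im by (simp add: complex_eq_iff)
qed

lemma Fock_norm_eq_of_has_sum: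
  assumes "((\<lambda>M. (cmod (\<phi> M))\<^sup>2 * mat_fact M) has_sum s) UNIV"
  shows "\<phi> \<in> Fock" "(Fock_norm \<phi>)\<^sup>2 = s"
proof -
  show "\<phi> \<in> Fock" unfolding Fock_def mem_Collect_eq by (rule has_sum_imp_summable[OF assms])
  have s0: "s \<ge> 0"
    by (rule has_sum_nonneg[OF assms]) (auto intro!: mult_nonneg_nonneg less_imp_le[OF mat_fact_pos])
  have "((\<lambda>M. complex_of_real ((cmod (\<phi> M))\<^sup>2 * mat_fact M)) has_sum of_real s) UNIV"
    by (rule has_sum_of_real[OF assms])
  moreover have "complex_of_real ((cmod (\<phi> M))\<^sup>2 * mat_fact M) = \<phi> M * cnj (\<phi> M) * of_real (mat_fact M)" for M
    by (simp only: of_real_mult complex_norm_square)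
  ultimately have "Fock_inner \<phi> \<phi> = of_real s"
    unfolding Fock_inner_def by (simp only:) (rule infsumI)
  then show "(Fock_norm \<phi>)\<^sup>2 = s" unfolding Fock_norm_def using s0 by simp
qed

theorem theorem3:
  fixes \<mu> :: real
  assumes k_ge_2: "CARD('k::finite) \<ge> 2"
    and mu: "\<mu> = (real CARD('k) - 1) * real CARD('l::finite) * real CARD('d::finite) / 2"
  shows
    "(\<forall>(g :: real ^ 'd \<Rightarrow> complex) (\<alpha> :: nat ^ 'd \<Rightarrow> complex)
        (\<phi> :: nat ^ 'd ^ 'k ^ 'l \<Rightarrow> complex) (I :: ennreal).
        g \<in> L2 gauss \<and> has_hermite_expansion g \<alpha> \<and>
        \<phi> = (\<lambda>M. \<Prod>i\<in>UNIV. \<Prod>j\<in>UNIV. \<alpha> (M $ i $ j)) \<and>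
        I = (\<integral>\<^sup>+t\<in>{-1/2..1/2}.
               (\<integral>\<^sup>+x. ennreal (cmod (Hop CARD('k) t g x) ^ (2 * CARD('k))) \<partial>gauss) ^ CARD('l) \<partial>lborel)
        \<longrightarrow>
          (\<forall>S. Fock_inner (level_part S \<phi>) (Pop (level_part S \<phi>)) \<in> \<real> \<and>
               Re (Fock_inner (level_part S \<phi>) (Pop (level_part S \<phi>))) \<ge> 0) \<and>
          I = Pform \<phi> \<and>
          (Pop \<phi> \<in> Fock \<longrightarrow>
             (\<lambda>M. \<phi> M * cnj (Pop \<phi> M) * of_real (mat_fact M)) summable_on UNIV) \<and>
          ((\<lambda>M. \<phi> M * cnj (Pop \<phi> M) * of_real (mat_fact M)) summable_on UNIV \<longrightarrow>
             I < \<infinity> \<and> of_real (enn2real I) = Fock_inner \<phi> (Pop \<phi>)) \<and>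
          \<phi> \<in> Fock \<and>
          (\<integral>x. (cmod (g x))\<^sup>2 \<partial>gauss) ^ (CARD('k) * CARD('l)) = (Fock_norm \<phi>)\<^sup>2)
     \<and>
     ((\<forall>S. Pop ` (Fock_level S :: (nat ^ 'd ^ 'k ^ 'l \<Rightarrow> complex) set) \<subseteq> Fock_level S) \<and>
      ((\<forall>S. \<forall>\<phi>\<in>Fock_level S :: (nat ^ 'd ^ 'k ^ 'l \<Rightarrow> complex) set. Pop (Pop \<phi>) = Pop \<phi>)
         \<longleftrightarrow> \<mu> = 1) \<and>
      (\<forall>S\<ge>2. (\<forall>\<phi>\<in>Fock_level S :: (nat ^ 'd ^ 'k ^ 'l \<Rightarrow> complex) set. Pop (Pop \<phi>) = Pop \<phi>)
         \<longleftrightarrow> \<mu> = 1) \<and>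
      (\<forall>S. (\<forall>\<phi>\<in>Fock_level S :: (nat ^ 'd ^ 'k ^ 'l \<Rightarrow> complex) set. Pop (Pop \<phi>) = Pop \<phi>)
         \<longrightarrow> projection_on (Fock_level S :: (nat ^ 'd ^ 'k ^ 'l \<Rightarrow> complex) set) Pop) \<and>
      (\<mu> = 1 \<longrightarrow>
         Pop ` (Fock :: (nat ^ 'd ^ 'k ^ 'l \<Rightarrow> complex) set) \<subseteq> Fock \<and>
         projection_on (Fock :: (nat ^ 'd ^ 'k ^ 'l \<Rightarrow> complex) set) Pop))
     \<and>
     (\<mu> > 1 \<longrightarrow>
        (\<forall>S. Fock_opnorm (Fock_level S :: (nat ^ 'd ^ 'k ^ 'l \<Rightarrow> complex) set) Pop
              = ennreal (pochhammer \<mu> (S div 2) / fact (S div 2))) \<and>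
        (\<lambda>S. pochhammer \<mu> (S div 2) / fact (S div 2))
          \<sim>[sequentially] (\<lambda>S. real S powr (\<mu> - 1) / (2 powr (\<mu> - 1) * Gamma \<mu>)) \<and>
        \<not> (\<exists>C. \<forall>\<phi>\<in>Fock :: (nat ^ 'd ^ 'k ^ 'l \<Rightarrow> complex) set.
               Pop \<phi> \<in> Fock \<longrightarrow> Fock_norm (Pop \<phi>) \<le> C * Fock_norm \<phi>))"
proof (intro conjI)
  have "real CARD('k) - 1 > 0" using k_ge_2 by simp
  then have pos: "\<mu> > 0" unfolding mu by (intro divide_pos_pos mult_pos_pos) auto
  show "(\<forall>(g :: real ^ 'd \<Rightarrow> complex) (\<alpha> :: nat ^ 'd \<Rightarrow> complex)
        (\<phi> :: nat ^ 'd ^ 'k ^ 'l \<Rightarrow> complex) (I :: ennreal).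
        g \<in> L2 gauss \<and> has_hermite_expansion g \<alpha> \<and>
        \<phi> = (\<lambda>M. \<Prod>i\<in>UNIV. \<Prod>j\<in>UNIV. \<alpha> (M $ i $ j)) \<and>
        I = (\<integral>\<^sup>+t\<in>{-1/2..1/2}.
               (\<integral>\<^sup>+x. ennreal (cmod (Hop CARD('k) t g x) ^ (2 * CARD('k))) \<partial>gauss) ^ CARD('l) \<partial>lborel)
        \<longrightarrow>
          (\<forall>S. Fock_inner (level_part S \<phi>) (Pop (level_part S \<phi>)) \<in> \<real> \<and>
               Re (Fock_inner (level_part S \<phi>) (Pop (level_part S \<phi>))) \<ge> 0) \<and>
          I = Pform \<phi> \<and>
          (Pop \<phi> \<in> Fock \<longrightarrow>
             (\<lambda>M. \<phi> M * cnj (Pop \<phi> M) * of_real (mat_fact M)) summable_on UNIV) \<and>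
          ((\<lambda>M. \<phi> M * cnj (Pop \<phi> M) * of_real (mat_fact M)) summable_on UNIV \<longrightarrow>
             I < \<infinity> \<and> of_real (enn2real I) = Fock_inner \<phi> (Pop \<phi>)) \<and>
          \<phi> \<in> Fock \<and>
          (\<integral>x. (cmod (g x))\<^sup>2 \<partial>gauss) ^ (CARD('k) * CARD('l)) = (Fock_norm \<phi>)\<^sup>2)"
  proof (intro allI impI)
    fix g :: "real ^ 'd \<Rightarrow> complex" and \<alpha> :: "nat ^ 'd \<Rightarrow> complex"
      and \<phi> :: "nat ^ 'd ^ 'k ^ 'l \<Rightarrow> complex" and I :: ennreal
    assume "g \<in> L2 gauss \<and> has_hermite_expansion g \<alpha> \<and>
        \<phi> = (\<lambda>M. \<Prod>i\<in>UNIV. \<Prod>j\<in>UNIV. \<alpha> (M $ i $ j)) \<and>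
        I = (\<integral>\<^sup>+t\<in>{-1/2..1/2}.
               (\<integral>\<^sup>+x. ennreal (cmod (Hop CARD('k) t g x) ^ (2 * CARD('k))) \<partial>gauss) ^ CARD('l) \<partial>lborel)"
    then have g: "g \<in> L2 gauss" and e: "has_hermite_expansion g \<alpha>"
      and \<phi>: "\<phi> = mat_prod \<alpha>" and I: "I = Pform \<phi>"
      using mixed_norm_eq_Pform[OF mu pos] by (auto simp: mat_prod_def[abs_def])
    have "((\<lambda>M. (cmod (\<phi> M))\<^sup>2 * mat_fact M) has_sum (\<integral>x. (cmod (g x))\<^sup>2 \<partial>gauss) ^ (CARD('k) * CARD('l))) UNIV"
      unfolding \<phi> by (rule mat_prod_Fock[OF Parseval[OF g e]])
    note norm = Fock_norm_eq_of_has_sum[OF this]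
    have real: "\<forall>S. Fock_inner (level_part S \<phi>) (Pop (level_part S \<phi>)) \<in> \<real> \<and>
               Re (Fock_inner (level_part S \<phi>) (Pop (level_part S \<phi>))) \<ge> 0"
      by (simp add: level_part_inner level_form_nonneg)
    show "(\<forall>S. Fock_inner (level_part S \<phi>) (Pop (level_part S \<phi>)) \<in> \<real> \<and>
               Re (Fock_inner (level_part S \<phi>) (Pop (level_part S \<phi>))) \<ge> 0) \<and>
          I = Pform \<phi> \<and>
          (Pop \<phi> \<in> Fock \<longrightarrow>
             (\<lambda>M. \<phi> M * cnj (Pop \<phi> M) * of_real (mat_fact M)) summable_on UNIV) \<and>
          ((\<lambda>M. \<phi> M * cnj (Pop \<phi> M) * of_real (mat_fact M)) summable_on UNIV \<longrightarrow>
             I < \<infinity> \<and> of_real (enn2real I) = Fock_inner \<phi> (Pop \<phi>)) \<and>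
          \<phi> \<in> Fock \<and>
          (\<integral>x. (cmod (g x))\<^sup>2 \<partial>gauss) ^ (CARD('k) * CARD('l)) = (Fock_norm \<phi>)\<^sup>2"
      unfolding I
      by (intro conjI impI real refl norm(1) norm(2)[symmetric])
         (erule Fock_product_summable[OF norm(1)] Pform_eq_Fock_inner)+
  qed
  show "\<forall>S. Pop ` (Fock_level S :: (nat ^ 'd ^ 'k ^ 'l \<Rightarrow> complex) set) \<subseteq> Fock_level S"
    using Pop_level by (intro allI image_subsetI)
  note iff = Pop_idempotent_on_level_iff[OF mu pos]
  show "(\<forall>S. \<forall>\<phi>\<in>Fock_level S :: (nat ^ 'd ^ 'k ^ 'l \<Rightarrow> complex) set. Pop (Pop \<phi>) = Pop \<phi>) \<longleftrightarrow> \<mu> = 1"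
    using iff[OF order_refl] Pop_Pop_eq[OF mu] by (intro iffI) simp_all
  show "\<forall>S\<ge>2. (\<forall>\<phi>\<in>Fock_level S :: (nat ^ 'd ^ 'k ^ 'l \<Rightarrow> complex) set. Pop (Pop \<phi>) = Pop \<phi>) \<longleftrightarrow> \<mu> = 1"
    using iff by (intro allI impI)
  show "\<forall>S. (\<forall>\<phi>\<in>Fock_level S :: (nat ^ 'd ^ 'k ^ 'l \<Rightarrow> complex) set. Pop (Pop \<phi>) = Pop \<phi>)
         \<longrightarrow> projection_on (Fock_level S :: (nat ^ 'd ^ 'k ^ 'l \<Rightarrow> complex) set) Pop"
    by (intro allI impI projection_on_level)
  show "\<mu> = 1 \<longrightarrow>
         Pop ` (Fock :: (nat ^ 'd ^ 'k ^ 'l \<Rightarrow> complex) set) \<subseteq> Fock \<and>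
         projection_on (Fock :: (nat ^ 'd ^ 'k ^ 'l \<Rightarrow> complex) set) Pop"
    by (intro impI conjI image_subsetI Pop_Fock[OF mu] projection_on_Fock[OF mu])
  show "\<mu> > 1 \<longrightarrow>
        (\<forall>S. Fock_opnorm (Fock_level S :: (nat ^ 'd ^ 'k ^ 'l \<Rightarrow> complex) set) Pop
              = ennreal (pochhammer \<mu> (S div 2) / fact (S div 2))) \<and>
        (\<lambda>S. pochhammer \<mu> (S div 2) / fact (S div 2))
          \<sim>[sequentially] (\<lambda>S. real S powr (\<mu> - 1) / (2 powr (\<mu> - 1) * Gamma \<mu>)) \<and>
        \<not> (\<exists>C. \<forall>\<phi>\<in>Fock :: (nat ^ 'd ^ 'k ^ 'l \<Rightarrow> complex) set.
               Pop \<phi> \<in> Fock \<longrightarrow> Fock_norm (Pop \<phi>) \<le> C * Fock_norm \<phi>)"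
    by (intro impI conjI allI Fock_opnorm_level[OF mu less_imp_le] pochhammer_fact_asymp_equiv[OF pos] Pop_unbounded[OF mu])
qed

end
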